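(* Let $K\subset\mathbb{C}$ be an imaginary quadratic field with ring of integers $\mathcal{O}_K$. Let $\mathfrak a$, $\mathfrak q$ be nonzero ideals of $\mathcal{O}_K$, let $\alpha \in \mathcal{O}_K$ with $\mathfrak a + \mathfrak q = \alpha\mathcal{O}_K + \mathfrak q = \mathcal{O}_K$, and let $\epsilon>0$. Then, for $t \geq 0$, $$\sum_{\substack{\rho \bmod \mathfrak q\\ \rho\mathcal{O}_K + \mathfrak q = \mathcal{O}_K}}\ \sum_{\substack{z \in \mathfrak a\\ z \equiv \alpha\rho^2 \bmod \mathfrak q\\ z\overline{z}\leq t}}1 = \frac{2\pi\,\phi_K^*(\mathfrak q)}{\sqrt{|\Delta_K|}\,\mathrm{N}\mathfrak a}\,t + O_\epsilon\!\left(\left(\frac{t}{\mathrm{N}\mathfrak a}\right)^{1/3}\mathrm{N}\mathfrak q^{1/3+\epsilon} + 2^{\omega_K(\mathfrak q)}\,\mathrm{N}\mathfrak q^{1/2}\right),$$ where $\rho$ runs over a reduced residue system of $\mathcal{O}_K$ modulo $\mathfrak q$, and the implied constant depends only on $K$ and $\epsilon$.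
   Context: $\Delta_K$ is the discriminant of $K$ and $\mathrm{N}$ the absolute norm of ideals. $\omega_K(\mathfrak q)$ is the number of distinct prime ideals dividing $\mathfrak q$, $\phi_K(\mathfrak q) = |(\mathcal{O}_K/\mathfrak q)^\times|$ is Euler's function on nonzero ideals, and $\phi_K^*(\mathfrak q) := \phi_K(\mathfrak q)/\mathrm{N}\mathfrak q$. *)

theory Defs
  imports
    "HOL-Analysis.Analysis"
    "HOL-Algebra.Algebraic_Closure_Type"
    "HOL-Algebra.Algebra"
begin

abbreviation complex_ring :: "complex ring" where
  "complex_ring \<equiv> ring_of_type_algebra"

definition imaginary_quadratic_field :: "complex set \<Rightarrow> bool" where
  "imaginary_quadratic_field K \<longleftrightarrow>
     subfield K complex_ring \<and> ring.dimension complex_ring 2 \<rat> K \<and> \<not> K \<subseteq> \<real>"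

definition ring_of_integers :: "complex set \<Rightarrow> complex ring" where
  "ring_of_integers K = complex_ring\<lparr>carrier := {x \<in> K. algebraic_int x}\<rparr>"

definition integral_basis :: "complex set \<Rightarrow> complex \<Rightarrow> complex \<Rightarrow> bool" where
  "integral_basis K w1 w2 \<longleftrightarrow>
     w1 \<in> carrier (ring_of_integers K) \<and> w2 \<in> carrier (ring_of_integers K) \<and>
     (\<forall>z \<in> carrier (ring_of_integers K).
        \<exists>!(m, n). z = of_int m * w1 + of_int n * w2)"

text \<open>
  The discriminant of a quadratic field is the square of the determinant of the matrix of the
  conjugates of an integral basis.  For an imaginary quadratic \<open>K\<close> the two embeddings of \<open>K\<close>
  into the complex numbers are the inclusion and its complex conjugate.  The value does not
  depend on the basis (lemma \<open>integral_basis_discriminant_unique\<close> below).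
\<close>

definition discriminant :: "complex set \<Rightarrow> int" where
  "discriminant K =
     (THE d. \<exists>w1 w2. integral_basis K w1 w2 \<and> of_int d = (w1 * cnj w2 - w2 * cnj w1)\<^sup>2)"

lemma integral_basis_discriminant_unique:
  assumes w: "integral_basis K w1 w2" and v: "integral_basis K v1 v2"
  shows "(w1 * cnj w2 - w2 * cnj w1)\<^sup>2 = (v1 * cnj v2 - v2 * cnj v1)\<^sup>2"
proof -
  have change: "\<exists>D::int. y1 * cnj y2 - y2 * cnj y1 = of_int D * (x1 * cnj x2 - x2 * cnj x1)"
    if x: "integral_basis K x1 x2" and y: "integral_basis K y1 y2" for x1 x2 y1 y2
  proof -
    have comb: "\<exists>m n. z = of_int m * x1 + of_int n * x2"
      if "z \<in> carrier (ring_of_integers K)" for z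
    proof -
      have "\<exists>!p. case p of (m, n) \<Rightarrow> z = of_int m * x1 + of_int n * x2"
        using x that unfolding integral_basis_def by blast
      then obtain p where "case p of (m, n) \<Rightarrow> z = of_int m * x1 + of_int n * x2"
        by (rule ex1E)
      then show ?thesis by (cases p) auto
    qed
    have mem: "y1 \<in> carrier (ring_of_integers K)" "y2 \<in> carrier (ring_of_integers K)"
      using y unfolding integral_basis_def by simp_all
    obtain a b where ab: "y1 = of_int a * x1 + of_int b * x2"
      using comb[OF mem(1)] by blast
    obtain c d where cd: "y2 = of_int c * x1 + of_int d * x2"
      using comb[OF mem(2)] by blast
    have "y1 * cnj y2 - y2 * cnj y1 = of_int (a * d - b * c) * (x1 * cnj x2 - x2 * cnj x1)"
      unfolding ab cd by (simp add: algebra_simps)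
    then show ?thesis by blast
  qed
  obtain D where D: "v1 * cnj v2 - v2 * cnj v1 = of_int D * (w1 * cnj w2 - w2 * cnj w1)"
    using change[OF w v] by blast
  obtain E where E: "w1 * cnj w2 - w2 * cnj w1 = of_int E * (v1 * cnj v2 - v2 * cnj v1)"
    using change[OF v w] by blast
  show ?thesis
  proof (cases "w1 * cnj w2 - w2 * cnj w1 = 0")
    case True
    then show ?thesis using D by simp
  next
    case False
    have "w1 * cnj w2 - w2 * cnj w1 = of_int (E * D) * (w1 * cnj w2 - w2 * cnj w1)"
      using E D by (simp add: mult.assoc)
    then have "of_int (E * D) = (1::complex)" using False by simp
    then have "E * D = 1" unfolding of_int_eq_1_iff .
    then have "D = 1 \<or> D = -1" by (simp add: zmult_eq_1_iff) auto
    then have "(of_int D)\<^sup>2 = (1::complex)" by auto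
    then show ?thesis unfolding D by (simp add: power_mult_distrib)
  qed
qed

definition ideal_norm :: "complex set \<Rightarrow> complex set \<Rightarrow> nat" where
  "ideal_norm K I = card (carrier (ring_of_integers K Quot I))"

definition ideal_phi :: "complex set \<Rightarrow> complex set \<Rightarrow> nat" where
  "ideal_phi K I = card (Units (ring_of_integers K Quot I))"

definition ideal_phi_star :: "complex set \<Rightarrow> complex set \<Rightarrow> real" where
  "ideal_phi_star K I = real (ideal_phi K I) / real (ideal_norm K I)"

definition ideal_dvd :: "complex set \<Rightarrow> complex set \<Rightarrow> complex set \<Rightarrow> bool" where
  "ideal_dvd K I J \<longleftrightarrow>
     (\<exists>B. ideal B (ring_of_integers K) \<and> J = ideal_prod (ring_of_integers K) I B)"

definition ideal_omega :: "complex set \<Rightarrow> complex set \<Rightarrow> nat" where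
  "ideal_omega K I = card {P. primeideal P (ring_of_integers K) \<and> ideal_dvd K P I}"

definition ideals_coprime :: "complex set \<Rightarrow> complex set \<Rightarrow> complex set \<Rightarrow> bool" where
  "ideals_coprime K I J \<longleftrightarrow>
     I <+>\<^bsub>ring_of_integers K\<^esub> J = carrier (ring_of_integers K)"

definition coprime_to_ideal :: "complex set \<Rightarrow> complex \<Rightarrow> complex set \<Rightarrow> bool" where
  "coprime_to_ideal K x I \<longleftrightarrow> ideals_coprime K (PIdl\<^bsub>ring_of_integers K\<^esub> x) I"

definition reduced_residue_system :: "complex set \<Rightarrow> complex set \<Rightarrow> complex set \<Rightarrow> bool" where
  "reduced_residue_system K I S \<longleftrightarrow>
     S \<subseteq> {x \<in> carrier (ring_of_integers K). coprime_to_ideal K x I} \<and>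
     (\<forall>x \<in> carrier (ring_of_integers K). coprime_to_ideal K x I \<longrightarrow> (\<exists>!s. s \<in> S \<and> x - s \<in> I))"

end

theory Submission
  imports Defs
begin

text \<open>
  For \<open>t\<close> up to \<open>N \<aa> (N \<qq>)\<^sup>1\<^sup>/\<^sup>2\<close> it suffices to count points of \<open>\<aa>\<close> in the disc and to bound the number
  of square roots modulo \<open>\<qq>\<close>.  For larger \<open>t\<close> the indicator of the disc of radius \<open>R = \<surd>t\<close> is
  smoothed at scale \<open>\<delta>\<close> and Poisson summation is applied on the translates of \<open>\<aa> \<inter> \<qq>\<close> that carry the
  points \<open>z \<equiv> \<alpha>\<rho>\<^sup>2\<close>.  The frequency 0 gives the main term.  A frequency \<open>w \<noteq> 0\<close> carries a quadratic
  Gauss sum of size at most \<open>(N \<qq>)\<^sup>1\<^sup>+\<^sup>\<epsilon> (N c)\<^sup>-\<^sup>1\<^sup>/\<^sup>2\<close>, where \<open>c \<supseteq> \<qq>\<close> is the annihilator of the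
  additive character attached to \<open>w\<close>, times the transform of the smoothed disc, which is at
  most a constant times \<open>R\<^sup>1\<^sup>/\<^sup>2 |w|\<^sup>-\<^sup>3\<^sup>/\<^sup>2 min(1, (\<delta>|w|)\<^sup>-\<^sup>3\<^sup>/\<^sup>2)\<close>.  Such a \<open>w\<close> lies in the trace dual of \<open>\<aa> \<inter> c\<close>, and
  summing over the dual lattices and then over \<open>c\<close> leaves \<open>(N \<qq>)\<^sup>1\<^sup>/\<^sup>2\<^sup>+\<^sup>\<epsilon> (R/\<delta>)\<^sup>1\<^sup>/\<^sup>2\<close>, to be balanced against
  the smoothing error \<open>R\<delta>/N \<aa>\<close>.  No factorization of ideals is needed: both the number of
  square roots and the Gauss sums are controlled by the number of ideals containing \<open>\<qq>\<close>.
\<close>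

section \<open>Divisors and quadratic congruences\<close>

text \<open>The obstacle is uniformity: constants may depend on \<omega> and \<epsilon> but not on
  the ideals, so the lattice estimates rest only on lower bounds for distances. An ideal
  \<open>I\<close> has a nonzero element of modulus O(\<open>sqrt (nrm I)\<close>), which forces
  nonzero vectors of its dual to have modulus at least a constant over \<open>sqrt (nrm I)\<close>.
  For one annihilator c the Gauss sum saves (N c)^(1/2), while the lattice sum over the dual of
  \<aa> \<inter> c costs N \<aa> N c; after division by the covolume (N c)^(1/2) remains, at most (N
  \<qq>)^(1/2). With T = t / N \<aa> the errors T \<delta> / R and (N \<qq>)^(1/2) (R /
  \<delta>)^(1/2) agree for \<delta> / R = ((N \<qq>)^(1/2) / T)^(2/3), and both are then (T N
  \<qq>)^(1/3); the condition \<delta> \<le> R is the threshold for t. The ideals containing \<qq>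
  are counted through their Hermite normal forms, hence by divisors of N \<qq> and roots of one
  quadratic congruence. That is why the file starts with congruences.\<close>

definition divisor_count :: "nat \<Rightarrow> nat" where
  "divisor_count n = card {d. d dvd n}"

text \<open>Every divisor of the product is \<open>p ^ i\<close> times a divisor of \<open>m\<close>
  with \<open>i \<le> k\<close>, so counting such pairs gives the bound.\<close>

lemma divisor_count_prime_power_mult:
  assumes "Factorial_Ring.prime p" "m > 0"
  shows "divisor_count (p ^ k * m) \<le> (k + 1) * divisor_count m"
proof -
  have "{d. d dvd p ^ k * m} \<subseteq> (\<lambda>(i, d). p ^ i * d) ` ({..k} \<times> {d. d dvd m})"
  proof
    fix d assume "d \<in> {d. d dvd p ^ k * m}"
    then obtain b c where bc: "d = b * c" "b dvd p ^ k" "c dvd m" using division_decomp by blast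
    then obtain i where "i \<le> k" "b = p ^ i" using divides_primepow_nat[OF assms(1)] by blast
    then show "d \<in> (\<lambda>(i, d). p ^ i * d) ` ({..k} \<times> {d. d dvd m})" using bc by auto
  qed
  then have "divisor_count (p ^ k * m) \<le> card ((\<lambda>(i, d). p ^ i * d) ` ({..k} \<times> {d. d dvd m}))"
    unfolding divisor_count_def using assms by (intro card_mono) auto
  also have "\<dots> \<le> card ({..k} \<times> {d. d dvd m})" using assms by (intro card_image_le) auto
  finally show ?thesis by (simp add: divisor_count_def card_cartesian_product)
qed

text \<open>A prime power contributes the factor \<open>k + 1\<close>, which is at most
  \<open>(p ^ k) powr \<epsilon>\<close> as soon as \<open>p\<close> is at least
  \<open>2 powr (1 / \<epsilon>)\<close>. Each of the finitely many smaller primes costs one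
  constant factor \<open>C0\<close>, hence the constant \<open>C0 ^ P\<close>.\<close>

lemma divisor_count_le_powr:
  fixes \<epsilon> :: real
  assumes eps: "\<epsilon> > 0"
  obtains C where "C \<ge> 1" "\<And>n. n > 0 \<Longrightarrow> real (divisor_count n) \<le> C * real n powr \<epsilon>"
proof -
  \<comment> \<open>Chosen so that \<open>k + 1\<close> is at most
    \<open>C0 * (1 + k * \<epsilon> * ln 2)\<close>, which is at most \<open>C0 * exp (k *
    \<epsilon> * ln 2) = C0 * (2 ^ k) powr \<epsilon>\<close>.\<close>
  define C0 where "C0 = max 1 (1 / (\<epsilon> * ln 2))"
  define P where "P = nat \<lceil>2 powr (1 / \<epsilon>)\<rceil>"
  have C0: "C0 \<ge> 1" "C0 * (\<epsilon> * ln 2) \<ge> 1"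
  proof -
    show "C0 \<ge> 1" by (simp add: C0_def)
    have "1 = (1 / (\<epsilon> * ln 2)) * (\<epsilon> * ln 2)" using eps by simp
    also have "\<dots> \<le> C0 * (\<epsilon> * ln 2)" using eps by (intro mult_right_mono) (auto simp: C0_def)
    finally show "C0 * (\<epsilon> * ln 2) \<ge> 1" .
  qed
  have small: "real (k + 1) \<le> C0 * real (p ^ k) powr \<epsilon>" if p: "p \<ge> 2" for p k :: nat
  proof -
    have "real k * 1 \<le> real k * (C0 * (\<epsilon> * ln 2))" using C0(2) by (intro mult_left_mono) auto
    then have "real (k + 1) \<le> C0 * (1 + real k * (\<epsilon> * ln 2))" using C0(1) by (simp add: algebra_simps)
    also have "1 + real k * (\<epsilon> * ln 2) \<le> exp (real k * (\<epsilon> * ln 2))" by (rule exp_ge_add_one_self)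
    also have "exp (real k * (\<epsilon> * ln 2)) = real (2 ^ k) powr \<epsilon>"
      by (simp add: powr_def ln_realpow mult_ac)
    also have "\<dots> \<le> real (p ^ k) powr \<epsilon>"
      using p eps by (intro powr_mono2) (auto simp: power_mono)
    finally show ?thesis using C0(1) by simp
  qed
  have large: "real (k + 1) \<le> real (p ^ k) powr \<epsilon>" if p: "p \<ge> P" "p \<ge> 2" for p k :: nat
  proof -
    have "real p \<ge> 2 powr (1 / \<epsilon>)" using p unfolding P_def by linarith
    then have "real p powr \<epsilon> \<ge> (2 powr (1 / \<epsilon>)) powr \<epsilon>" using eps by (intro powr_mono2) auto
    then have "real p powr \<epsilon> \<ge> 2" using eps by (simp add: powr_powr)
    then have "2 ^ k \<le> (real p powr \<epsilon>) ^ k" by (intro power_mono) auto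
    also have "\<dots> = real (p ^ k) powr \<epsilon>" using p by (simp add: powr_power powr_realpow[symmetric] powr_powr mult.commute)
    finally have "2 ^ k \<le> real (p ^ k) powr \<epsilon>" .
    moreover have "real (k + 1) \<le> 2 ^ k" by (induction k) auto
    ultimately show ?thesis by linarith
  qed
  \<comment> \<open>The exponent of \<open>C0\<close> counts the small primes that divide
    \<open>n\<close>, so removing a full prime power lowers it exactly when that prime is
    small.\<close>
  have main: "real (divisor_count n) \<le> C0 ^ card {q. Factorial_Ring.prime q \<and> q dvd n \<and> q < P} * real n powr \<epsilon>"
    if "n > 0" for n using that
  proof (induction n rule: less_induct)
    case (less n)
    show ?case
    proof (cases "n = 1")
      case True
      have "C0 ^ card {q. Factorial_Ring.prime q \<and> q dvd (1::nat) \<and> q < P} \<ge> 1" using C0 by (intro one_le_power)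
      then show ?thesis using True by (simp add: divisor_count_def)
    next
      case False
      then obtain p where p: "Factorial_Ring.prime p" "p dvd n" using prime_factor_nat by blast
      define k where "k = multiplicity p n"
      obtain m where m: "n = p ^ k * m" "\<not> p dvd m"
      proof -
        have "\<not> is_unit p" using p not_prime_unit by blast
        then show ?thesis using that multiplicity_decompose'[of n p thesis] less.prems by (auto simp: k_def)
      qed
      have p2: "p \<ge> 2" using p by (simp add: prime_ge_2_nat)
      have "k > 0" using p less.prems by (simp add: k_def prime_multiplicity_gt_zero_iff)
      have m0: "m > 0" using m less.prems by (cases m) auto
      have "p ^ k > 1" using \<open>k > 0\<close> p2 by (metis one_less_power prime_gt_1_nat p(1))
      then have mn: "m < n" using m m0 by simp
      define A where "A = (\<lambda>n. {q. Factorial_Ring.prime q \<and> q dvd n \<and> q < P})"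
      have finA: "finite (A n)" for n unfolding A_def by (rule finite_subset[of _ "{..<P}"]) auto
      have IH: "real (divisor_count m) \<le> C0 ^ card (A m) * real m powr \<epsilon>"
        unfolding A_def by (rule less.IH[OF mn m0])
      have step: "real (k + 1) * C0 ^ card (A m) \<le> C0 ^ card (A n) * real (p ^ k) powr \<epsilon>"
      proof (cases "p < P")
        case True
        have "insert p (A m) \<subseteq> A n" using True p m by (auto simp: A_def)
        then have "card (insert p (A m)) \<le> card (A n)" by (intro card_mono finA)
        moreover have "p \<notin> A m" using m by (auto simp: A_def)
        ultimately have "Suc (card (A m)) \<le> card (A n)" using finA by simp
        then have "C0 ^ Suc (card (A m)) \<le> C0 ^ card (A n)" using C0 by (intro power_increasing)
        then have "C0 * C0 ^ card (A m) * real (p ^ k) powr \<epsilon> \<le> C0 ^ card (A n) * real (p ^ k) powr \<epsilon>"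
          by (intro mult_right_mono) auto
        moreover have "real (k + 1) * C0 ^ card (A m) \<le> (C0 * real (p ^ k) powr \<epsilon>) * C0 ^ card (A m)"
          using small[OF p2, of k] C0 by (intro mult_right_mono) auto
        ultimately show ?thesis by (simp add: mult_ac)
      next
        case False
        have "A m \<subseteq> A n" using m by (auto simp: A_def)
        then have "C0 ^ card (A m) \<le> C0 ^ card (A n)" using C0 by (intro power_increasing card_mono finA)
        moreover have "real (k + 1) \<le> real (p ^ k) powr \<epsilon>" using False p2 by (intro large) auto
        ultimately have "real (k + 1) * C0 ^ card (A m) \<le> real (p ^ k) powr \<epsilon> * C0 ^ card (A n)"
          using C0 by (intro mult_mono) auto
        then show ?thesis by (simp add: mult_ac)
      qed
      have "real (divisor_count n) \<le> real ((k + 1) * divisor_count m)"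
        unfolding of_nat_le_iff m(1) by (rule divisor_count_prime_power_mult[OF p(1) m0])
      also have "\<dots> \<le> real (k + 1) * (C0 ^ card (A m) * real m powr \<epsilon>)"
        unfolding of_nat_mult using IH by (intro mult_left_mono) auto
      also have "\<dots> \<le> (C0 ^ card (A n) * real (p ^ k) powr \<epsilon>) * real m powr \<epsilon>"
        unfolding mult.assoc[symmetric] using step by (intro mult_right_mono) auto
      also have "\<dots> = C0 ^ card (A n) * real n powr \<epsilon>"
        by (simp add: m(1) powr_mult mult.assoc)
      finally show ?thesis by (simp add: A_def)
    qed
  qed
  show ?thesis
  proof
    show "C0 ^ P \<ge> 1" using C0 by (intro one_le_power)
    fix n :: nat assume "n > 0"
    have "card {q. Factorial_Ring.prime q \<and> q dvd n \<and> q < P} \<le> card {..<P}" by (intro card_mono) auto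
    then have "C0 ^ card {q. Factorial_Ring.prime q \<and> q dvd n \<and> q < P} \<le> C0 ^ P" using C0 by (intro power_increasing) auto
    then have "C0 ^ card {q. Factorial_Ring.prime q \<and> q dvd n \<and> q < P} * real n powr \<epsilon> \<le> C0 ^ P * real n powr \<epsilon>"
      by (intro mult_right_mono) auto
    with main[OF \<open>n > 0\<close>] show "real (divisor_count n) \<le> C0 ^ P * real n powr \<epsilon>" by linarith
  qed
qed

text \<open>The integer quotient of \<open>\<bar>D\<bar> * (y - y0)\<close> by \<open>m\<close>
  determines \<open>y\<close>. As \<open>y\<close> runs through \<open>m\<close> consecutive
  integers, it stays in an interval with \<open>\<bar>D\<bar>\<close> integers.\<close>

lemma card_dvd_mult_diff_le:
  fixes m D y0 :: int
  assumes m: "m > 0" and D: "D \<noteq> 0"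
  shows "card {y \<in> {0..<m}. m dvd D * (y - y0)} \<le> nat \<bar>D\<bar>"
proof -
  define E where "E = \<bar>D\<bar>"
  have E: "E > 0" using D by (simp add: E_def)
  \<comment> \<open>The ceiling of \<open>- E * y0 / m\<close>, expressed with
    \<open>div\<close>.\<close>
  define c where "c = (E * (- y0) + m - 1) div m"
  define f where "f = (\<lambda>y. (E * (y - y0)) div m)"
  let ?A = "{y \<in> {0..<m}. m dvd D * (y - y0)}"
  have f: "m * f y = E * (y - y0)" if "y \<in> ?A" for y
  proof -
    have "m dvd E * (y - y0)" using that by (auto simp: E_def abs_if minus_mult_commute)
    then show ?thesis by (simp add: f_def)
  qed
  have "inj_on f ?A"
  proof (rule inj_onI)
    fix y z assume "y \<in> ?A" "z \<in> ?A" "f y = f z"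
    then have "E * (y - y0) = E * (z - y0)" using f by metis
    then show "y = z" using E by simp
  qed
  moreover have "f ` ?A \<subseteq> {c..<c+E}"
  proof (intro image_subsetI)
    fix y assume y: "y \<in> ?A"
    have 1: "m * f y \<ge> - (E * y0)" and 2: "m * f y < m * E - E * y0"
      using y E unfolding f[OF y] by (auto simp: algebra_simps)
    have c1: "m * c > - (E * y0) - 1" "m * c \<le> - (E * y0) + m - 1"
    proof -
      have "m * c = (E * (- y0) + m - 1) - (E * (- y0) + m - 1) mod m" by (simp add: c_def minus_mod_eq_mult_div)
      moreover have "(E * (- y0) + m - 1) mod m < m" "(E * (- y0) + m - 1) mod m \<ge> 0" using m by simp_all
      ultimately show "m * c > - (E * y0) - 1" "m * c \<le> - (E * y0) + m - 1" by auto
    qed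
    have "m * c < m * (f y + 1)" using 1 c1 by (simp add: algebra_simps)
    then have "c \<le> f y" using m by simp
    moreover have "m * f y < m * (c + E)" using 2 c1 by (simp add: algebra_simps)
    then have "f y < c + E" using m by simp
    ultimately show "f y \<in> {c..<c+E}" by simp
  qed
  ultimately have "card ?A \<le> card {c..<c+E}" by (intro card_inj_on_le) auto
  then show ?thesis by (simp add: E_def)
qed

text \<open>Let d be the common gcd and m = d e. From (x - y) (x + y + s) = 0 modulo m, and likewise
  for z, it follows that e divides x + y + s and x + z + s. So both d and e divide y - z. Moreover
  gcd(d, e) divides 2 x + s and m, hence the discriminant (2 x + s)^2 - 4 (x^2 + s x + n). Finally m
  = gcd(d, e) lcm(d, e).\<close>

lemma dvd_discriminant_mult_diff:
  fixes m s n x y z :: int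
  assumes m: "m > 0"
    and x: "m dvd x\<^sup>2 + s * x + n" and y: "m dvd y\<^sup>2 + s * y + n" and z: "m dvd z\<^sup>2 + s * z + n"
    and g: "gcd (x - y) m = gcd (x - z) m"
  shows "m dvd (s\<^sup>2 - 4 * n) * (y - z)"
proof -
  define d where "d = gcd (x - y) m"
  obtain e where e: "m = d * e" unfolding d_def by (metis dvdE gcd_dvd2)
  have d0: "d \<noteq> 0" using m by (simp add: d_def)
  have cof: "e dvd x + w + s" if w: "m dvd w\<^sup>2 + s * w + n" and gw: "gcd (x - w) m = d" for w
  proof -
    have "m dvd (x\<^sup>2 + s * x + n) - (w\<^sup>2 + s * w + n)" using x w by (rule dvd_diff)
    also have "(x\<^sup>2 + s * x + n) - (w\<^sup>2 + s * w + n) = (x - w) * (x + w + s)"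
      by (simp add: power2_eq_square algebra_simps)
    finally have *: "m dvd (x - w) * (x + w + s)" .
    obtain a where a: "x - w = d * a" using gw by (metis dvdE gcd_dvd1)
    have "coprime a e"
    proof -
      have "d * gcd a e = normalize d * 1" using gw unfolding a e by (simp add: gcd_mult_left d_def)
      then have "gcd a e = 1" using d0 m by (auto simp: d_def)
      then show ?thesis by (simp add: coprime_iff_gcd_eq_1)
    qed
    moreover have "e dvd a * (x + w + s)" using * d0 unfolding a e by (simp add: mult.assoc)
    ultimately show ?thesis using coprime_dvd_mult_right_iff coprime_commute by blast
  qed
  have ey: "e dvd x + y + s" and ez: "e dvd x + z + s" using cof[OF y] cof[OF z] g by (auto simp: d_def)
  have "e dvd (x + y + s) - (x + z + s)" using ey ez by (rule dvd_diff)
  then have eyz: "e dvd y - z" by simp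
  have dy: "d dvd x - y" and dz: "d dvd x - z" unfolding d_def by simp (simp add: g)
  have "d dvd (x - z) - (x - y)" using dz dy by (rule dvd_diff)
  then have dyz: "d dvd y - z" by simp
  define h where "h = gcd d e"
  have "h dvd x - y" "h dvd x + y + s" unfolding h_def using dy ey by (blast intro: dvd_trans gcd_dvd1 gcd_dvd2)+
  then have "h dvd (x - y) + (x + y + s)" by (rule dvd_add)
  then have "h dvd 2 * x + s" by (simp add: algebra_simps)
  then have h1: "h dvd (2 * x + s)\<^sup>2" by (simp add: power2_eq_square)
  have "h dvd m" by (simp add: h_def e)
  then have h2: "h dvd 4 * (x\<^sup>2 + s * x + n)" using x by (meson dvd_mult dvd_trans)
  have "h dvd (2 * x + s)\<^sup>2 - 4 * (x\<^sup>2 + s * x + n)" using h1 h2 by (rule dvd_diff)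
  also have "(2 * x + s)\<^sup>2 - 4 * (x\<^sup>2 + s * x + n) = s\<^sup>2 - 4 * n" by (simp add: power2_eq_square algebra_simps)
  finally have hD: "h dvd s\<^sup>2 - 4 * n" .
  have "lcm d e dvd y - z" using dyz eyz by (rule lcm_least)
  then have "h * lcm d e dvd (s\<^sup>2 - 4 * n) * (y - z)" using hD by (rule mult_dvd_mono[rotated])
  moreover have "m dvd h * lcm d e" by (simp add: h_def e flip: abs_mult)
  ultimately show ?thesis by (rule dvd_trans[rotated])
qed

text \<open>Fix a root x and sort the roots y by gcd(x - y, m). There are at most as many classes as
  divisors of m, and inside a class \<open>dvd_discriminant_mult_diff\<close> confines the roots to
  \<open>\<bar>s\<^sup>2 - 4 * n\<bar>\<close> residues.\<close>

lemma card_quadratic_roots_le: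
  fixes m s n :: int
  assumes m: "m > 0" and D: "s\<^sup>2 - 4 * n \<noteq> 0"
  shows "card {x \<in> {0..<m}. m dvd x\<^sup>2 + s * x + n} \<le> nat \<bar>s\<^sup>2 - 4 * n\<bar> * divisor_count (nat m)"
proof -
  define Z where "Z = {x \<in> {0..<m}. m dvd x\<^sup>2 + s * x + n}"
  have finX: "finite Z" unfolding Z_def by (rule finite_subset[of _ "{0..<m}"]) auto
  show ?thesis
  proof (cases "Z = {}")
    case True then show ?thesis unfolding Z_def[symmetric] by simp
  next
    case False
    then obtain x where x: "x \<in> Z" by blast
    define f where "f = (\<lambda>y. nat (gcd (x - y) m))"
    have fim: "f ` Z \<subseteq> {d. d dvd nat m}"
      using m by (auto simp: f_def nat_dvd_iff intro!: nat_dvd_iff[THEN iffD2])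
    have fib: "card {y \<in> Z. f y = d} \<le> nat \<bar>s\<^sup>2 - 4 * n\<bar>" for d
    proof (cases "{y \<in> Z. f y = d} = {}")
      case False
      then obtain z where z: "z \<in> Z" "f z = d" by blast
      have "{y \<in> Z. f y = d} \<subseteq> {y \<in> {0..<m}. m dvd (s\<^sup>2 - 4 * n) * (y - z)}"
      proof
        fix y assume y: "y \<in> {y \<in> Z. f y = d}"
        then have "nat (gcd (x - y) m) = nat (gcd (x - z) m)" using z by (simp add: f_def)
        then have "gcd (x - y) m = gcd (x - z) m" by (metis gcd_ge_0_int nat_0_le)
        then have "m dvd (s\<^sup>2 - 4 * n) * (y - z)"
          using x y z by (intro dvd_discriminant_mult_diff[OF m, of x]) (auto simp: Z_def)
        then show "y \<in> {y \<in> {0..<m}. m dvd (s\<^sup>2 - 4 * n) * (y - z)}" using y by (auto simp: Z_def)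
      qed
      then have "card {y \<in> Z. f y = d} \<le> card {y \<in> {0..<m}. m dvd (s\<^sup>2 - 4 * n) * (y - z)}"
        by (intro card_mono finite_subset[of "{y \<in> {0..<m}. _ y}" "{0..<m}"]) auto
      also have "\<dots> \<le> nat \<bar>s\<^sup>2 - 4 * n\<bar>" by (rule card_dvd_mult_diff_le[OF m D])
      finally show ?thesis .
    next
      case True
      then show ?thesis by (simp only: card.empty)
    qed
    have fin: "finite {d. d dvd nat m}" using m by simp
    have "card Z = (\<Sum>d\<in>{d. d dvd nat m}. card {y \<in> Z. f y = d})"
      using card_eq_sum[of Z] sum.group[OF finX fin fim, of "\<lambda>_. 1::nat"] by simp
    also have "\<dots> \<le> (\<Sum>d\<in>{d. d dvd nat m}. nat \<bar>s\<^sup>2 - 4 * n\<bar>)" by (intro sum_mono fib)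
    also have "\<dots> = nat \<bar>s\<^sup>2 - 4 * n\<bar> * divisor_count (nat m)" by (simp add: divisor_count_def)
    finally show ?thesis by (simp add: Z_def)
  qed
qed

section \<open>Fourier transforms of discs\<close>

definition semicircle :: "real \<Rightarrow> real \<Rightarrow> real" where
  "semicircle R x = sqrt (max 0 (R\<^sup>2 - x\<^sup>2))"

lemma semicircle_nonneg [simp]: "semicircle R x \<ge> 0"
  by (simp add: semicircle_def)

lemma continuous_semicircle: "continuous_on A (semicircle R)"
  unfolding semicircle_def [abs_def] by (intro continuous_intros)

lemma measurable_semicircle [measurable]: "semicircle R \<in> borel_measurable borel"
  by (intro borel_measurable_continuous_onI continuous_semicircle)

lemma semicircle_eq_0: "\<bar>x\<bar> \<ge> R \<Longrightarrow> R \<ge> 0 \<Longrightarrow> semicircle R x = 0"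
  unfolding semicircle_def using power_mono[of R "\<bar>x\<bar>" 2] by simp

lemma integrable_semicircle:
  assumes "R \<ge> 0" shows "integrable lborel (semicircle R)"
proof -
  have "set_integrable lborel {-R..R} (semicircle R)"
    by (intro borel_integrable_atLeastAtMost' continuous_semicircle)
  moreover have "(\<lambda>x. indicat_real {-R..R} x *\<^sub>R semicircle R x) = semicircle R"
  proof
    fix x show "indicat_real {-R..R} x *\<^sub>R semicircle R x = semicircle R x"
      using semicircle_eq_0[of R x] assms by (cases "\<bar>x\<bar> \<ge> R") (auto simp: indicator_def)
  qed
  ultimately show ?thesis by (simp add: set_integrable_def)
qed

text \<open>The zone has width 2 \<eta> because it must contain x - \<eta>, x and x + \<eta> for
  every x closer than \<eta> to an end point.\<close>

lemma semicircle_edge: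
  assumes "R \<ge> 0" "\<eta> > 0" "\<bar>y\<bar> \<ge> R - 2 * \<eta>"
  shows "semicircle R y \<le> 2 * sqrt (R * \<eta>)"
proof (cases "\<bar>y\<bar> \<ge> R")
  case True
  then show ?thesis using semicircle_eq_0[of R y] assms by simp
next
  case False
  have "R\<^sup>2 - y\<^sup>2 = (R - \<bar>y\<bar>) * (R + \<bar>y\<bar>)" by (simp add: algebra_simps power2_eq_square)
  also have "\<dots> \<le> (2 * \<eta>) * (2 * R)" using False assms by (intro mult_mono) auto
  finally have "max 0 (R\<^sup>2 - y\<^sup>2) \<le> 2\<^sup>2 * (R * \<eta>)" using assms by (simp add: mult.commute)
  then have "semicircle R y \<le> sqrt (2\<^sup>2 * (R * \<eta>))" unfolding semicircle_def by (rule real_sqrt_le_mono)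
  then show ?thesis by (simp add: real_sqrt_mult)
qed

text \<open>Concavity from (sqrt A + sqrt B)^2 \<le> 2 (A + B) \<le> 4 C; it fixes the sign of the
  second difference in the interior.\<close>

lemma semicircle_midpoint_concave:
  assumes "\<bar>x\<bar> + \<eta> \<le> R" "\<eta> > 0"
  shows "semicircle R (x - \<eta>) + semicircle R (x + \<eta>) \<le> 2 * semicircle R x"
proof -
  have le: "\<bar>y\<bar> \<le> R \<Longrightarrow> y\<^sup>2 \<le> R\<^sup>2" for y using power_mono[of "\<bar>y\<bar>" R 2] by simp
  define A B C where "A = R\<^sup>2 - (x-\<eta>)\<^sup>2" and "B = R\<^sup>2 - (x+\<eta>)\<^sup>2" and "C = R\<^sup>2 - x\<^sup>2"
  have nn: "A \<ge> 0" "B \<ge> 0" "C \<ge> 0" using le[of "x-\<eta>"] le[of "x+\<eta>"] le[of x] assms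
    by (auto simp: A_def B_def C_def)
  have AB: "A + B \<le> 2 * C" unfolding A_def B_def C_def by (simp add: power2_eq_square algebra_simps)
  have "(sqrt A + sqrt B)\<^sup>2 \<le> 2 * (A + B)"
  proof -
    have "0 \<le> (sqrt A - sqrt B)\<^sup>2" by simp
    then show ?thesis using nn by (simp add: power2_eq_square algebra_simps)
  qed
  also have "\<dots> \<le> (2 * sqrt C)\<^sup>2" using AB nn by (simp add: power_mult_distrib)
  finally have "sqrt A + sqrt B \<le> 2 * sqrt C" by (rule power2_le_imp_le) (use nn in simp)
  then show ?thesis using nn by (simp add: semicircle_def A_def B_def C_def max_def)
qed

text \<open>The second difference has integral zero and is nonpositive away from the two end points, where
  the semicircle is small, so the end points control its absolute integral.\<close>

lemma integral_abs_second_difference_semicircle: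
  assumes R: "R \<ge> 0" and eta: "\<eta> > 0"
  defines "D \<equiv> \<lambda>x. semicircle R (x - \<eta>) - 2 * semicircle R x + semicircle R (x + \<eta>)"
  shows "(LBINT x. \<bar>D x\<bar>) \<le> 64 * \<eta> * sqrt (R * \<eta>)"
proof -
  define K where "K = 8 * sqrt (R * \<eta>)"
  have K: "K \<ge> 0" using R eta by (simp add: K_def)
  note int0 = integrable_semicircle[OF R]
  have int1: "integrable lborel (\<lambda>x. semicircle R (x - \<eta>))"
    using lborel_integrable_real_affine[OF int0, of 1 "-\<eta>"] by (simp add: add.commute)
  have int2: "integrable lborel (\<lambda>x. semicircle R (x + \<eta>))"
    using lborel_integrable_real_affine[OF int0, of 1 "\<eta>"] by (simp add: add.commute)
  have I1: "(LBINT x. semicircle R (x - \<eta>)) = (LBINT x. semicircle R x)"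
    using lborel_integral_real_affine[of 1 "semicircle R" "-\<eta>"] by (simp add: add.commute)
  have I2: "(LBINT x. semicircle R (x + \<eta>)) = (LBINT x. semicircle R x)"
    using lborel_integral_real_affine[of 1 "semicircle R" "\<eta>"] by (simp add: add.commute)
  have intD: "integrable lborel D" unfolding D_def using int0 int1 int2 by auto
  have ID: "(LBINT x. D x) = 0"
    unfolding D_def using int0 int1 int2 I1 I2 by simp
  let ?E = "\<lambda>x. indicat_real {-R-\<eta>..-R+\<eta>} x + indicat_real {R-\<eta>..R+\<eta>} x"
  have intE: "integrable lborel ?E" using eta by auto
  have IE: "(LBINT x. ?E x) = 4 * \<eta>" using eta by simp
  \<comment> \<open>Where \<open>D x \<le> 0\<close> the term \<open>- D x\<close> already suffices;
    in the two edge zones \<open>\<bar>D x\<bar> \<le> K\<close> and the indicators sum to at least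
    1. As \<open>D\<close> has integral 0, only 2 K times the total length 4 \<eta> remains, which
    is the source of 64.\<close>
  have pt: "\<bar>D x\<bar> \<le> - D x + 2 * K * ?E x" for x
  proof -
    consider "\<bar>x\<bar> + \<eta> \<le> R" | "\<bar>x\<bar> \<ge> R + \<eta>" | "\<bar>x\<bar> > R - \<eta>" "\<bar>x\<bar> < R + \<eta>" by linarith
    then show ?thesis
    proof cases
      case 1
      have "D x \<le> 0" using semicircle_midpoint_concave[OF 1 eta] by (simp add: D_def)
      then show ?thesis using K by (simp add: indicator_def)
    next
      case 2
      have "D x = 0" unfolding D_def using 2 R eta by (subst (1 2 3) semicircle_eq_0) auto
      then show ?thesis using K by (simp add: indicator_def)
    next
      case 3
      have "semicircle R (x - \<eta>) \<le> 2 * sqrt (R * \<eta>)" "semicircle R (x + \<eta>) \<le> 2 * sqrt (R * \<eta>)"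
        "semicircle R x \<le> 2 * sqrt (R * \<eta>)"
        using 3 R eta by (auto intro!: semicircle_edge)
      then have "\<bar>D x\<bar> \<le> K" using semicircle_nonneg[of R x] semicircle_nonneg[of R "x-\<eta>"]
         semicircle_nonneg[of R "x+\<eta>"] unfolding D_def K_def by linarith
      moreover have "?E x \<ge> 1" using 3 by (auto simp: indicator_def)
      then have "K * 1 \<le> K * ?E x" using K by (intro mult_left_mono) auto
      ultimately show ?thesis by linarith
    qed
  qed
  have "(LBINT x. \<bar>D x\<bar>) \<le> (LBINT x. - D x + 2 * K * ?E x)"
    using intD intE pt by (intro integral_mono) auto
  also have "\<dots> = - (LBINT x. D x) + 2 * K * (LBINT x. ?E x)"
    using intD intE by simp
  also have "\<dots> = 64 * \<eta> * sqrt (R * \<eta>)" unfolding ID IE K_def by simp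
  finally show ?thesis .
qed

text \<open>Translation by half a period \<open>\<eta> = \<pi> / |\<xi>|\<close> changes the sign of the integral, so four times the
  integral is the transform of a second difference.\<close>

lemma norm_fourier_semicircle:
  assumes R: "R \<ge> 0" and xi: "\<xi> \<noteq> 0"
  shows "norm (LBINT x. semicircle R x * cis (- \<xi> * x)) \<le> 16 * sqrt R * (pi / \<bar>\<xi>\<bar>) powr (3/2)"
proof -
  define \<eta> where "\<eta> = pi / \<bar>\<xi>\<bar>"
  have eta: "\<eta> > 0" using xi by (simp add: \<eta>_def)
  define f where "f = (\<lambda>x. semicircle R x * cis (- \<xi> * x))"
  define J where "J = (LBINT x. f x)"
  have cisX: "cis (\<xi> * \<eta>) = -1" "cis (- \<xi> * \<eta>) = -1"
    using xi by (auto simp: \<eta>_def complex_eq_iff abs_if)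
  note int0 = integrable_semicircle[OF R]
  have [measurable]: "cis \<in> borel_measurable borel"
    by (intro borel_measurable_continuous_onI continuous_intros)
  have intf: "integrable lborel f"
    by (rule Bochner_Integration.integrable_bound[OF int0]) (auto simp: f_def norm_mult)
  have int1: "integrable lborel (\<lambda>x. f (x - \<eta>))"
    using lborel_integrable_real_affine[OF intf, of 1 "-\<eta>"] by (simp add: add.commute)
  have int2: "integrable lborel (\<lambda>x. f (x + \<eta>))"
    using lborel_integrable_real_affine[OF intf, of 1 "\<eta>"] by (simp add: add.commute)
  have I1: "(LBINT x. f (x - \<eta>)) = J"
    using lborel_integral_real_affine[of 1 f "-\<eta>"] by (simp add: add.commute J_def)
  have I2: "(LBINT x. f (x + \<eta>)) = J"
    using lborel_integral_real_affine[of 1 f "\<eta>"] by (simp add: add.commute J_def)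
  define D where "D = (\<lambda>x. semicircle R (x - \<eta>) - 2 * semicircle R x + semicircle R (x + \<eta>))"
  have e1: "f (x - \<eta>) = - (semicircle R (x - \<eta>) * cis (- \<xi> * x))" for x
  proof -
    have "cis (- \<xi> * (x - \<eta>)) = cis (- \<xi> * x) * cis (\<xi> * \<eta>)" by (simp add: cis_mult algebra_simps)
    then show ?thesis using cisX by (simp add: f_def)
  qed
  have e2: "f (x + \<eta>) = - (semicircle R (x + \<eta>) * cis (- \<xi> * x))" for x
  proof -
    have "cis (- \<xi> * (x + \<eta>)) = cis (- \<xi> * x) * cis (- \<xi> * \<eta>)" by (simp add: cis_mult algebra_simps)
    then show ?thesis using cisX by (simp add: f_def)
  qed
  have eq: "of_real (D x) * cis (- \<xi> * x) = - f (x - \<eta>) - 2 * f x - f (x + \<eta>)" for x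
    unfolding e1 e2 unfolding D_def f_def by (simp add: algebra_simps)
  have "(LBINT x. of_real (D x) * cis (- \<xi> * x)) = - J - 2 * J - J"
    unfolding eq using intf int1 int2 I1 I2 by (simp add: J_def)
  then have "4 * norm J = norm (LBINT x. of_real (D x) * cis (- \<xi> * x))"
    by (simp add: norm_mult flip: norm_minus_cancel[of "4 * J"])
  also have "\<dots> \<le> (LBINT x. norm (of_real (D x) * cis (- \<xi> * x)))" by (rule integral_norm_bound)
  also have "\<dots> = (LBINT x. \<bar>D x\<bar>)" by (simp add: norm_mult)
  also have "\<dots> \<le> 64 * \<eta> * sqrt (R * \<eta>)"
    unfolding D_def by (rule integral_abs_second_difference_semicircle[OF R eta])
  finally have "norm J \<le> 16 * \<eta> * sqrt (R * \<eta>)" by simp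
  also have "16 * \<eta> * sqrt (R * \<eta>) = 16 * sqrt R * \<eta> powr (3/2)"
    using eta by (simp add: real_sqrt_mult powr_half_sqrt[symmetric] powr_mult_base)
  finally show ?thesis by (simp add: J_def f_def \<eta>_def)
qed

section \<open>The Fourier transform of a disc in the plane\<close>

definition ft :: "(real \<times> real \<Rightarrow> real) \<Rightarrow> real \<Rightarrow> real \<Rightarrow> complex" where
  "ft f a b = (LINT p|lborel. of_real (f p) * cis (- (2 * pi * (a * fst p + b * snd p))))"

lemma measurable_cis [measurable]: "cis \<in> borel_measurable borel"
  by (intro borel_measurable_continuous_onI continuous_intros)

lemma integrable_indicator_cball: "integrable lborel (indicat_real (cball (c::'a::euclidean_space) R))"
  using emeasure_bounded_finite[OF bounded_cball, of c R] by (intro integrable_real_indicator) (simp_all add: less_top)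

text \<open>Completing the square in y with k = 1 + s^2 turns the condition into a bound on (y - s u
  / k)^2. The slice is thus an interval whose half-length is a semicircle profile of radius R sqrt
  k, divided by k.\<close>

lemma measure_ellipse_slice:
  fixes R s u :: real
  assumes R: "R \<ge> 0"
  shows "measure lborel {y. (u - s * y)\<^sup>2 + y\<^sup>2 \<le> R\<^sup>2} = 2 * semicircle (R * sqrt (1 + s\<^sup>2)) u / (1 + s\<^sup>2)"
proof -
  define k where "k = 1 + s\<^sup>2"
  have k: "k > 0" by (simp add: k_def add_pos_nonneg)
  define h where "h = semicircle (R * sqrt k) u / k"
  have h0: "h \<ge> 0" using k by (simp add: h_def)
  have eq: "(u - s * y)\<^sup>2 + y\<^sup>2 = k * (y - s * u / k)\<^sup>2 + u\<^sup>2 / k" for y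
  proof -
    have "k * ((u - s * y)\<^sup>2 + y\<^sup>2) = (k * y - s * u)\<^sup>2 + u\<^sup>2"
      unfolding k_def by (simp add: power2_eq_square algebra_simps)
    moreover have "k * (k * (y - s * u / k)\<^sup>2 + u\<^sup>2 / k) = (k * y - s * u)\<^sup>2 + u\<^sup>2"
    proof -
      have "k * y - s * u = k * (y - s * u / k)" using k by (simp add: algebra_simps)
      then show ?thesis using k by (simp add: power_mult_distrib power2_eq_square algebra_simps)
    qed
    ultimately have "k * ((u - s * y)\<^sup>2 + y\<^sup>2) = k * (k * (y - s * u / k)\<^sup>2 + u\<^sup>2 / k)" by simp
    then show ?thesis using k by simp
  qed
  have Rk: "(R * sqrt k)\<^sup>2 = R\<^sup>2 * k" using k by (simp add: power_mult_distrib)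
  show ?thesis
  proof (cases "u\<^sup>2 \<le> R\<^sup>2 * k")
    case True
    have hh: "(k * h)\<^sup>2 = R\<^sup>2 * k - u\<^sup>2" using True k Rk by (simp add: h_def semicircle_def)
    have "(u - s * y)\<^sup>2 + y\<^sup>2 \<le> R\<^sup>2 \<longleftrightarrow> \<bar>y - s * u / k\<bar> \<le> h" for y
    proof -
      have "(u - s * y)\<^sup>2 + y\<^sup>2 \<le> R\<^sup>2 \<longleftrightarrow> k * (k * (y - s * u / k)\<^sup>2 + u\<^sup>2 / k) \<le> k * R\<^sup>2"
        unfolding eq using k by simp
      also have "\<dots> \<longleftrightarrow> (k * (y - s * u / k))\<^sup>2 \<le> (k * h)\<^sup>2"
        unfolding hh using k by (simp add: power_mult_distrib power2_eq_square algebra_simps)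
      also have "\<dots> \<longleftrightarrow> \<bar>k * (y - s * u / k)\<bar> \<le> \<bar>k * h\<bar>" by (rule abs_le_square_iff[symmetric])
      also have "\<dots> \<longleftrightarrow> \<bar>y - s * u / k\<bar> \<le> h" using k h0 by (simp add: abs_mult)
      finally show ?thesis .
    qed
    then have *: "{y. (u - s * y)\<^sup>2 + y\<^sup>2 \<le> R\<^sup>2} = {s*u/k - h..s*u/k + h}"
      by (intro Set.set_eqI) (simp add: abs_le_iff, linarith)
    have "measure lborel {s*u/k - h..s*u/k + h} = 2 * h" using h0 by simp
    then show ?thesis unfolding * h_def k_def by simp
  next
    case False
    have "u\<^sup>2 / k > R\<^sup>2" using False k by (simp add: field_simps)
    moreover have "k * (y - s * u / k)\<^sup>2 \<ge> 0" for y using k by simp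
    ultimately have "{y. (u - s * y)\<^sup>2 + y\<^sup>2 \<le> R\<^sup>2} = {}" unfolding eq by (smt (verit) Collect_empty_eq)
    moreover have "semicircle (R * sqrt k) u = 0" using False Rk by (simp add: semicircle_def)
    ultimately show ?thesis by (simp add: k_def)
  qed
qed

lemma indicator_cball_pair: "R \<ge> 0 \<Longrightarrow> indicat_real (cball (0::real\<times>real) R) (x, y) = of_bool (x\<^sup>2 + y\<^sup>2 \<le> R\<^sup>2)"
  using real_sqrt_le_iff[of "x\<^sup>2 + y\<^sup>2" "R\<^sup>2"] by (simp add: indicator_def norm_Pair)

text \<open>Lets the shear, which divides by the first frequency, be applied to whichever coordinate
  is nonzero.\<close>

lemma ft_swap: "ft (indicat_real (cball 0 R)) a b = ft (indicat_real (cball 0 R)) b a"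
proof -
  have n: "norm (y, x) = norm (x, y)" for x y :: real by (simp add: norm_Pair add.commute)
  define f where "f = (\<lambda>a b p. of_real (indicat_real (cball (0::real\<times>real) R) p) * cis (- (2 * pi * (a * fst p + b * snd p))))"
  have m [measurable]: "f a b \<in> borel_measurable (lborel \<Otimes>\<^sub>M lborel)" for a b
  proof -
    have "(\<lambda>p::real\<times>real. - (2 * pi * (a * fst p + b * snd p))) \<in> borel_measurable borel"
      by (intro borel_measurable_continuous_onI continuous_intros)
    from measurable_compose[OF this measurable_cis]
    have "(\<lambda>p::real\<times>real. cis (- (2 * pi * (a * fst p + b * snd p)))) \<in> borel_measurable borel" .
    moreover have "indicat_real (cball (0::real\<times>real) R) \<in> borel_measurable borel"
      by (intro borel_measurable_indicator) auto
    ultimately show ?thesis unfolding f_def lborel_prod by simp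
  qed
  have "ft (indicat_real (cball 0 R)) a b = integral\<^sup>L (lborel \<Otimes>\<^sub>M lborel) (f a b)"
    by (simp add: ft_def f_def lborel_prod)
  also have "\<dots> = integral\<^sup>L (lborel \<Otimes>\<^sub>M lborel) (\<lambda>(x,y). f a b (y, x))"
    by (rule lborel_pair.integral_product_swap[symmetric]) simp
  also have "(\<lambda>(x,y). f a b (y, x)) = f b a"
    by (auto simp: f_def indicator_def n add.commute fun_eq_iff)
  finally show ?thesis by (simp add: ft_def f_def lborel_prod)
qed

text \<open>The shear \<open>x = u - (b / a) y\<close> turns the phase into a function of \<open>u\<close> alone, and the slices of
  the resulting ellipse have semicircular length.\<close>

lemma norm_ft_disc_aux:
  assumes R: "R \<ge> 0" and a: "a \<noteq> 0"
  shows "norm (ft (indicat_real (cball 0 R)) a b) \<le> 32 * sqrt R * norm (a, b) powr (-3/2)"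
proof -
  define s where "s = b / a"
  define k where "k = 1 + s\<^sup>2"
  have k: "k > 0" by (simp add: k_def add_pos_nonneg)
  define f where "f = (\<lambda>x y. complex_of_real (of_bool (x\<^sup>2 + y\<^sup>2 \<le> R\<^sup>2)) * cis (- (2 * pi * (a * x + b * y))))"
  define g where "g = (\<lambda>u y. f (u - s * y) y)"
  have g: "g u y = complex_of_real (of_bool ((u - s * y)\<^sup>2 + y\<^sup>2 \<le> R\<^sup>2)) * cis (- (2 * pi * a) * u)" for u y
    using a by (simp add: g_def f_def s_def algebra_simps)
  have m1 [measurable]: "(\<lambda>(x,y). f x y) \<in> borel_measurable (lborel \<Otimes>\<^sub>M lborel)" unfolding f_def by measurable
  have m2 [measurable]: "(\<lambda>(x,y). g x y) \<in> borel_measurable (lborel \<Otimes>\<^sub>M lborel)" unfolding g_def f_def by measurable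
  have i1: "integrable (lborel \<Otimes>\<^sub>M lborel) (\<lambda>(x,y). f x y)"
  proof (rule Bochner_Integration.integrable_bound)
    show "integrable (lborel \<Otimes>\<^sub>M lborel) (indicat_real (cball (0::real\<times>real) R))"
      unfolding lborel_prod by (rule integrable_indicator_cball)
    show "AE p in lborel \<Otimes>\<^sub>M lborel. norm (case p of (x, y) \<Rightarrow> f x y) \<le> norm (indicat_real (cball (0::real\<times>real) R) p)"
      by (auto simp: f_def norm_mult indicator_cball_pair R intro!: AE_I2 split: prod.splits)
  qed auto
  have i2: "integrable (lborel \<Otimes>\<^sub>M lborel) (\<lambda>(x,y). g x y)"
  proof (rule Bochner_Integration.integrable_bound)
    \<comment> \<open>On the sheared disc |y| \<le> R and |u| \<le> R + |s| R, so a disc of this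
      radius contains it; the resulting integrability licenses Fubini.\<close>
    show "integrable (lborel \<Otimes>\<^sub>M lborel) (indicat_real (cball (0::real\<times>real) (R * (2 + \<bar>s\<bar>))))"
      unfolding lborel_prod by (rule integrable_indicator_cball)
    have "norm (u, y) \<le> R * (2 + \<bar>s\<bar>)" if "(u - s * y)\<^sup>2 + y\<^sup>2 \<le> R\<^sup>2" for u y
    proof -
      have "y\<^sup>2 \<le> R\<^sup>2" "(u - s * y)\<^sup>2 \<le> R\<^sup>2" using that zero_le_power2[of y] zero_le_power2[of "u - s*y"] by linarith+
      then have y: "\<bar>y\<bar> \<le> R" and u: "\<bar>u - s * y\<bar> \<le> R" using R by (simp_all add: power2_le_iff_abs_le)
      have "\<bar>s * y\<bar> \<le> \<bar>s\<bar> * R" using y by (simp add: abs_mult mult_left_mono)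
      then have "\<bar>u\<bar> \<le> R + \<bar>s\<bar> * R" using u by linarith
      then show ?thesis using y norm_Pair_le[of u y] by (simp add: algebra_simps)
    qed
    then show "AE p in lborel \<Otimes>\<^sub>M lborel. norm (case p of (x, y) \<Rightarrow> g x y) \<le> norm (indicat_real (cball (0::real\<times>real) (R * (2 + \<bar>s\<bar>))) p)"
      by (auto simp: g norm_mult indicator_def intro!: AE_I2 split: prod.splits)
  qed auto
  have "ft (indicat_real (cball 0 R)) a b = integral\<^sup>L (lborel \<Otimes>\<^sub>M lborel) (\<lambda>(x,y). f x y)"
    unfolding ft_def lborel_prod
    by (intro Bochner_Integration.integral_cong) (auto simp: f_def indicator_cball_pair R split: prod.splits)
  also have "\<dots> = (LBINT y. LBINT x. f x y)" by (rule lborel_pair.integral_snd[symmetric, OF i1])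
  also have "\<dots> = (LBINT y. LBINT u. g u y)"
  proof (rule Bochner_Integration.integral_cong[OF refl])
    fix y :: real
    show "(LBINT x. f x y) = (LBINT u. g u y)"
      unfolding g_def using lborel_integral_real_affine[of 1 "\<lambda>x. f x y" "- s * y"] by simp
  qed
  also have "\<dots> = (LBINT u. LBINT y. g u y)" by (rule lborel_pair.Fubini_integral[OF i2])
  also have "\<dots> = (LBINT u. of_real (2 / k) * (semicircle (R * sqrt k) u * cis (- (2 * pi * a) * u)))"
  proof (rule Bochner_Integration.integral_cong[OF refl])
    fix u :: real
    have "(LBINT y. g u y) = (LBINT y. complex_of_real (indicat_real {y. (u - s * y)\<^sup>2 + y\<^sup>2 \<le> R\<^sup>2} y)) * cis (- (2 * pi * a) * u)"
      unfolding g integral_mult_left_zero[symmetric] by (intro Bochner_Integration.integral_cong) (auto simp: indicator_def)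
    also have "(LBINT y. complex_of_real (indicat_real {y. (u - s * y)\<^sup>2 + y\<^sup>2 \<le> R\<^sup>2} y)) =
       of_real (measure lborel {y. (u - s * y)\<^sup>2 + y\<^sup>2 \<le> R\<^sup>2})"
      by simp
    finally show "(LBINT y. g u y) = of_real (2 / k) * (semicircle (R * sqrt k) u * cis (- (2 * pi * a) * u))"
      by (simp add: measure_ellipse_slice R k_def)
  qed
  also have "\<dots> = of_real (2 / k) * (LBINT u. semicircle (R * sqrt k) u * cis (- (2 * pi * a) * u))"
    by (rule integral_mult_right_zero)
  finally have "norm (ft (indicat_real (cball 0 R)) a b) = 2 / k * norm (LBINT u. semicircle (R * sqrt k) u * cis (- (2 * pi * a) * u))"
    using k by (simp add: norm_mult norm_divide)
  also have "\<dots> \<le> 2 / k * (16 * sqrt (R * sqrt k) * (pi / \<bar>2 * pi * a\<bar>) powr (3/2))"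
    using k R a by (intro mult_left_mono norm_fourier_semicircle) auto
  also have "\<dots> \<le> 2 / k * (16 * sqrt (R * sqrt k) * (1 / \<bar>a\<bar>) powr (3/2))"
    using k R a by (intro mult_left_mono powr_mono2) (auto simp: abs_mult field_simps)
  also have "\<dots> = 32 * sqrt R * (k powr (-1) * k powr (1/4) * \<bar>a\<bar> powr (-3/2))"
    using k R a by (simp add: real_sqrt_mult powr_half_sqrt[symmetric] powr_powr powr_divide powr_minus_divide)
  \<comment> \<open>The factor 1 / k is from the slice length and k^(1/4) from the radius R sqrt k.
    Since |(a, b)| = |a| sqrt k, the powers recombine to the rotation invariant one.\<close>
  also have "k powr (-1) * k powr (1/4) * \<bar>a\<bar> powr (-3/2) = norm (a, b) powr (-3/2)"
  proof -
    have "norm (a, b) = \<bar>a\<bar> * sqrt k"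
    proof -
      have "a\<^sup>2 + b\<^sup>2 = a\<^sup>2 * k" using a by (simp add: k_def s_def field_simps power2_eq_square)
      then show ?thesis by (simp add: norm_Pair real_sqrt_mult)
    qed
    then have "norm (a, b) powr (-3/2) = \<bar>a\<bar> powr (-3/2) * k powr (-3/4)"
      using k by (simp add: powr_mult powr_half_sqrt[symmetric] powr_powr)
    also have "k powr (-3/4) = k powr (-1) * k powr (1/4)" unfolding powr_add[symmetric] by simp
    finally show ?thesis by simp
  qed
  finally show ?thesis .
qed

lemma norm_ft_disc:
  assumes R: "R \<ge> 0" and ab: "(a, b) \<noteq> 0"
  shows "norm (ft (indicat_real (cball 0 R)) a b) \<le> 32 * sqrt R * norm (a, b) powr (-3/2)"
proof (cases "a = 0")
  case False then show ?thesis by (rule norm_ft_disc_aux[OF R])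
next
  case True
  then have "b \<noteq> 0" using ab by (auto simp: zero_prod_def)
  from norm_ft_disc_aux[OF R this, of a] show ?thesis
    by (simp add: ft_swap[of R b a] norm_Pair add.commute)
qed

text \<open>Convolving two discs makes the transform decay like \<open>|w|\<^sup>-\<^sup>3\<close>, which is summable over a plane
  lattice.\<close>

definition smooth_disc :: "real \<Rightarrow> real \<Rightarrow> real \<times> real \<Rightarrow> real" where
  "smooth_disc R \<delta> p =
     (LINT q|lborel. indicat_real (cball 0 R) (p - q) * indicat_real (cball 0 \<delta>) q) / (pi * \<delta>\<^sup>2)"

lemma measure_disc: "R \<ge> 0 \<Longrightarrow> measure lborel (cball (c::real\<times>real) R) = pi * R\<^sup>2"
  by (simp add: content_cball unit_ball_vol_2 power2_eq_square)

lemma measurable_disc_shift [measurable]: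
  "(\<lambda>q. indicat_real (cball (0::real\<times>real) R) (p - q)) \<in> borel_measurable borel"
proof -
  have "(\<lambda>q. p - q) \<in> borel_measurable borel" by simp
  moreover have "indicat_real (cball (0::real\<times>real) R) \<in> borel_measurable borel"
    by (intro borel_measurable_indicator) auto
  ultimately show ?thesis by (rule measurable_compose)
qed

lemma measurable_disc [measurable]:
  "indicat_real (cball (0::real\<times>real) R) \<in> borel_measurable borel"
  by (intro borel_measurable_indicator) auto

lemma measurable_phase [measurable]:
  "(\<lambda>p::real\<times>real. cis (- (2 * pi * (a * fst p + b * snd p)))) \<in> borel_measurable borel"
proof -
  have "(\<lambda>p::real\<times>real. - (2 * pi * (a * fst p + b * snd p))) \<in> borel_measurable borel"
    by (intro borel_measurable_continuous_onI continuous_intros)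
  from measurable_compose[OF this measurable_cis] show ?thesis .
qed

lemma integrable_disc_product:
  "integrable lborel (\<lambda>q. indicat_real (cball (0::real\<times>real) R) (p - q) * indicat_real (cball 0 \<delta>) q)"
  by (rule Bochner_Integration.integrable_bound[OF integrable_indicator_cball[of 0 \<delta>]]) (auto simp: indicator_def)

context
  fixes R \<delta> :: real
  assumes R: "R \<ge> 0" and \<delta>: "\<delta> > 0"
begin

lemma smooth_disc_nonneg: "smooth_disc R \<delta> p \<ge> 0"
  unfolding smooth_disc_def by (intro divide_nonneg_nonneg integral_nonneg_AE) (auto simp: indicator_def)

lemma smooth_disc_le_1: "smooth_disc R \<delta> p \<le> 1"
proof -
  have "(LINT q|lborel. indicat_real (cball 0 R) (p - q) * indicat_real (cball 0 \<delta>) q)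
      \<le> (LINT q|lborel. indicat_real (cball (0::real\<times>real) \<delta>) q)"
    by (intro integral_mono integrable_disc_product integrable_indicator_cball) (auto simp: indicator_def)
  also have "\<dots> = pi * \<delta>\<^sup>2" using \<delta> by (simp add: measure_disc)
  finally show ?thesis using \<delta> by (simp add: smooth_disc_def)
qed

lemma smooth_disc_eq_1:
  assumes "norm p + \<delta> \<le> R" shows "smooth_disc R \<delta> p = 1"
proof -
  have *: "(\<lambda>q. indicat_real (cball 0 R) (p - q) * indicat_real (cball 0 \<delta>) q) = indicat_real (cball 0 \<delta>)"
  proof
    fix q show "indicat_real (cball 0 R) (p - q) * indicat_real (cball 0 \<delta>) q = indicat_real (cball 0 \<delta>) q"
      using assms norm_triangle_ineq4[of p q] by (auto simp: indicator_def)
  qed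
  have "smooth_disc R \<delta> p = (LINT q|lborel. indicat_real (cball (0::real\<times>real) \<delta>) q) / (pi * \<delta>\<^sup>2)"
    unfolding smooth_disc_def * ..
  also have "\<dots> = 1" using \<delta> by (simp add: measure_disc)
  finally show ?thesis .
qed

lemma smooth_disc_eq_0:
  assumes "norm p > R + \<delta>" shows "smooth_disc R \<delta> p = 0"
proof -
  have *: "(\<lambda>q. indicat_real (cball 0 R) (p - q) * indicat_real (cball 0 \<delta>) q) = (\<lambda>q. 0)"
  proof
    fix q show "indicat_real (cball 0 R) (p - q) * indicat_real (cball 0 \<delta>) q = 0"
      using assms norm_triangle_ineq2[of p q] by (auto simp: indicator_def)
  qed
  show ?thesis unfolding smooth_disc_def * by simp
qed

text \<open>Dominated convergence: for q off the circle of radius R around p, a null set, the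
  indicator at x n - q is eventually constant. Continuity is what Poisson summation requires and
  what the sharp indicator lacks.\<close>

lemma continuous_smooth_disc: "continuous_on UNIV (smooth_disc R \<delta>)"
proof -
  have "(\<lambda>n. LINT q|lborel. indicat_real (cball 0 R) (x n - q) * indicat_real (cball 0 \<delta>) q)
      \<longlonglongrightarrow> (LINT q|lborel. indicat_real (cball 0 R) (p - q) * indicat_real (cball 0 \<delta>) q)"
    if x: "x \<longlonglongrightarrow> p" for x and p :: "real \<times> real"
  proof (rule integral_dominated_convergence)
    show "integrable lborel (indicat_real (cball (0::real\<times>real) \<delta>))" by (rule integrable_indicator_cball)
    show "AE q in lborel. norm (indicat_real (cball 0 R) (x n - q) * indicat_real (cball 0 \<delta>) q)
      \<le> indicat_real (cball 0 \<delta>) q" for n by (auto simp: indicator_def)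
    have "sphere p R \<in> null_sets lebesgue" using negligible_sphere by (simp add: negligible_iff_null_sets)
    then have "sphere p R \<in> null_sets lborel" by (subst (asm) null_sets_completion_iff) auto
    then have "AE q in lborel. q \<notin> sphere p R" by (rule AE_not_in)
    then show "AE q in lborel. (\<lambda>n. indicat_real (cball 0 R) (x n - q) * indicat_real (cball 0 \<delta>) q)
        \<longlonglongrightarrow> indicat_real (cball 0 R) (p - q) * indicat_real (cball 0 \<delta>) q"
    proof eventually_elim
      case (elim q)
      have lim: "(\<lambda>n. norm (x n - q)) \<longlonglongrightarrow> norm (p - q)" by (intro tendsto_intros x)
      have "eventually (\<lambda>n. indicat_real (cball 0 R) (x n - q) = indicat_real (cball 0 R) (p - q)) sequentially"
      proof (cases "norm (p - q) < R")
        case True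
        then have "eventually (\<lambda>n. norm (x n - q) < R) sequentially" using lim by (simp add: order_tendsto_iff)
        then show ?thesis by eventually_elim (use True in \<open>auto simp: indicator_def\<close>)
      next
        case False
        then have F: "norm (p - q) > R" using elim by (auto simp: dist_norm)
        then have "eventually (\<lambda>n. norm (x n - q) > R) sequentially" using lim by (simp add: order_tendsto_iff)
        then show ?thesis by eventually_elim (use F in \<open>auto simp: indicator_def\<close>)
      qed
      then have "(\<lambda>n. indicat_real (cball 0 R) (x n - q)) \<longlonglongrightarrow> indicat_real (cball 0 R) (p - q)"
        by (rule tendsto_eventually)
      then show ?case by (intro tendsto_intros)
    qed
  qed auto
  then show ?thesis
    unfolding smooth_disc_def [abs_def] using \<delta>
    by (intro continuous_on_divide) (auto simp: continuous_on_sequentially o_def)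
qed

text \<open>The convolution theorem: the phase at p is the product of the phases at p - q and q, and
  Fubini with translation invariance separates the two integrals.\<close>

lemma ft_smooth_disc:
  "ft (smooth_disc R \<delta>) a b =
     ft (indicat_real (cball 0 R)) a b * ft (indicat_real (cball 0 \<delta>)) a b / of_real (pi * \<delta>\<^sup>2)"
proof -
  define e where "e = (\<lambda>p. cis (- (2 * pi * (a * fst p + b * snd p))))"
  define A where "A = (\<lambda>p. complex_of_real (indicat_real (cball (0::real\<times>real) R) p))"
  define B where "B = (\<lambda>p. complex_of_real (indicat_real (cball (0::real\<times>real) \<delta>) p))"
  define h where "h = (\<lambda>p q. A (p - q) * B q * e p)"
  have [measurable]: "e \<in> borel_measurable borel" unfolding e_def by measurable
  have [measurable]: "A \<in> borel_measurable borel" "B \<in> borel_measurable borel"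
    unfolding A_def B_def by measurable
  have ne: "norm (e p) = 1" for p by (simp add: e_def)
  have eadd: "e p = e (p - q) * e q" for p q
    by (simp add: e_def cis_mult algebra_simps)
  have int: "integrable (lborel \<Otimes>\<^sub>M lborel) (\<lambda>(p, q). h p q)"
  proof (rule Bochner_Integration.integrable_bound)
    \<comment> \<open>The integrand lives on |p| \<le> R + \<delta> and |q| \<le> \<delta>, hence in
      a ball of radius R + 2 \<delta> in dimension four.\<close>
    let ?g = "indicat_real (cball (0::(real\<times>real)\<times>(real\<times>real)) (R + 2 * \<delta>))"
    show "integrable (lborel \<Otimes>\<^sub>M lborel) ?g" unfolding lborel_prod by (rule integrable_indicator_cball)
    have "norm (h p q) \<le> norm (?g (p, q))" for p q
    proof (cases "norm (p - q) \<le> R \<and> norm q \<le> \<delta>")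
      case True
      then have "norm p \<le> R + \<delta>" using norm_triangle_ineq[of "p - q" q] by simp
      then have "norm (p, q) \<le> R + 2 * \<delta>" using norm_Pair_le[of p q] True by simp
      then show ?thesis by (simp add: h_def A_def B_def norm_mult ne indicator_def)
    next
      case False
      then show ?thesis by (auto simp: h_def A_def B_def indicator_def)
    qed
    then show "AE x in lborel \<Otimes>\<^sub>M lborel. norm (case x of (p, q) \<Rightarrow> h p q) \<le> norm (?g x)"
      by auto
    show "(\<lambda>(p, q). h p q) \<in> borel_measurable (lborel \<Otimes>\<^sub>M lborel)"
      unfolding h_def by measurable
  qed
  have "of_real (pi * \<delta>\<^sup>2) * ft (smooth_disc R \<delta>) a b = (LINT p|lborel. LINT q|lborel. h p q)"
  proof -
    have "(LINT q|lborel. h p q) = of_real (pi * \<delta>\<^sup>2) * (of_real (smooth_disc R \<delta> p) * e p)" for p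
    proof -
      have "(LINT q|lborel. h p q) = (LINT q|lborel. complex_of_real (indicat_real (cball 0 R) (p - q) * indicat_real (cball 0 \<delta>) q)) * e p"
        unfolding h_def A_def B_def integral_mult_left_zero[symmetric] by simp
      also have "\<dots> = of_real (LINT q|lborel. (indicat_real (cball 0 R) (p - q) * indicat_real (cball 0 \<delta>) q)) * e p"
        by (subst integral_complex_of_real) (rule refl)
      finally show ?thesis using \<delta> by (simp add: smooth_disc_def)
    qed
    then show ?thesis by (simp add: ft_def e_def)
  qed
  also have "\<dots> = (LINT q|lborel. LINT p|lborel. h p q)"
    by (rule lborel_pair.Fubini_integral[symmetric, OF int])
  also have "\<dots> = (LINT q|lborel. (LINT p|lborel. A p * e p) * (B q * e q))"
  proof (rule Bochner_Integration.integral_cong[OF refl])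
    fix q :: "real \<times> real"
    have "(LINT p|lborel. h p q) = (LINT p|lborel. A (p - q) * e (p - q)) * (B q * e q)"
      unfolding integral_mult_left_zero[symmetric]
    proof (rule Bochner_Integration.integral_cong[OF refl])
      fix p show "h p q = A (p - q) * e (p - q) * (B q * e q)"
        unfolding h_def by (subst eadd[of p q]) simp
    qed
    also have "(LINT p|lborel. A (p - q) * e (p - q)) = (LINT p|distr lborel borel ((+) (-q)). A p * e p)"
      by (subst integral_distr) auto
    also have "\<dots> = (LINT p|lborel. A p * e p)" by (simp add: lborel_distr_plus)
    finally show "(LINT p|lborel. h p q) = (LINT p|lborel. A p * e p) * (B q * e q)" .
  qed
  also have "\<dots> = ft (indicat_real (cball 0 R)) a b * ft (indicat_real (cball 0 \<delta>)) a b"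
    by (simp add: ft_def A_def B_def e_def)
  finally show ?thesis using \<delta> by (simp add: field_simps)
qed

lemma ft_disc_0: "r \<ge> 0 \<Longrightarrow> ft (indicat_real (cball 0 r)) 0 0 = of_real (pi * r\<^sup>2)"
  unfolding ft_def by (simp add: measure_disc)

text \<open>Averaging preserves total mass, so the zero frequency yields the area of the unsmoothed
  disc without any error in \<delta>.\<close>

lemma ft_smooth_disc_0: "ft (smooth_disc R \<delta>) 0 0 = of_real (pi * R\<^sup>2)"
  unfolding ft_smooth_disc using R \<delta> by (simp add: ft_disc_0)

lemma norm_ft_disc_le: "r \<ge> 0 \<Longrightarrow> norm (ft (indicat_real (cball 0 r)) a b) \<le> pi * r\<^sup>2"
proof -
  assume r: "r \<ge> 0"
  have "norm (ft (indicat_real (cball 0 r)) a b) \<le> (LINT p|lborel. indicat_real (cball (0::real\<times>real) r) p)"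
    unfolding ft_def by (rule order_trans[OF integral_norm_bound]) (simp add: norm_mult)
  then show ?thesis using r by (simp add: measure_disc)
qed

text \<open>The large disc contributes its decay. The normalised small disc contributes the better
  of its mass, which is 1, and its own decay, where
  \<open>sqrt \<delta> / \<delta>\<^sup>2 = \<delta> powr (-3/2)\<close> makes the bound a function
  of \<delta> |w|.\<close>

lemma norm_ft_smooth_disc:
  assumes ab: "(a, b) \<noteq> 0"
  shows "norm (ft (smooth_disc R \<delta>) a b) \<le>
    32 * sqrt R * norm (a, b) powr (-3/2) * min 1 (32 * (\<delta> * norm (a, b)) powr (-3/2))"
proof -
  have "norm (ft (indicat_real (cball 0 \<delta>)) a b) / (pi * \<delta>\<^sup>2) \<le> 1"
    using norm_ft_disc_le[of \<delta> a b] \<delta> by simp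
  moreover have "norm (ft (indicat_real (cball 0 \<delta>)) a b) / (pi * \<delta>\<^sup>2) \<le> 32 * (\<delta> * norm (a, b)) powr (-3/2)"
  proof -
    have "norm (ft (indicat_real (cball 0 \<delta>)) a b) / (pi * \<delta>\<^sup>2) \<le> 32 * sqrt \<delta> * norm (a, b) powr (-3/2) / (pi * \<delta>\<^sup>2)"
      using norm_ft_disc[of \<delta> a b] \<delta> ab by (intro divide_right_mono) auto
    also have "\<dots> \<le> 32 * sqrt \<delta> * norm (a, b) powr (-3/2) / \<delta>\<^sup>2"
      using \<delta> pi_gt3 by (intro divide_left_mono) auto
    also have "32 * sqrt \<delta> * norm (a, b) powr (-3/2) / \<delta>\<^sup>2 = 32 * (\<delta> * norm (a, b)) powr (-3/2)"
    proof -
    have "sqrt \<delta> / \<delta>\<^sup>2 = \<delta> powr (-3/2)"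
    proof -
      have "\<delta> powr (-3/2) = \<delta> powr (1/2 - 2)" by simp
      also have "\<dots> = sqrt \<delta> / \<delta>\<^sup>2" unfolding powr_diff using \<delta> by (simp add: powr_half_sqrt)
      finally show ?thesis by simp
    qed
    then have "32 * (sqrt \<delta> / \<delta>\<^sup>2) * norm (a, b) powr (-3/2) = 32 * (\<delta> * norm (a, b)) powr (-3/2)"
      using \<delta> by (simp only: powr_mult)
    then have "32 * sqrt \<delta> * norm (a, b) powr (-3/2) / \<delta>\<^sup>2 = 32 * (\<delta> * norm (a, b)) powr (-3/2)"
      by simp
    then show ?thesis .
    qed
    finally show ?thesis .
  qed
  ultimately have le: "norm (ft (indicat_real (cball 0 \<delta>)) a b) / (pi * \<delta>\<^sup>2) \<le> min 1 (32 * (\<delta> * norm (a, b)) powr (-3/2))"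
    by simp
  have "norm (ft (smooth_disc R \<delta>) a b) = norm (ft (indicat_real (cball 0 R)) a b) * (norm (ft (indicat_real (cball 0 \<delta>)) a b) / (pi * \<delta>\<^sup>2))"
    unfolding ft_smooth_disc using \<delta> by (simp add: norm_mult norm_divide norm_power)
  also have "\<dots> \<le> (32 * sqrt R * norm (a, b) powr (-3/2)) * min 1 (32 * (\<delta> * norm (a, b)) powr (-3/2))"
    by (rule mult_mono[OF norm_ft_disc[OF R ab] le]) (use R \<delta> in simp_all)
  finally show ?thesis .
qed

end

section \<open>Poisson summation in the plane\<close>

definition char2 :: "int \<times> int \<Rightarrow> real \<times> real \<Rightarrow> complex" where
  "char2 k p = cis (2 * pi * (of_int (fst k) * fst p + of_int (snd k) * snd p))"

abbreviation unit_square :: "(real \<times> real) set" where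
  "unit_square \<equiv> cbox (0,0) (1,1)"

lemma continuous_char2 [continuous_intros]: "continuous_on A (char2 k)"
  unfolding char2_def [abs_def] by (intro continuous_intros)

lemma norm_char2 [simp]: "norm (char2 k p) = 1"
  by (simp add: char2_def)

lemma char2_mult: "char2 k p * char2 l p = char2 (k + l) p"
  by (simp add: char2_def cis_mult algebra_simps)

lemma char2_0 [simp]: "char2 0 p = 1"
  by (simp add: char2_def)

lemma cis_2pi_int: "cis (2 * pi * of_int n) = 1"
  by (simp add: cis_multiple_2pi)

lemma char2_shift: "char2 k (p + (of_int i, of_int j)) = char2 k p"
proof -
  have "char2 k (p + (of_int i, of_int j)) = char2 k p * cis (2 * pi * of_int (fst k * i + snd k * j))"
    by (simp add: char2_def cis_mult algebra_simps)
  then show ?thesis unfolding cis_2pi_int by simp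
qed

lemma cnj_char2: "cnj (char2 k p) = char2 (- k) p"
  by (simp add: char2_def cis_cnj algebra_simps)

lemma integral_unit_square:
  fixes f :: "real \<times> real \<Rightarrow> complex"
  assumes "continuous_on unit_square f"
  shows "integral unit_square f = integral {0..1} (\<lambda>x. integral {0..1} (\<lambda>y. f (x, y)))"
  using integral_prod_continuous[of 0 0 1 1 f] assms by (simp add: cbox_interval)

lemma integral_cis_unit:
  fixes n :: int
  assumes "n \<noteq> 0"
  shows "integral {0..1} (\<lambda>x. cis (2 * pi * (of_int n * x))) = 0"
proof -
  define c where "c = \<i> * of_real (2 * pi * of_int n)"
  have c: "c \<noteq> 0" using assms by (simp add: c_def)
  have e: "cis (2 * pi * (of_int n * x)) = exp (c * of_real x)" for x
    by (simp add: c_def cis_conv_exp mult_ac)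
  have "((\<lambda>x. exp (c * of_real x)) has_integral (exp (c * of_real 1) / c - exp (c * of_real 0) / c)) {0..1}"
  proof (rule fundamental_theorem_of_calculus)
    fix x :: real
    have "((\<lambda>z. exp (c * z) / c) has_field_derivative exp (c * of_real x)) (at (of_real x))"
      using c by (auto intro!: derivative_eq_intros)
    then have "((\<lambda>t. exp (c * of_real t) / c) has_vector_derivative exp (c * of_real x)) (at x)"
      by (rule has_vector_derivative_real_field)
    then show "((\<lambda>t. exp (c * of_real t) / c) has_vector_derivative exp (c * of_real x)) (at x within {0..1})"
      by (rule has_vector_derivative_at_within)
  qed simp
  moreover have "exp (c * of_real 1) = 1" using e[of 1] cis_2pi_int[of n] by simp
  ultimately show ?thesis unfolding e by (simp add: integral_unique)
qed

lemma integral_char2: "integral unit_square (char2 k) = (if k = 0 then 1 else 0)"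
proof -
  have sp: "char2 k (x, y) = cis (2 * pi * (of_int (fst k) * x)) * cis (2 * pi * (of_int (snd k) * y))" for x y
    by (simp add: char2_def cis_mult algebra_simps)
  have "integral unit_square (char2 k) = integral {0..1} (\<lambda>x. integral {0..1} (\<lambda>y. char2 k (x, y)))"
    by (rule integral_unit_square) (intro continuous_intros)
  also have "\<dots> = integral {0..1} (\<lambda>x. cis (2 * pi * (of_int (fst k) * x))) * integral {0..1} (\<lambda>y. cis (2 * pi * (of_int (snd k) * y)))"
    unfolding sp by simp
  also have "\<dots> = (if k = 0 then 1 else 0)"
    by (cases "fst k = 0"; cases "snd k = 0") (auto simp: integral_cis_unit prod_eq_iff)
  finally show ?thesis .
qed

section \<open>Uniqueness of Fourier coefficients on the torus\<close>

inductive trig_poly :: "(real \<times> real \<Rightarrow> complex) \<Rightarrow> bool" where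
  char2: "trig_poly (\<lambda>p. c * char2 k p)"
| add: "trig_poly f \<Longrightarrow> trig_poly g \<Longrightarrow> trig_poly (\<lambda>p. f p + g p)"

lemma trig_poly_mult_char2: "trig_poly f \<Longrightarrow> trig_poly (\<lambda>p. (c * char2 k p) * f p)"
proof (induction rule: trig_poly.induct)
  case (char2 d l)
  have "(\<lambda>p. (c * char2 k p) * (d * char2 l p)) = (\<lambda>p. (c * d) * char2 (k + l) p)"
    by (simp add: char2_mult[symmetric] fun_eq_iff)
  then show ?case by (simp only: trig_poly.char2)
next
  case (add f g)
  then show ?case using trig_poly.add[OF add.IH] by (simp only: distrib_left)
qed

lemma trig_poly_mult: "trig_poly f \<Longrightarrow> trig_poly g \<Longrightarrow> trig_poly (\<lambda>p. f p * g p)"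
proof (induction rule: trig_poly.induct)
  case (char2 c k)
  then show ?case by (rule trig_poly_mult_char2)
next
  case (add f1 f2)
  then show ?case using trig_poly.add[OF add.IH] by (simp only: distrib_right)
qed

lemma trig_poly_const: "trig_poly (\<lambda>p. c)"
  using trig_poly.char2[of c 0] by simp

text \<open>Identifies the torus with a compact subset of a Euclidean space, where polynomials
  approximate all continuous functions uniformly.\<close>

definition torus_map :: "real \<times> real \<Rightarrow> complex \<times> complex" where
  "torus_map p = (cis (2 * pi * fst p), cis (2 * pi * snd p))"

lemma cis_cos_sin: "of_real (cos t) = cis t / 2 + cis (- t) / 2" "of_real (sin t) = - \<i> * cis t / 2 + \<i> * cis (- t) / 2"
  by (simp_all add: complex_eq_iff)

text \<open>A linear functional of the embedded point is a real combination of cosines and sines of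
  both coordinates, hence of four characters; products and sums stay trigonometric
  polynomials.\<close>

lemma trig_poly_of_polynomial:
  "real_polynomial_function q \<Longrightarrow> trig_poly (\<lambda>p. of_real (q (torus_map p)))"
proof (induction rule: real_polynomial_function.induct)
  case (linear f)
  interpret bounded_linear f by fact
  have dec: "f (z, w) = Re z * f (1, 0) + Im z * f (\<i>, 0) + Re w * f (0, 1) + Im w * f (0, \<i>)" for z w
  proof -
    have "(z, w) = Re z *\<^sub>R (1, 0) + Im z *\<^sub>R (\<i>, 0) + Re w *\<^sub>R (0, 1) + Im w *\<^sub>R (0, \<i>)"
      by (simp add: prod_eq_iff complex_eq_iff)
    then have "f (z, w) = f (Re z *\<^sub>R (1, 0) + Im z *\<^sub>R (\<i>, 0) + Re w *\<^sub>R (0, 1) + Im w *\<^sub>R (0, \<i>))" by simp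
    then show ?thesis by (simp only: add scaleR real_scaleR_def)
  qed
  have ch: "cis (2 * pi * fst p) = char2 (1, 0) p" "cis (- (2 * pi * fst p)) = char2 (-1, 0) p"
     "cis (2 * pi * snd p) = char2 (0, 1) p" "cis (- (2 * pi * snd p)) = char2 (0, -1) p" for p
    by (simp_all add: char2_def)
  have comb: "(z / 2 + w / 2) * a + (- \<i> * z / 2 + \<i> * w / 2) * b =
      (a / 2 - \<i> * b / 2) * z + (a / 2 + \<i> * b / 2) * w" for z w a b :: complex
    by (simp add: algebra_simps)
  define A B C D where "A = complex_of_real (f (1,0))" and "B = complex_of_real (f (\<i>,0))"
    and "C = complex_of_real (f (0,1))" and "D = complex_of_real (f (0,\<i>))"
  have eq: "(\<lambda>p. complex_of_real (f (torus_map p))) =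
     (\<lambda>p. ((A / 2 - \<i> * B / 2) * char2 (1, 0) p + (A / 2 + \<i> * B / 2) * char2 (-1, 0) p)
       + ((C / 2 - \<i> * D / 2) * char2 (0, 1) p + (C / 2 + \<i> * D / 2) * char2 (0, -1) p))"
    unfolding comb[symmetric] ch[symmetric] cis_cos_sin[symmetric] A_def B_def C_def D_def torus_map_def
    by (subst dec) (simp add: fun_eq_iff add.assoc)
  show ?case unfolding eq by (intro trig_poly.intros)
next
  case (const c)
  show ?case by (rule trig_poly_const)
next
  case (add f g)
  then show ?case by (simp add: trig_poly.add)
next
  case (mult f g)
  then show ?case by (simp add: trig_poly_mult)
qed

lemma continuous_trig_poly: "trig_poly f \<Longrightarrow> continuous_on A f"
  by (induction rule: trig_poly.induct) (intro continuous_intros | assumption)+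

lemma integral_times_trig_poly:
  fixes u :: "real \<times> real \<Rightarrow> complex"
  assumes u: "continuous_on unit_square u" and z: "\<And>k. integral unit_square (\<lambda>p. u p * char2 k p) = 0"
  shows "trig_poly f \<Longrightarrow> integral unit_square (\<lambda>p. u p * f p) = 0"
proof (induction rule: trig_poly.induct)
  case (char2 c k)
  have "integral unit_square (\<lambda>p. u p * (c * char2 k p)) = c * integral unit_square (\<lambda>p. u p * char2 k p)"
    unfolding integral_mult_right[symmetric] by (simp add: mult_ac)
  then show ?case by (simp add: z)
next
  case (add f g)
  have "integral unit_square (\<lambda>p. u p * f p + u p * g p) =
      integral unit_square (\<lambda>p. u p * f p) + integral unit_square (\<lambda>p. u p * g p)"
    using add.hyps by (intro integral_add integrable_continuous continuous_intros u continuous_trig_poly)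
  then show ?case using add.IH by (simp add: distrib_left)
qed

text \<open>The square is compact and the torus Hausdorff, so the projection is a quotient map and a
  continuous function that is constant on its fibres descends. The only identifications are between
  opposite edges.\<close>

lemma periodic_descends_to_torus:
  fixes u :: "real \<times> real \<Rightarrow> real"
  assumes u: "continuous_on unit_square u"
    and per: "\<And>y. u (0, y) = u (1, y)" "\<And>x. u (x, 0) = u (x, 1)"
  obtains h where "continuous_on (torus_map ` unit_square) h" "\<And>p. p \<in> unit_square \<Longrightarrow> h (torus_map p) = u p"
proof -
  have cis_eq: "x = y \<or> (x = 0 \<and> y = 1) \<or> (x = 1 \<and> y = 0)"
    if "cis (2 * pi * x) = cis (2 * pi * y)" "x \<in> {0..1}" "y \<in> {0..1}" for x y :: real
  proof -
    have "cis (2 * pi * x) / cis (2 * pi * y) = 1" using that by simp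
    then have "cis (2 * pi * (x - y)) = 1" by (simp add: cis_divide algebra_simps)
    then have "cos (2 * pi * (x - y)) = 1" by (metis cis.sel(1) one_complex.sel(1))
    then obtain n :: int where "2 * pi * (x - y) = of_int n * 2 * pi" using cos_one_2pi_int by blast
    then have n: "x - y = of_int n" by simp
    then have "real_of_int n \<le> 1" "real_of_int n \<ge> -1" using that by auto
    then have "n = 0 \<or> n = 1 \<or> n = -1" by linarith
    then show ?thesis using n that by auto
  qed
  have same: "u p = u q" if "p \<in> unit_square" "q \<in> unit_square" "torus_map p = torus_map q" for p q
  proof -
    obtain a b c d where pq: "p = (a, b)" "q = (c, d)" by (metis surj_pair)
    have ab: "a \<in> {0..1}" "b \<in> {0..1}" "c \<in> {0..1}" "d \<in> {0..1}"
      using that(1,2) by (auto simp: pq mem_box cbox_Pair_eq)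
    have "cis (2 * pi * a) = cis (2 * pi * c)" "cis (2 * pi * b) = cis (2 * pi * d)"
      using that(3) by (auto simp: torus_map_def pq)
    then have ac: "a = c \<or> (a = 0 \<and> c = 1) \<or> (a = 1 \<and> c = 0)" and bd: "b = d \<or> (b = 0 \<and> d = 1) \<or> (b = 1 \<and> d = 0)"
      using cis_eq[of a c] cis_eq[of b d] ab by simp_all
    have "u (a, b) = u (c, b)" using ac per(1)[of b] by auto
    also have "\<dots> = u (c, d)" using bd per(2)[of c] by auto
    finally show ?thesis unfolding pq .
  qed
  define h where "h = (\<lambda>z. u (inv_into unit_square torus_map z))"
  have h: "h (torus_map p) = u p" if "p \<in> unit_square" for p
    unfolding h_def using that by (intro same) (auto intro: inv_into_into f_inv_into_f)
  have cont: "continuous_on unit_square torus_map"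
    unfolding torus_map_def [abs_def] by (intro continuous_intros)
  have "quotient_map (top_of_set unit_square) (top_of_set (torus_map ` unit_square)) torus_map"
    using cont by (intro T1_Spaces.continuous_imp_quotient_map)
      (auto simp: compact_space_subtopology Hausdorff_space_subtopology compact_space_def)
  then have "continuous_map (top_of_set (torus_map ` unit_square)) euclideanreal h"
  proof (rule continuous_compose_quotient_map)
    have "continuous_on unit_square (h \<circ> torus_map)"
      using u by (rule continuous_on_eq) (simp add: h)
    then show "continuous_map (top_of_set unit_square) euclideanreal (h \<circ> torus_map)" by simp
  qed
  then have "continuous_on (torus_map ` unit_square) h" by simp
  then show ?thesis using h that by blast
qed

text \<open>If u is orthogonal to all characters, it is orthogonal to a polynomial f within e of u.
  Hence the integral of u^2 equals that of u (u - f), which is at most e times the integral of |u|.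
  Letting e tend to 0 kills the integral of u^2.\<close>

lemma fourier_uniqueness_real:
  fixes u :: "real \<times> real \<Rightarrow> real"
  assumes u: "continuous_on unit_square u"
    and per: "\<And>y. u (0, y) = u (1, y)" "\<And>x. u (x, 0) = u (x, 1)"
    and z: "\<And>k. integral unit_square (\<lambda>p. of_real (u p) * char2 k p) = 0"
    and p: "p \<in> unit_square"
  shows "u p = 0"
proof -
  obtain h where h: "continuous_on (torus_map ` unit_square) h" "\<And>p. p \<in> unit_square \<Longrightarrow> h (torus_map p) = u p"
    using periodic_descends_to_torus[OF u per] by blast
  have cont: "continuous_on unit_square torus_map"
    unfolding torus_map_def [abs_def] by (intro continuous_intros)
  then have cpt: "compact (torus_map ` unit_square)" by (intro compact_continuous_image compact_cbox)
  define M where "M = integral unit_square (\<lambda>p. \<bar>u p\<bar>)"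
  have M: "M \<ge> 0" unfolding M_def by (intro integral_nonneg integrable_continuous continuous_intros u) auto
  have small: "integral unit_square (\<lambda>p. (u p)\<^sup>2) \<le> e * M" if e: "e > 0" for e
  proof -
    obtain q where q: "real_polynomial_function q"
      "\<And>x. x \<in> torus_map ` unit_square \<Longrightarrow> \<bar>h x - q x\<bar> < e"
      using Stone_Weierstrass_real_polynomial_function[OF cpt h(1) e] by blast
    define f where "f = (\<lambda>p. q (torus_map p))"
    have fc: "continuous_on unit_square f"
      unfolding f_def
      by (rule continuous_on_compose2[OF continuous_at_imp_continuous_on cont, of UNIV])
         (auto intro: continuous_real_polymonial_function q(1))
    have "integral unit_square (\<lambda>p. complex_of_real (u p) * of_real (f p)) = 0"
      unfolding f_def using u by (intro integral_times_trig_poly[OF _ z] trig_poly_of_polynomial q continuous_intros)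
    moreover have "((\<lambda>p. complex_of_real (u p * f p)) has_integral of_real (integral unit_square (\<lambda>p. u p * f p))) unit_square"
      by (intro has_integral_of_real integrable_integral integrable_continuous continuous_intros u fc)
    ultimately have uf: "integral unit_square (\<lambda>p. u p * f p) = 0"
      by (simp add: integral_unique)
    have "integral unit_square (\<lambda>p. (u p)\<^sup>2) = integral unit_square (\<lambda>p. u p * (u p - f p)) + integral unit_square (\<lambda>p. u p * f p)"
      by (subst integral_add[symmetric])
         (auto intro!: integrable_continuous continuous_intros u fc simp: algebra_simps power2_eq_square)
    also have "\<dots> \<le> integral unit_square (\<lambda>p. e * \<bar>u p\<bar>)"
      unfolding uf add_0_right
    proof (intro integral_le integrable_continuous continuous_intros u fc)
      fix p assume "p \<in> unit_square"
      then have "torus_map p \<in> torus_map ` unit_square" by (rule imageI)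
      from q(2)[OF this] h(2)[OF \<open>p \<in> unit_square\<close>] have "\<bar>u p - f p\<bar> \<le> e" by (simp add: f_def)
      then have "\<bar>u p\<bar> * \<bar>u p - f p\<bar> \<le> \<bar>u p\<bar> * e" by (intro mult_left_mono) auto
      then show "u p * (u p - f p) \<le> e * \<bar>u p\<bar>" using abs_ge_self[of "u p * (u p - f p)"] by (simp add: abs_mult mult.commute)
    qed
    finally show ?thesis by (simp add: M_def)
  qed
  have "integral unit_square (\<lambda>p. (u p)\<^sup>2) \<le> 0"
  proof (rule field_le_epsilon)
    fix e :: real assume "e > 0"
    \<comment> \<open>The denominator \<open>M + 1\<close> covers the case
      \<open>M = 0\<close>.\<close>
    then have "integral unit_square (\<lambda>p. (u p)\<^sup>2) \<le> (e / (M + 1)) * M" using M by (intro small) auto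
    also have "\<dots> \<le> e" using M \<open>e > 0\<close> by (simp add: field_simps)
    finally show "integral unit_square (\<lambda>p. (u p)\<^sup>2) \<le> 0 + e" by simp
  qed
  moreover have "integral unit_square (\<lambda>p. (u p)\<^sup>2) \<ge> 0"
    by (intro integral_nonneg integrable_continuous continuous_intros u) auto
  ultimately have "integral unit_square (\<lambda>p. (u p)\<^sup>2) = 0" by simp
  then have "((\<lambda>p. (u p)\<^sup>2) has_integral 0) unit_square"
    using integrable_integral[of "\<lambda>p. (u p)\<^sup>2" unit_square] by (auto intro!: integrable_continuous continuous_intros u)
  then have "(u p)\<^sup>2 = 0"
  proof (rule has_integral_0_cbox_imp_0[rotated 2])
    show "box (0::real,0::real) (1,1) \<noteq> {}" by (auto simp: box_ne_empty Basis_prod_def)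
  qed (auto intro!: continuous_intros u p)
  then show ?thesis by simp
qed

section \<open>Periodization and Poisson summation\<close>

definition int_point :: "int \<times> int \<Rightarrow> real \<times> real" where
  "int_point k = (of_int (fst k), of_int (snd k))"

lemma char2_int_point: "char2 k (p + int_point v) = char2 k p"
  unfolding int_point_def by (rule char2_shift)

lemma ft_char2: "ft f (of_int (fst k)) (of_int (snd k)) = (LINT p|lborel. of_real (f p) * char2 (- k) p)"
  by (simp add: ft_def char2_def algebra_simps)

text \<open>The integer translates of the half-open square tile the plane without overlap, while
  compactness arguments use the closed square. The two differ by a negligible set, and the equation
  also passes from the gauge integral to the Lebesgue integral.\<close>

lemma integral_unit_square_half_open:
  fixes f :: "real \<times> real \<Rightarrow> complex"
  assumes f: "continuous_on UNIV f"
  defines "Q \<equiv> {0..<1} \<times> {0..<1}"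
  shows "integral unit_square f = (LINT p|lborel. indicator Q p *\<^sub>R f p)"
    and "integrable lborel (\<lambda>p. indicator Q p *\<^sub>R f p)"
proof -
  have sub: "Q \<subseteq> unit_square" "box (0,0) (1,1) \<subseteq> Q"
    by (auto simp: Q_def cbox_Pair_eq box_prod)
  have "set_integrable lborel unit_square f"
    unfolding set_integrable_def by (intro borel_integrable_compact continuous_on_subset[OF f]) auto
  then have Q: "set_integrable lborel Q f"
    by (rule set_integrable_subset) (auto simp: Q_def cbox_Pair_eq intro: borel_Times)
  then show "integrable lborel (\<lambda>p. indicator Q p *\<^sub>R f p)" by (simp add: set_integrable_def)
  have "(LINT p|lborel. indicator Q p *\<^sub>R f p) = integral Q f"
    using set_borel_integral_eq_integral(2)[OF Q] by (simp add: set_lebesgue_integral_def)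
  also have "\<dots> = integral unit_square f"
  proof (rule integral_spike_set)
    show "negligible {x \<in> Q - unit_square. f x \<noteq> 0}" using sub by (auto intro: negligible_subset[of "{}"])
    show "negligible {x \<in> unit_square - Q. f x \<noteq> 0}"
      by (rule negligible_subset[OF negligible_frontier_interval[of "(0,0)" "(1,1)"]]) (use sub in auto)
  qed
  finally show "integral unit_square f = (LINT p|lborel. indicator Q p *\<^sub>R f p)" by simp
qed

locale compactly_supported =
  fixes H :: "real \<times> real \<Rightarrow> real" and B :: real
  assumes cont: "continuous_on UNIV H" and supp: "norm p > B \<Longrightarrow> H p = 0"
begin

text \<open>The margin 2 absorbs the side of the unit square and the rounding of coordinates to
  integers, so one box of indices serves both for translates into the support and for floors of
  points of the support.\<close>

definition N :: int where "N = \<lceil>\<bar>B\<bar>\<rceil> + 2"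

definition box_index :: "(int \<times> int) set" where "box_index = {-N..N} \<times> {-N..N}"

definition periodization :: "real \<times> real \<Rightarrow> real" where
  "periodization p = (\<Sum>\<^sub>\<infinity>k. H (p + int_point k))"

lemma finite_box_index [simp]: "finite box_index"
  by (simp add: box_index_def)

lemma cont' [continuous_intros]: "continuous_on A f \<Longrightarrow> continuous_on A (\<lambda>x. H (f x))"
  by (rule continuous_on_compose2[OF cont]) auto

lemma not_box_index:
  assumes "p \<in> unit_square" "k \<notin> box_index" shows "H (p + int_point k) = 0"
proof (rule supp)
  obtain a b where p: "p = (a, b)" by force
  obtain i j where k: "k = (i, j)" by force
  have ab: "0 \<le> a" "a \<le> 1" "0 \<le> b" "b \<le> 1" using assms(1) by (auto simp: p cbox_Pair_eq)
  have N: "real_of_int N \<ge> B + 2" unfolding N_def by linarith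
  have "\<bar>i\<bar> > N \<or> \<bar>j\<bar> > N" using assms(2) by (auto simp: k box_index_def)
  then have "\<bar>real_of_int i\<bar> > N \<or> \<bar>real_of_int j\<bar> > N" by linarith
  then have "\<bar>a + i\<bar> > B \<or> \<bar>b + j\<bar> > B" using ab N by linarith
  moreover have "\<bar>a + i\<bar> \<le> norm (p + int_point k)" "\<bar>b + j\<bar> \<le> norm (p + int_point k)"
    using norm_fst_le[of "p + int_point k"] norm_snd_le[of "p + int_point k"]
    by (auto simp: p k int_point_def norm_Pair)
  ultimately show "norm (p + int_point k) > B" by linarith
qed

lemma periodization_eq:
  assumes "p \<in> unit_square"
  shows "periodization p = (\<Sum>k\<in>box_index. H (p + int_point k))"
proof -
  have "periodization p = (\<Sum>\<^sub>\<infinity>k\<in>box_index. H (p + int_point k))"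
    unfolding periodization_def using not_box_index[OF assms] by (intro infsum_cong_neutral) auto
  then show ?thesis by simp
qed

lemma periodization_periodic: "periodization (p + int_point v) = periodization p"
proof -
  have "bij_betw (\<lambda>k. k + v) UNIV UNIV"
    by (rule bij_betw_byWitness[where f' = "\<lambda>k. k - v"]) auto
  then have "periodization p = (\<Sum>\<^sub>\<infinity>k. H (p + int_point (k + v)))"
    unfolding periodization_def by (rule infsum_reindex_bij_betw[symmetric])
  also have "\<dots> = periodization (p + int_point v)"
    by (simp add: periodization_def int_point_def algebra_simps)
  finally show ?thesis by simp
qed

lemma continuous_periodization: "continuous_on unit_square periodization"
  by (rule continuous_on_eq[of _ "\<lambda>p. \<Sum>k\<in>box_index. H (p + int_point k)"])
     (auto simp: periodization_eq intro!: continuous_intros)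

text \<open>Unfolding: the integral over the square of the sum of translates is the integral over
  the plane, because the character has integer periods. The index is \<open>- k\<close> since the
  integrand carries \<open>char2 k\<close> and not its conjugate.\<close>

lemma fourier_coeff_periodization:
  "integral unit_square (\<lambda>p. of_real (periodization p) * char2 k p) =
     ft H (of_int (fst (- k))) (of_int (snd (- k)))"
proof -
  define h where "h = (\<lambda>p. complex_of_real (H p) * char2 k p)"
  define Q :: "(real \<times> real) set" where "Q = {0..<1} \<times> {0..<1}"
  have h: "continuous_on UNIV h" unfolding h_def by (intro continuous_intros)
  have hs: "continuous_on UNIV (\<lambda>p. h (p + int_point v))" for v
    by (rule continuous_on_compose2[OF h]) (auto intro!: continuous_intros)
  have shift: "(LINT p|lborel. indicator Q p *\<^sub>R h (p + int_point v)) = (LINT p|lborel. indicator Q (p - int_point v) *\<^sub>R h p)"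
    "integrable lborel (\<lambda>p. indicator Q (p - int_point v) *\<^sub>R h p)" for v
  proof -
    have [measurable]: "Q \<in> sets borel" "h \<in> borel_measurable borel"
      using h by (auto simp: Q_def intro: borel_Times borel_measurable_continuous_onI)
    have m: "(\<lambda>p. indicat_real Q (p - int_point v) *\<^sub>R h p) \<in> borel_measurable borel"
      by measurable
    have "(LINT p|lborel. indicator Q (p - int_point v) *\<^sub>R h p) = (LINT p|distr lborel borel ((+) (int_point v)). indicator Q (p - int_point v) *\<^sub>R h p)"
      by (simp add: lborel_distr_plus)
    also have "\<dots> = (LINT p|lborel. indicator Q p *\<^sub>R h (p + int_point v))"
      by (subst integral_distr) (auto simp: m add.commute)
    finally show "(LINT p|lborel. indicator Q p *\<^sub>R h (p + int_point v)) = (LINT p|lborel. indicator Q (p - int_point v) *\<^sub>R h p)" ..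
    have "integrable lborel (\<lambda>p. indicator Q p *\<^sub>R h (p + int_point v))"
      unfolding Q_def by (rule integral_unit_square_half_open(2)[OF hs])
    then have "integrable (distr lborel borel ((+) (int_point v))) (\<lambda>p. indicator Q (p - int_point v) *\<^sub>R h p)"
      by (subst integrable_distr_eq) (auto simp: m add.commute)
    then show "integrable lborel (\<lambda>p. indicator Q (p - int_point v) *\<^sub>R h p)"
      by (simp add: lborel_distr_plus)
  qed
  \<comment> \<open>Exactly one translate contains p, the one given by the floors of its
    coordinates, and its index lies in the box if p is in the support.\<close>
  have tile: "(\<Sum>v\<in>box_index. indicator Q (p - int_point v) *\<^sub>R h p) = h p" for p
  proof (cases "h p = 0")
    case False
    then have "norm p \<le> B" using supp[of p] by (force simp: h_def)
    obtain a b where p: "p = (a, b)" by force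
    define v0 where "v0 = (\<lfloor>a\<rfloor>, \<lfloor>b\<rfloor>)"
    have "\<bar>a\<bar> \<le> B" "\<bar>b\<bar> \<le> B" using \<open>norm p \<le> B\<close> norm_fst_le[of a b] norm_snd_le[of b a] by (auto simp: p)
    then have "\<bar>\<lfloor>a\<rfloor>\<bar> \<le> N" "\<bar>\<lfloor>b\<rfloor>\<bar> \<le> N" unfolding N_def by linarith+
    then have v0: "v0 \<in> box_index" by (auto simp: v0_def box_index_def)
    have "p - int_point v \<in> Q \<longleftrightarrow> v = v0" for v
      by (cases v) (auto simp: p int_point_def Q_def v0_def, linarith+)
    then have "(\<Sum>v\<in>box_index. indicator Q (p - int_point v) *\<^sub>R h p) = (\<Sum>v\<in>box_index. if v = v0 then h p else 0)"
      by (intro sum.cong) (auto simp: indicator_def)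
    then show ?thesis using v0 by simp
  qed simp
  have "integral unit_square (\<lambda>p. of_real (periodization p) * char2 k p) =
      integral unit_square (\<lambda>p. \<Sum>v\<in>box_index. h (p + int_point v))"
    by (intro integral_cong) (simp add: periodization_eq h_def char2_int_point sum_distrib_right)
  also have "\<dots> = (\<Sum>v\<in>box_index. integral unit_square (\<lambda>p. h (p + int_point v)))"
    by (intro integral_sum integrable_continuous continuous_on_subset[OF hs]) auto
  also have "\<dots> = (\<Sum>v\<in>box_index. LINT p|lborel. indicator Q p *\<^sub>R h (p + int_point v))"
    unfolding Q_def by (intro sum.cong refl integral_unit_square_half_open hs)
  also have "\<dots> = (\<Sum>v\<in>box_index. LINT p|lborel. indicator Q (p - int_point v) *\<^sub>R h p)"
    by (simp only: shift)
  also have "\<dots> = (LINT p|lborel. (\<Sum>v\<in>box_index. indicator Q (p - int_point v) *\<^sub>R h p))"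
    by (rule Bochner_Integration.integral_sum[symmetric]) (rule shift)
  also have "\<dots> = (LINT p|lborel. h p)" by (simp only: tile)
  also have "\<dots> = ft H (of_int (fst (- k))) (of_int (snd (- k)))"
    unfolding ft_char2 by (simp add: h_def)
  finally show ?thesis .
qed

text \<open>The series with coefficients \<open>ft H\<close> converges uniformly by the M-test, so
  it is continuous and has the same Fourier coefficients as the periodization. By uniqueness both
  agree, and their values at the origin are the two sides.\<close>

theorem poisson_summation:
  assumes sum: "(\<lambda>k. norm (ft H (of_int (fst k)) (of_int (snd k)))) summable_on UNIV"
  shows "((\<lambda>k. ft H (of_int (fst k)) (of_int (snd k))) has_sum of_real (\<Sum>\<^sub>\<infinity>k. H (int_point k))) UNIV"
proof -
  define c where "c = (\<lambda>k::int\<times>int. ft H (of_int (fst k)) (of_int (snd k)))"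
  define S where "S = (\<lambda>p. \<Sum>\<^sub>\<infinity>k. c k * char2 k p)"
  have c: "(\<lambda>k. norm (c k)) summable_on UNIV" using sum by (simp add: c_def)
  have ul: "uniform_limit unit_square (\<lambda>Z p. \<Sum>k\<in>Z. c k * char2 k p) S (finite_subsets_at_top UNIV)"
    unfolding S_def by (rule Weierstrass_m_test_general[OF _ c]) (simp add: norm_mult)
  have Sc: "continuous_on unit_square S"
    by (rule uniform_limit_theorem[OF _ ul]) (auto intro!: always_eventually continuous_intros)
  have coeffS: "integral unit_square (\<lambda>p. S p * char2 j p) = c (- j)" for j
  proof -
    have ul': "uniform_limit unit_square (\<lambda>Z p. (\<Sum>k\<in>Z. c k * char2 k p) * char2 j p) (\<lambda>p. S p * char2 j p) (finite_subsets_at_top UNIV)"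
    proof (rule uniform_limitI)
      fix e :: real assume "e > 0"
      from uniform_limitD[OF ul this]
      show "\<forall>\<^sub>F Z in finite_subsets_at_top UNIV. \<forall>p\<in>unit_square. dist ((\<Sum>k\<in>Z. c k * char2 k p) * char2 j p) (S p * char2 j p) < e"
        by eventually_elim (simp add: dist_norm norm_mult flip: left_diff_distrib)
    qed
    obtain I J where IJ: "\<And>Z. ((\<lambda>p. (\<Sum>k\<in>Z. c k * char2 k p) * char2 j p) has_integral I Z) unit_square"
      "((\<lambda>p. S p * char2 j p) has_integral J) unit_square" "(I \<longlongrightarrow> J) (finite_subsets_at_top UNIV)"
      by (rule uniform_limit_integral_cbox[OF ul']) (auto intro!: continuous_intros)
    \<comment> \<open>The partial integrals are already constant once the finite set contains - j,
      which identifies the limit.\<close>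
    have I: "I Z = c (- j)" if Z: "finite Z" "- j \<in> Z" for Z
    proof -
      have "I Z = integral unit_square (\<lambda>p. \<Sum>k\<in>Z. c k * char2 (k + j) p)"
        using integral_unique[OF IJ(1)[of Z]] by (simp add: sum_distrib_right mult.assoc char2_mult)
      also have "\<dots> = (\<Sum>k\<in>Z. integral unit_square (\<lambda>p. c k * char2 (k + j) p))"
        by (intro integral_sum integrable_continuous continuous_intros Z)
      also have "\<dots> = (\<Sum>k\<in>Z. if k = - j then c k else 0)"
        by (intro sum.cong) (auto simp: integral_char2 add_eq_0_iff add_eq_0_iff2)
      finally show ?thesis using Z by simp
    qed
    have "eventually (\<lambda>Z. I Z = c (- j)) (finite_subsets_at_top UNIV)"
      unfolding eventually_finite_subsets_at_top by (rule exI[of _ "{- j}"]) (auto intro: I)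
    then have "(I \<longlongrightarrow> c (- j)) (finite_subsets_at_top UNIV)" by (rule tendsto_eventually)
    then have "J = c (- j)" using IJ(3) by (intro tendsto_unique[of "finite_subsets_at_top UNIV"]) auto
    then show ?thesis using integral_unique[OF IJ(2)] by simp
  qed
  define d where "d = (\<lambda>p. of_real (periodization p) - S p)"
  have dc: "continuous_on unit_square d"
    unfolding d_def by (intro continuous_intros continuous_periodization Sc)
  have d0: "integral unit_square (\<lambda>p. d p * char2 k p) = 0" for k
  proof -
    have "integral unit_square (\<lambda>p. d p * char2 k p) = integral unit_square (\<lambda>p. of_real (periodization p) * char2 k p)
        - integral unit_square (\<lambda>p. S p * char2 k p)"
      unfolding d_def left_diff_distrib
      by (intro integral_diff integrable_continuous continuous_intros continuous_periodization Sc)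
    then show ?thesis unfolding fourier_coeff_periodization coeffS by (simp add: c_def)
  qed
  \<comment> \<open>Uniqueness was proved for real functions; the coefficients of the real and
    imaginary parts of \<open>d\<close> combine those of \<open>d\<close> and of its
    conjugate.\<close>
  have d0': "integral unit_square (\<lambda>p. cnj (d p) * char2 k p) = 0" for k
  proof -
    have "integral unit_square (\<lambda>p. cnj (d p) * char2 k p) = integral unit_square (\<lambda>p. cnj (d p * char2 (- k) p))"
      by (simp add: cnj_char2)
    also have "\<dots> = cnj (integral unit_square (\<lambda>p. d p * char2 (- k) p))" by (rule Henstock_Kurzweil_Integration.integral_cnj[symmetric])
    finally show ?thesis by (simp add: d0)
  qed
  have per: "d (p + int_point v) = d p" for p v
    by (simp add: d_def S_def periodization_periodic char2_int_point)
  have per1: "d (0, y) = d (1, y)" and per2: "d (x, 0) = d (x, 1)" for x y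
    using per[of "(0, y)" "(1, 0)"] per[of "(x, 0)" "(0, 1)"] by (simp_all add: int_point_def)
  have zero: "(0, 0) \<in> unit_square" by (simp add: cbox_Pair_eq)
  have "Re (d (0, 0)) = 0"
  proof (rule fourier_uniqueness_real[of "\<lambda>p. Re (d p)"])
    show "integral unit_square (\<lambda>p. of_real (Re (d p)) * char2 k p) = 0" for k
    proof -
      have "of_real (Re (d p)) * char2 k p = (d p * char2 k p + cnj (d p) * char2 k p) / 2" for p
        unfolding distrib_right[symmetric] complex_add_cnj by simp
      then have "integral unit_square (\<lambda>p. of_real (Re (d p)) * char2 k p) =
          integral unit_square (\<lambda>p. d p * char2 k p + cnj (d p) * char2 k p) / 2"
        by (simp only: Henstock_Kurzweil_Integration.integral_divide)
      moreover have "integral unit_square (\<lambda>p. d p * char2 k p + cnj (d p) * char2 k p) = 0"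
        by (subst integral_add) (auto simp: d0 d0' intro!: integrable_continuous continuous_intros dc)
      ultimately show ?thesis by simp
    qed
  qed (auto intro!: continuous_intros dc zero simp: per1 per2)
  moreover have "Im (d (0, 0)) = 0"
  proof (rule fourier_uniqueness_real[of "\<lambda>p. Im (d p)"])
    show "integral unit_square (\<lambda>p. of_real (Im (d p)) * char2 k p) = 0" for k
    proof -
      have "of_real (Im (d p)) * char2 k p = (d p * char2 k p - cnj (d p) * char2 k p) / (2 * \<i>)" for p
        unfolding left_diff_distrib[symmetric] complex_diff_cnj by (simp add: mult.left_commute mult.assoc[symmetric])
      then have "integral unit_square (\<lambda>p. of_real (Im (d p)) * char2 k p) =
          integral unit_square (\<lambda>p. d p * char2 k p - cnj (d p) * char2 k p) / (2 * \<i>)"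
        by (simp only: Henstock_Kurzweil_Integration.integral_divide)
      moreover have "integral unit_square (\<lambda>p. d p * char2 k p - cnj (d p) * char2 k p) = 0"
        by (subst integral_diff) (auto simp: d0 d0' intro!: integrable_continuous continuous_intros dc)
      ultimately show ?thesis by simp
    qed
  qed (auto intro!: continuous_intros dc zero simp: per1 per2)
  ultimately have "d (0, 0) = 0" by (simp add: complex_eq_iff)
  then have "of_real (\<Sum>\<^sub>\<infinity>k. H (int_point k)) = (\<Sum>\<^sub>\<infinity>k. c k)"
    by (simp add: d_def periodization_def S_def char2_def int_point_def)
  moreover have "(c has_sum (\<Sum>\<^sub>\<infinity>k. c k)) UNIV"
    by (rule has_sum_infsum[OF abs_summable_summable[OF c]])
  ultimately show ?thesis by (simp add: c_def)
qed

end

section \<open>Ideals of an imaginary quadratic order\<close>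

lemma int_subgroup_generator:
  fixes S :: "int set"
  assumes diff: "\<And>x y. x \<in> S \<Longrightarrow> y \<in> S \<Longrightarrow> x - y \<in> S" and ne: "\<exists>x\<in>S. x \<noteq> 0"
  obtains c where "c > 0" "\<And>x. x \<in> S \<longleftrightarrow> c dvd x"
proof -
  obtain x0 where x0: "x0 \<in> S" "x0 \<noteq> 0" using ne by blast
  have zero: "0 \<in> S" using diff[OF x0(1) x0(1)] by simp
  have neg: "- x \<in> S" if "x \<in> S" for x using diff[OF zero that] by simp
  have add: "x + y \<in> S" if "x \<in> S" "y \<in> S" for x y using diff[OF that(1) neg[OF that(2)]] by simp
  have "int (nat \<bar>x0\<bar>) \<in> S \<and> nat \<bar>x0\<bar> > 0" using x0 neg by (auto simp: abs_if)
  then have ex: "\<exists>k. int k \<in> S \<and> k > 0" by blast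
  define k where "k = (LEAST k. int k \<in> S \<and> k > 0)"
  have k: "int k \<in> S" "k > 0" using LeastI_ex[OF ex] by (auto simp: k_def)
  have least: "k \<le> j" if "int j \<in> S" "j > 0" for j unfolding k_def using that by (intro Least_le) auto
  have multn: "int k * int m \<in> S" for m by (induction m) (auto simp: zero algebra_simps intro: add k)
  have mult: "int k * m \<in> S" for m
    using multn[of "nat m"] neg[OF multn[of "nat (- m)"]] by (cases "m \<ge> 0") auto
  show ?thesis
  proof
    show "int k > 0" using k by simp
    show "x \<in> S \<longleftrightarrow> int k dvd x" for x
    proof
      assume "x \<in> S"
      then have "x mod int k \<in> S" using diff[OF _ mult[of "x div int k"], of x] by (simp add: minus_mult_div_eq_mod)
      moreover have "x mod int k < int k" "x mod int k \<ge> 0" using k by simp_all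
      ultimately have "x mod int k = 0" using least[of "nat (x mod int k)"] by (cases "x mod int k = 0") auto
      then show "int k dvd x" by (simp add: dvd_eq_mod_eq_0)
    next
      assume "int k dvd x" then show "x \<in> S" using mult by (auto elim: dvdE)
    qed
  qed
qed

text \<open>The integers \<open>s\<close> and \<open>n\<close> are trace and norm of \<omega>, and
  the order is Z + Z \<omega>. All ring computations reduce to integer coordinates through
  \<open>pt\<close>.\<close>

locale imaginary_quadratic_order =
  fixes \<omega> :: complex and s n :: int
  assumes Im_pos: "Im \<omega> > 0" and omega_square: "\<omega>\<^sup>2 = of_int s * \<omega> - of_int n"
begin

definition pt :: "int \<Rightarrow> int \<Rightarrow> complex" where "pt x y = of_int x + of_int y * \<omega>"

definition ints :: "complex set" where "ints = {pt x y | x y. True}"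

lemma Re_omega: "Re \<omega> = of_int s / 2" and n_eq: "of_int n = (Re \<omega>)\<^sup>2 + (Im \<omega>)\<^sup>2"
proof -
  have re: "(Re \<omega>)\<^sup>2 - (Im \<omega>)\<^sup>2 = of_int s * Re \<omega> - of_int n" and im: "2 * Re \<omega> * Im \<omega> = of_int s * Im \<omega>"
    using arg_cong[OF omega_square, of Re] arg_cong[OF omega_square, of Im]
    by (simp_all add: Re_power2 Im_power2)
  show 1: "Re \<omega> = of_int s / 2" using im Im_pos by simp
  show "of_int n = (Re \<omega>)\<^sup>2 + (Im \<omega>)\<^sup>2" using re unfolding 1 by (simp add: power2_eq_square)
qed

lemma cnj_omega: "cnj \<omega> = of_int s - \<omega>"
  by (simp add: complex_eq_iff Re_omega)

lemma disc_neg: "s\<^sup>2 - 4 * n < 0"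
proof -
  have "of_int (s\<^sup>2 - 4 * n) = - 4 * (Im \<omega>)\<^sup>2" using n_eq by (simp add: Re_omega power2_eq_square)
  also have "\<dots> < 0" using Im_pos by simp
  finally show ?thesis by (simp only: of_int_less_0_iff)
qed

lemma pt_eq_iff [simp]: "pt x y = pt x' y' \<longleftrightarrow> x = x' \<and> y = y'"
  using Im_pos by (auto simp: pt_def complex_eq_iff)

lemma pt_add: "pt x y + pt x' y' = pt (x + x') (y + y')"
  and pt_diff: "pt x y - pt x' y' = pt (x - x') (y - y')"
  and pt_minus: "- pt x y = pt (- x) (- y)"
  by (simp_all add: pt_def algebra_simps)

lemma pt_mult: "pt x y * pt x' y' = pt (x * x' - y * y' * n) (x * y' + y * x' + y * y' * s)"
proof -
  have "pt x y * pt x' y' = of_int x * of_int x' + (of_int x * of_int y' + of_int y * of_int x') * \<omega> + of_int y * of_int y' * \<omega>\<^sup>2"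
    by (simp add: pt_def algebra_simps power2_eq_square)
  then show ?thesis unfolding omega_square by (simp add: pt_def algebra_simps)
qed

lemma pt_0_0 [simp]: "pt 0 0 = 0" and pt_of_int: "pt x 0 = of_int x" and pt_omega: "pt 0 1 = \<omega>"
  by (simp_all add: pt_def)

lemma pt_eq_0_iff [simp]: "pt x y = 0 \<longleftrightarrow> x = 0 \<and> y = 0"
  using pt_eq_iff[of x y 0 0] by simp

lemma pt_in_ints [simp, intro]: "pt x y \<in> ints" by (auto simp: ints_def)

lemma intsE: assumes "z \<in> ints" obtains x y where "z = pt x y" using assms by (auto simp: ints_def)

lemma ints_add [intro]: "x \<in> ints \<Longrightarrow> y \<in> ints \<Longrightarrow> x + y \<in> ints"
  and ints_diff [intro]: "x \<in> ints \<Longrightarrow> y \<in> ints \<Longrightarrow> x - y \<in> ints"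
  and ints_mult [intro]: "x \<in> ints \<Longrightarrow> y \<in> ints \<Longrightarrow> x * y \<in> ints"
  and ints_minus [intro]: "x \<in> ints \<Longrightarrow> - x \<in> ints"
  by (auto elim!: intsE simp: pt_add pt_diff pt_mult pt_minus)

lemma ints_of_int [simp, intro]: "of_int x \<in> ints" using pt_in_ints[of x 0] by (simp add: pt_of_int)
lemma ints_0 [simp, intro]: "0 \<in> ints" and ints_1 [simp, intro]: "1 \<in> ints"
  using ints_of_int[of 0] ints_of_int[of 1] by simp_all
lemma ints_numeral [simp, intro]: "numeral k \<in> ints" using ints_of_int[of "numeral k"] by simp
lemma ints_power [intro]: "x \<in> ints \<Longrightarrow> x ^ k \<in> ints" by (induction k) auto
lemma ints_omega [simp, intro]: "\<omega> \<in> ints" using pt_in_ints[of 0 1] by (simp add: pt_omega)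

lemma cnj_pt: "cnj (pt x y) = pt (x + y * s) (- y)"
  by (simp add: pt_def cnj_omega algebra_simps)

lemma ints_cnj [intro]: "x \<in> ints \<Longrightarrow> cnj x \<in> ints"
  by (auto elim!: intsE simp: cnj_pt)

definition norm_form :: "int \<Rightarrow> int \<Rightarrow> int" where "norm_form x y = x\<^sup>2 + s * x * y + n * y\<^sup>2"

lemma pt_mult_cnj: "pt x y * cnj (pt x y) = of_int (norm_form x y)"
  by (simp add: cnj_pt pt_mult norm_form_def flip: pt_of_int) (simp add: algebra_simps power2_eq_square)

lemma cmod_pt: "(cmod (pt x y))\<^sup>2 = of_int (norm_form x y)"
proof -
  have "complex_of_real ((cmod (pt x y))\<^sup>2) = complex_of_real (of_int (norm_form x y))"
    unfolding complex_norm_square by (simp add: pt_mult_cnj)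
  then show ?thesis by (simp only: of_real_eq_iff)
qed

lemma norm_form_pos: "(x, y) \<noteq> (0, 0) \<Longrightarrow> norm_form x y > 0"
proof -
  assume "(x, y) \<noteq> (0, 0)"
  then have "(cmod (pt x y))\<^sup>2 > 0" by auto
  then show ?thesis unfolding cmod_pt by simp
qed

section \<open>Ideals as plane lattices, their normal forms and their index\<close>

definition is_ideal :: "complex set \<Rightarrow> bool" where
  "is_ideal I \<longleftrightarrow> I \<subseteq> ints \<and> 0 \<in> I \<and> (\<forall>x\<in>I. \<forall>y\<in>I. x + y \<in> I) \<and> (\<forall>r\<in>ints. \<forall>x\<in>I. r * x \<in> I)"

lemma ideal_ints: "is_ideal I \<Longrightarrow> x \<in> I \<Longrightarrow> x \<in> ints"
  and ideal_0: "is_ideal I \<Longrightarrow> 0 \<in> I"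
  and ideal_add: "is_ideal I \<Longrightarrow> x \<in> I \<Longrightarrow> y \<in> I \<Longrightarrow> x + y \<in> I"
  and ideal_mult: "is_ideal I \<Longrightarrow> r \<in> ints \<Longrightarrow> x \<in> I \<Longrightarrow> r * x \<in> I"
  by (auto simp: is_ideal_def)

lemma ideal_mult': "is_ideal I \<Longrightarrow> r \<in> ints \<Longrightarrow> x \<in> I \<Longrightarrow> x * r \<in> I"
  using ideal_mult[of I r x] by (simp add: mult.commute)

lemma ideal_minus: "is_ideal I \<Longrightarrow> x \<in> I \<Longrightarrow> - x \<in> I"
  using ideal_mult[of I "-1" x] ints_minus[OF ints_1] by simp

lemma ideal_diff: "is_ideal I \<Longrightarrow> x \<in> I \<Longrightarrow> y \<in> I \<Longrightarrow> x - y \<in> I"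
  using ideal_add[of I x "-y"] ideal_minus[of I y] by simp

lemma ideal_minus_iff: "is_ideal I \<Longrightarrow> - x \<in> I \<longleftrightarrow> x \<in> I"
  using ideal_minus[of I x] ideal_minus[of I "- x"] by auto

lemma ideal_diff_commute: "is_ideal I \<Longrightarrow> x - y \<in> I \<longleftrightarrow> y - x \<in> I"
  using ideal_minus_iff[of I "x - y"] by simp

lemma ideal_diff_trans: "is_ideal I \<Longrightarrow> x - y \<in> I \<Longrightarrow> y - z \<in> I \<Longrightarrow> x - z \<in> I"
  using ideal_add[of I "x - y" "y - z"] by simp

lemma is_ideal_Int: "is_ideal I \<Longrightarrow> is_ideal J \<Longrightarrow> is_ideal (I \<inter> J)"
  by (auto simp: is_ideal_def)

text \<open>\<open>hnf c a b I\<close> states that \<open>I = c (a \<int> + (b + \<omega>) \<int>)\<close> with \<open>a\<close> dividing the norm of \<open>b + \<omega>\<close>; the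
  index of \<open>I\<close> is then \<open>c\<^sup>2 a\<close>.\<close>

definition hnf :: "int \<Rightarrow> int \<Rightarrow> int \<Rightarrow> complex set \<Rightarrow> bool" where
  "hnf c a b I \<longleftrightarrow> c > 0 \<and> a > 0 \<and> 0 \<le> b \<and> b < a \<and> a dvd b\<^sup>2 + s * b + n \<and>
     I = {pt (c * (x * a + y * b)) (c * y) | x y. True}"

text \<open>\<open>A\<close> generates the rational integers in \<open>I\<close> and
  \<open>c\<close> the group of \<omega>-coordinates. Stability under multiplication by \<omega>
  forces \<open>c\<close> to divide everything else.\<close>

lemma ideal_hnf:
  assumes I: "is_ideal I" and ne: "I \<noteq> {0}"
  obtains c a b where "hnf c a b I"
proof -
  define J where "J = {y. \<exists>x. pt x y \<in> I}"
  define A0 where "A0 = {x. pt x 0 \<in> I}"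
  obtain z where z: "z \<in> I" "z \<noteq> 0" using ne ideal_0[OF I] by blast
  obtain x0 y0 where xy0: "z = pt x0 y0" using z(1) ideal_ints[OF I] intsE by blast
  have "z * cnj z \<in> I" using ideal_mult'[OF I _ z(1)] ideal_ints[OF I z(1)] by blast
  then have "pt (norm_form x0 y0) 0 \<in> I" unfolding xy0 pt_mult_cnj by (simp add: pt_of_int)
  moreover have "norm_form x0 y0 \<noteq> 0" using norm_form_pos[of x0 y0] z(2) xy0 by auto
  ultimately have neA: "\<exists>x\<in>A0. x \<noteq> 0" by (auto simp: A0_def)
  have "x - y \<in> A0" if "x \<in> A0" "y \<in> A0" for x y
    using that ideal_diff[OF I, of "pt x 0" "pt y 0"] by (auto simp: A0_def pt_diff)
  then obtain A where A: "A > 0" "\<And>x. x \<in> A0 \<longleftrightarrow> A dvd x" using int_subgroup_generator[of A0] neA by metis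
  have pA: "pt A 0 \<in> I" using A(2)[of A] by (simp add: A0_def)
  \<comment> \<open>So \<open>A\<close> is also an \<omega>-coordinate; this gives c | A further
    down.\<close>
  have "\<omega> * pt A 0 \<in> I" by (intro ideal_mult[OF I] pA) auto
  also have "\<omega> * pt A 0 = pt 0 A" by (simp add: pt_def)
  finally have AJ: "A \<in> J" by (auto simp: J_def)
  then have neJ: "\<exists>x\<in>J. x \<noteq> 0" using A(1) by (intro bexI[of _ A]) auto
  have "x - y \<in> J" if xy: "x \<in> J" "y \<in> J" for x y
  proof -
    obtain u v where "pt u x \<in> I" "pt v y \<in> I" using xy by (auto simp: J_def)
    from ideal_diff[OF I this] show ?thesis by (auto simp: J_def pt_diff)
  qed
  then obtain c where c: "c > 0" "\<And>x. x \<in> J \<longleftrightarrow> c dvd x" using int_subgroup_generator[of J] neJ by metis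
  obtain B0 where B0: "pt B0 c \<in> I" using c(2)[of c] by (auto simp: J_def)
  define B where "B = B0 mod A"
  have "pt (A * (B0 div A)) 0 \<in> I" using A(2)[of "A * (B0 div A)"] by (simp add: A0_def)
  from ideal_diff[OF I B0 this] have pB: "pt B c \<in> I" by (simp add: pt_diff B_def minus_mult_div_eq_mod)
  have B: "0 \<le> B" "B < A" using A(1) by (auto simp: B_def)
  have "c dvd A" using AJ c(2) by simp
  then obtain a where a: "A = c * a" by blast
  \<comment> \<open>The \<omega>-coordinate of the product is B + c s, whence c | B.\<close>
  have "\<omega> * pt B c \<in> I" by (intro ideal_mult[OF I] pB) auto
  also have "\<omega> * pt B c = pt (- c * n) (B + c * s)" using pt_mult[of 0 1 B c] by (simp add: pt_omega)
  finally have "c dvd B + c * s" using c(2) by (auto simp: J_def)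
  then have "c dvd B" by (simp add: dvd_add_left_iff)
  then obtain b where b: "B = c * b" by blast
  have a0: "a > 0" using A(1) c(1) unfolding a by (simp add: zero_less_mult_iff)
  have bb: "0 \<le> b" "b < a" using B c(1) unfolding a b by (auto simp: zero_le_mult_iff)
  \<comment> \<open>The first factor is the conjugate of b + \<omega>, so the product with c (b +
    \<omega>) is c times the norm of b + \<omega>, a rational integer of \<open>I\<close>.\<close>
  have "pt (b + s) (-1) * pt B c \<in> I" by (intro ideal_mult[OF I] pB) auto
  also have "pt (b + s) (-1) * pt B c = pt (c * (b\<^sup>2 + s * b + n)) 0"
    unfolding pt_mult b by (simp add: algebra_simps power2_eq_square)
  finally have "A dvd c * (b\<^sup>2 + s * b + n)" using A(2) by (simp add: A0_def)
  then have "a dvd b\<^sup>2 + s * b + n" unfolding a using c(1) by simp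
  moreover have "I = {pt (c * (x * a + y * b)) (c * y) | x y. True}" (is "_ = ?R")
  proof
    show "I \<subseteq> ?R"
    proof
      fix w assume w: "w \<in> I"
      then obtain u v where uv: "w = pt u v" using ideal_ints[OF I] intsE by blast
      have "c dvd v" using w uv c(2) by (auto simp: J_def)
      then obtain y where y: "v = c * y" by blast
      have "of_int y * pt B c \<in> I" by (intro ideal_mult[OF I] pB) auto
      also have "of_int y * pt B c = pt (y * B) v" unfolding pt_of_int[symmetric] pt_mult y by simp
      finally have "pt u v - pt (y * B) v \<in> I" using w uv ideal_diff[OF I] by blast
      then have "A dvd u - y * B" using A(2) by (simp add: A0_def pt_diff)
      then obtain x where "u - y * B = A * x" by blast
      then have "u = c * (x * a + y * b)" by (simp add: a b algebra_simps)
      then show "w \<in> ?R" using uv y by auto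
    qed
    show "?R \<subseteq> I"
    proof
      fix w assume "w \<in> ?R"
      then obtain x y where w: "w = pt (c * (x * a + y * b)) (c * y)" by auto
      have "of_int x * pt A 0 + of_int y * pt B c \<in> I"
        by (intro ideal_add[OF I] ideal_mult[OF I] pA pB) auto
      also have "of_int x * pt A 0 + of_int y * pt B c = w"
        unfolding pt_of_int[symmetric] pt_mult pt_add w by (simp add: a b algebra_simps)
      finally show "w \<in> I" .
    qed
  qed
  ultimately have "hnf c a b I" using c(1) a0 bb by (simp add: hnf_def)
  then show ?thesis by (rule that)
qed

definition reps :: "complex set \<Rightarrow> complex set \<Rightarrow> bool" where
  "reps I R \<longleftrightarrow> R \<subseteq> ints \<and> (\<forall>x\<in>ints. \<exists>!r. r \<in> R \<and> x - r \<in> I)"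

definition box_reps :: "int \<Rightarrow> int \<Rightarrow> complex set" where
  "box_reps c a = (\<lambda>(i, j). pt i j) ` ({0..<c * a} \<times> {0..<c})"

lemma card_box_reps: "card (box_reps c a) = nat (c * a) * nat c" "finite (box_reps c a)"
proof -
  have "inj_on (\<lambda>(i, j). pt i j) ({0..<c * a} \<times> {0..<c})" by (auto simp: inj_on_def)
  then show "card (box_reps c a) = nat (c * a) * nat c"
    unfolding box_reps_def by (simp add: card_image card_cartesian_product)
qed (simp add: box_reps_def)

lemma hnf_mem: "hnf c a b I \<Longrightarrow> pt u v \<in> I \<longleftrightarrow> c dvd v \<and> c * a dvd u - v * b"
proof -
  assume h: "hnf c a b I"
  have c: "c > 0" using h by (simp add: hnf_def)
  have "pt u v \<in> I \<longleftrightarrow> (\<exists>x y. u = c * (x * a + y * b) \<and> v = c * y)" using h by (auto simp: hnf_def)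
  also have "\<dots> \<longleftrightarrow> c dvd v \<and> c * a dvd u - v * b"
  proof safe
    fix x y
    have "c * (x * a + y * b) - c * y * b = c * a * x" by (simp add: algebra_simps)
    then show "c * a dvd c * (x * a + y * b) - c * y * b" by simp
  next
    assume "c dvd v" "c * a dvd u - v * b"
    then obtain y x where "v = c * y" "u - v * b = c * a * x" by (auto elim!: dvdE)
    then have "u = c * (x * a + y * b) \<and> v = c * y" by (simp add: algebra_simps)
    then show "\<exists>x y. u = c * (x * a + y * b) \<and> v = c * y" by blast
  qed auto
  finally show ?thesis .
qed

lemma reps_hnf:
  assumes h: "hnf c a b I" shows "reps I (box_reps c a)"
  unfolding reps_def
proof (intro conjI ballI subsetI)
  have c: "c > 0" and a: "a > 0" using h by (auto simp: hnf_def)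
  show "r \<in> box_reps c a \<Longrightarrow> r \<in> ints" for r by (auto simp: box_reps_def)
  fix x assume "x \<in> ints"
  then obtain u v where x: "x = pt u v" by (rule intsE)
  define j where "j = v mod c"
  \<comment> \<open>Reducing the \<omega>-coordinate to j subtracts (v - j) / c copies of c (b +
    \<omega>), which shifts the integer coordinate by (v - j) b before it is reduced modulo c
    a.\<close>
  define i where "i = (u - (v - j) * b) mod (c * a)"
  have ij: "0 \<le> i" "i < c * a" "0 \<le> j" "j < c" using c a by (auto simp: i_def j_def)
  have mem: "pt u v - pt i' j' \<in> I \<longleftrightarrow> c dvd v - j' \<and> c * a dvd (u - i') - (v - j') * b" for i' j'
    unfolding pt_diff hnf_mem[OF h] ..
  show "\<exists>!r. r \<in> box_reps c a \<and> x - r \<in> I"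
  proof (rule ex1I[of _ "pt i j"])
    have "c * a dvd (u - (v - j) * b) - i" by (simp add: i_def mod_eq_dvd_iff[symmetric])
    then show "pt i j \<in> box_reps c a \<and> x - pt i j \<in> I"
      using ij unfolding x mem by (auto simp: box_reps_def j_def mod_eq_dvd_iff[symmetric] algebra_simps)
    fix r assume r: "r \<in> box_reps c a \<and> x - r \<in> I"
    then obtain i' j' where r': "r = pt i' j'" "0 \<le> i'" "i' < c * a" "0 \<le> j'" "j' < c" by (auto simp: box_reps_def)
    have d: "c dvd v - j'" "c * a dvd (u - i') - (v - j') * b" using r unfolding x r' mem by auto
    have "v mod c = j' mod c" using d(1) by (simp add: mod_eq_dvd_iff)
    then have jj: "j' = j" using r' by (simp add: j_def)
    have eq: "(u - i') - (v - j') * b = (u - (v - j) * b) - i'" unfolding jj by simp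
    have "c * a dvd (u - (v - j) * b) - i'" using d(2) unfolding eq .
    then have "(u - (v - j) * b) mod (c * a) = i' mod (c * a)" unfolding mod_eq_dvd_iff .
    then have "i' = i" using r' by (simp add: i_def)
    then show "r = pt i j" using jj r' by simp
  qed
qed

lemma reps_card_eq:
  assumes I: "is_ideal I" and R: "reps I R" and R': "reps I R'"
  shows "card R = card R'"
proof -
  define f where "f = (\<lambda>R x. THE r. r \<in> R \<and> x - r \<in> I)"
  have f: "f Q x \<in> Q \<and> x - f Q x \<in> I" if "reps I Q" "x \<in> ints" for Q x
  proof -
    have "\<exists>!r. r \<in> Q \<and> x - r \<in> I" using that by (auto simp: reps_def)
    then show ?thesis unfolding f_def by (rule theI')
  qed
  have uniq: "r = r'" if "reps I Q" "r \<in> Q" "r' \<in> Q" "r - r' \<in> I" for Q r r'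
  proof -
    have "r \<in> ints" using that by (auto simp: reps_def)
    then have "\<exists>!r'. r' \<in> Q \<and> r - r' \<in> I" using that by (auto simp: reps_def)
    moreover have "r - r \<in> I" using ideal_0[OF I] by simp
    ultimately show ?thesis using that by blast
  qed
  have "bij_betw (f R') R R'"
  proof (rule bij_betw_byWitness[where f' = "f R"])
    have inv: "f Q (f Q' x) = x" if "reps I Q" "reps I Q'" "x \<in> Q" for Q Q' x
    proof -
      have x: "x \<in> ints" using that by (auto simp: reps_def)
      note 1 = f[OF that(2) x]
      then have y: "f Q' x \<in> ints" using that by (auto simp: reps_def)
      note 2 = f[OF that(1) y]
      have "x - f Q (f Q' x) \<in> I" using 1 2 by (blast intro: ideal_diff_trans[OF I])
      then show ?thesis using uniq[OF that(1) that(3)] 2 by metis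
    qed
    show "\<forall>x\<in>R. f R (f R' x) = x" using inv R R' by blast
    show "\<forall>x\<in>R'. f R' (f R x) = x" using inv R R' by blast
    show "f R' ` R \<subseteq> R'" "f R ` R' \<subseteq> R" using f R R' by (auto simp: reps_def subset_iff)
  qed
  then show ?thesis by (rule bij_betw_same_card)
qed

text \<open>The index of \<open>I\<close>; by \<open>reps_card_eq\<close> the choice of
  representatives does not affect it.\<close>

definition nrm :: "complex set \<Rightarrow> nat" where
  "nrm I = card (SOME R. reps I R)"

lemma nrm_eq: "is_ideal I \<Longrightarrow> reps I R \<Longrightarrow> nrm I = card R"
  unfolding nrm_def by (rule reps_card_eq) (auto intro: someI)

lemma nrm_hnf: "is_ideal I \<Longrightarrow> hnf c a b I \<Longrightarrow> int (nrm I) = c * c * a"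
  using nrm_eq[OF _ reps_hnf, of I c a b] by (auto simp: card_box_reps hnf_def)

lemma nrm_pos: "is_ideal I \<Longrightarrow> I \<noteq> {0} \<Longrightarrow> nrm I > 0"
proof -
  assume I: "is_ideal I" "I \<noteq> {0}"
  obtain c a b where h: "hnf c a b I" using ideal_hnf[OF I] .
  then have "int (nrm I) > 0" using nrm_hnf[OF I(1) h] by (simp add: hnf_def)
  then show ?thesis by simp
qed

lemma ex_reps:
  assumes "is_ideal I" "I \<noteq> {0}"
  obtains R where "reps I R" "finite R" "card R = nrm I"
proof -
  obtain c a b where h: "hnf c a b I" using ideal_hnf[OF assms] .
  show ?thesis using that[OF reps_hnf[OF h]] card_box_reps nrm_eq[OF assms(1) reps_hnf[OF h]] by simp
qed

lemma nrm_mem: "is_ideal I \<Longrightarrow> I \<noteq> {0} \<Longrightarrow> of_nat (nrm I) \<in> I"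
proof -
  assume I: "is_ideal I" "I \<noteq> {0}"
  obtain c a b where h: "hnf c a b I" using ideal_hnf[OF I] .
  have "pt (int (nrm I)) 0 \<in> I" unfolding hnf_mem[OF h] nrm_hnf[OF I(1) h] by (simp add: mult.assoc)
  then show ?thesis by (simp add: pt_of_int)
qed

text \<open>Expanding the norm form in the Hermite coordinates, every term is divisible by c^2 a,
  because a divides the norm of b + \<omega>. A nonzero norm is a positive integer, hence at least
  the index.\<close>

lemma cmod_ge_nrm:
  assumes I: "is_ideal I" "I \<noteq> {0}" and z: "z \<in> I" "z \<noteq> 0"
  shows "(cmod z)\<^sup>2 \<ge> real (nrm I)"
proof -
  obtain c a b where h: "hnf c a b I" using ideal_hnf[OF I] .
  obtain x y where zxy: "z = pt (c * (x * a + y * b)) (c * y)" using z h by (auto simp: hnf_def)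
  define N where "N = norm_form (c * (x * a + y * b)) (c * y)"
  obtain k where k: "b\<^sup>2 + s * b + n = a * k" using h by (auto simp: hnf_def)
  have "N = c * c * (a * (x\<^sup>2 * a + 2 * x * y * b + s * x * y) + y\<^sup>2 * (b\<^sup>2 + s * b + n))"
    by (simp add: N_def norm_form_def power2_eq_square algebra_simps)
  also have "\<dots> = (c * c * a) * (x\<^sup>2 * a + 2 * x * y * b + s * x * y + y\<^sup>2 * k)"
    unfolding k by (simp add: algebra_simps)
  finally have "c * c * a dvd N" by simp
  moreover have "N > 0" unfolding N_def using z(2) zxy by (intro norm_form_pos) auto
  ultimately have "int (nrm I) \<le> N" unfolding nrm_hnf[OF I(1) h] by (rule zdvd_imp_le)
  then show ?thesis unfolding zxy cmod_pt N_def[symmetric] by linarith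
qed

text \<open>An ideal is determined by its normal form (c, a, b). Since N \<qq> lies in it, c and a
  divide N \<qq>, and b is a root of the quadratic congruence modulo a. Two factors of the divisor
  function count c and a, the third comes from the roots.\<close>

lemma finite_ideals_containing:
  assumes q: "is_ideal q" "q \<noteq> {0}"
  shows "finite {g. is_ideal g \<and> q \<subseteq> g}"
    and "card {g. is_ideal g \<and> q \<subseteq> g} \<le> nat \<bar>s\<^sup>2 - 4 * n\<bar> * divisor_count (nrm q) ^ 3"
proof -
  define N where "N = nrm q"
  have N: "N > 0" unfolding N_def by (rule nrm_pos[OF q])
  define Dv where "Dv = int ` {d. d dvd N}"
  have Dv: "finite Dv" "card Dv = divisor_count N" using N by (auto simp: Dv_def divisor_count_def card_image)
  define roots where "roots = (\<lambda>a. {b \<in> {0..<a}. a dvd b\<^sup>2 + s * b + n})"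
  have finroots: "finite (roots a)" for a unfolding roots_def by (rule finite_subset[of _ "{0..<a}"]) auto
  define T where "T = (SIGMA ca : Dv \<times> Dv. roots (snd ca))"
  have finT: "finite T" unfolding T_def using Dv finroots by auto
  define G where "G = {g. is_ideal g \<and> q \<subseteq> g}"
  define f where "f = (\<lambda>g. SOME t. hnf (fst (fst t)) (snd (fst t)) (snd t) g)"
  have f: "hnf (fst (fst (f g))) (snd (fst (f g))) (snd (f g)) g" if "g \<in> G" for g
  proof -
    have "is_ideal g" "g \<noteq> {0}" using that q ideal_0[OF q(1)] by (auto simp: G_def)
    then obtain c a b where "hnf c a b g" by (rule ideal_hnf)
    then have "hnf (fst (fst ((c, a), b))) (snd (fst ((c, a), b))) (snd ((c, a), b)) g" by simp
    then show ?thesis unfolding f_def by (rule someI)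
  qed
  have "inj_on f G"
  proof (rule inj_onI)
    fix g h assume "g \<in> G" "h \<in> G" "f g = f h"
    then show "g = h" using f[of g] f[of h] unfolding hnf_def by simp
  qed
  moreover have "f ` G \<subseteq> T"
  proof (intro image_subsetI)
    fix g assume g: "g \<in> G"
    obtain c a b where cab: "f g = ((c, a), b)" by (metis surj_pair)
    have h: "hnf c a b g" using f[OF g] by (simp add: cab)
    have "of_nat N \<in> g" using g nrm_mem[OF q] by (auto simp: G_def N_def)
    then have "pt (int N) 0 \<in> g" by (simp add: pt_of_int)
    then have "c * a dvd int N" unfolding hnf_mem[OF h] by simp
    then have "c dvd int N" "a dvd int N" by (auto elim: dvd_mult_left dvd_mult_right)
    then have "c \<in> Dv" "a \<in> Dv" using h unfolding Dv_def hnf_def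
      by (auto intro!: image_eqI[of c int "nat c"] image_eqI[of a int "nat a"] simp: nat_dvd_iff)
    moreover have "b \<in> roots a" using h by (simp add: hnf_def roots_def)
    ultimately show "f g \<in> T" by (simp add: T_def cab)
  qed
  ultimately have finG: "finite G" and le: "card G \<le> card T"
    using finT by (auto intro: inj_on_finite card_inj_on_le)
  show "finite {g. is_ideal g \<and> q \<subseteq> g}" using finG by (simp add: G_def)
  have "card T = (\<Sum>ca\<in>Dv \<times> Dv. card (roots (snd ca)))"
    unfolding T_def using Dv finroots by (intro card_SigmaI) auto
  also have "\<dots> \<le> (\<Sum>ca\<in>Dv \<times> Dv. nat \<bar>s\<^sup>2 - 4 * n\<bar> * divisor_count N)"
  proof (rule sum_mono)
    fix ca assume ca: "ca \<in> Dv \<times> Dv"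
    then obtain d where d: "snd ca = int d" "d dvd N" by (auto simp: Dv_def)
    have d0: "d > 0" using d N by (auto intro: Nat.gr0I)
    have "card (roots (snd ca)) \<le> nat \<bar>s\<^sup>2 - 4 * n\<bar> * divisor_count (nat (snd ca))"
      unfolding roots_def using d0 d disc_neg by (intro card_quadratic_roots_le) auto
    also have "divisor_count (nat (snd ca)) \<le> divisor_count N"
      unfolding divisor_count_def using d N by (intro card_mono) (auto intro: dvd_trans)
    finally show "card (roots (snd ca)) \<le> nat \<bar>s\<^sup>2 - 4 * n\<bar> * divisor_count N" by simp
  qed
  also have "\<dots> = nat \<bar>s\<^sup>2 - 4 * n\<bar> * divisor_count N ^ 3"
    by (simp add: card_cartesian_product Dv power3_eq_cube)
  finally show "card {g. is_ideal g \<and> q \<subseteq> g} \<le> nat \<bar>s\<^sup>2 - 4 * n\<bar> * divisor_count (nrm q) ^ 3"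
    using le by (simp add: N_def G_def)
qed

end

section \<open>Residues modulo nested ideals\<close>

context imaginary_quadratic_order
begin

text \<open>Weaker than being a system of representatives, so it covers reduced residues and their
  translates as well.\<close>

definition incongruent :: "complex set \<Rightarrow> complex set \<Rightarrow> bool" where
  "incongruent q S \<longleftrightarrow> S \<subseteq> ints \<and> (\<forall>x\<in>S. \<forall>y\<in>S. x - y \<in> q \<longrightarrow> x = y)"

lemma reps_incongruent:
  assumes q: "is_ideal q" and R: "reps q R" shows "incongruent q R"
  unfolding incongruent_def
proof (intro conjI ballI impI)
  show "R \<subseteq> ints" using R by (simp add: reps_def)
  fix x y assume xy: "x \<in> R" "y \<in> R" "x - y \<in> q"
  then have "\<exists>!r. r \<in> R \<and> x - r \<in> q" using R by (auto simp: reps_def)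
  moreover have "x - x \<in> q" using ideal_0[OF q] by simp
  ultimately show "x = y" using xy by blast
qed

lemma reps_ex: "reps q R \<Longrightarrow> x \<in> ints \<Longrightarrow> \<exists>r\<in>R. x - r \<in> q"
  by (auto simp: reps_def)

lemma incongruent_embeds:
  assumes q: "is_ideal q" and S: "incongruent q S" and R: "reps q R"
  obtains f where "inj_on f S" "\<And>x. x \<in> S \<Longrightarrow> f x \<in> R \<and> x - f x \<in> q"
proof -
  have "\<forall>x\<in>S. \<exists>r. r \<in> R \<and> x - r \<in> q" using S R by (auto simp: incongruent_def reps_def)
  then obtain f where f: "\<And>x. x \<in> S \<Longrightarrow> f x \<in> R \<and> x - f x \<in> q" by metis
  have "inj_on f S"
  proof (rule inj_onI)
    fix x y assume xy: "x \<in> S" "y \<in> S" "f x = f y"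
    have "x - f x \<in> q" "y - f y \<in> q" using f[OF xy(1)] f[OF xy(2)] by blast+
    then have "x - f x \<in> q" "f x - y \<in> q" using ideal_diff_commute[OF q, of y "f y"] xy(3) by auto
    then have "x - y \<in> q" by (rule ideal_diff_trans[OF q])
    then show "x = y" using S xy by (auto simp: incongruent_def)
  qed
  then show ?thesis using f that by blast
qed

lemma incongruent_finite:
  assumes q: "is_ideal q" "q \<noteq> {0}" and S: "incongruent q S" shows "finite S" "card S \<le> nrm q"
proof -
  obtain R where R: "reps q R" "finite R" "card R = nrm q" using ex_reps[OF q] .
  obtain f where f: "inj_on f S" "\<And>x. x \<in> S \<Longrightarrow> f x \<in> R \<and> x - f x \<in> q"
    by (rule incongruent_embeds[OF q(1) S R(1)]) blast
  have "f ` S \<subseteq> R" using f(2) by auto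
  then show "finite S" "card S \<le> nrm q"
    using inj_on_finite[OF f(1) _ R(2)] card_inj_on_le[OF f(1) _ R(2)] R(3) by auto
qed

text \<open>Translation by z - y, followed by reduction modulo q, carries the representatives
  congruent to y modulo c injectively to those congruent to z. All classes modulo c are therefore
  equally large.\<close>

lemma card_class_reps:
  assumes q: "is_ideal q" "q \<noteq> {0}" and c: "is_ideal c" "q \<subseteq> c" and R: "reps q R" and y: "y \<in> ints"
  shows "card {x \<in> R. x - y \<in> c} * nrm c = nrm q"
proof -
  have c0: "c \<noteq> {0}" using c q ideal_0[OF q(1)] by auto
  have finR: "finite R" using incongruent_finite[OF q reps_incongruent[OF q(1) R]] by simp
  obtain Rc where Rc: "reps c Rc" "finite Rc" "card Rc = nrm c" using ex_reps[OF c(1) c0] .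
  have incl: "card {x \<in> R. x - y \<in> c} \<le> card {x \<in> R. x - z \<in> c}" if y: "y \<in> ints" and z: "z \<in> ints" for y z
  proof -
    have "\<forall>x\<in>{x \<in> R. x - y \<in> c}. \<exists>r. r \<in> R \<and> (x - y + z) - r \<in> q"
    proof
      fix x assume "x \<in> {x \<in> R. x - y \<in> c}"
      then have "x - y + z \<in> ints" using R y z by (auto simp: reps_def)
      from reps_ex[OF R this] show "\<exists>r. r \<in> R \<and> (x - y + z) - r \<in> q" by blast
    qed
    then obtain f where f: "\<And>x. x \<in> R \<Longrightarrow> x - y \<in> c \<Longrightarrow> f x \<in> R \<and> (x - y + z) - f x \<in> q"
      by (metis (mono_tags, lifting) mem_Collect_eq)
    have "inj_on f {x \<in> R. x - y \<in> c}"
    proof (rule inj_onI)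
      fix x x' assume xx: "x \<in> {x \<in> R. x - y \<in> c}" "x' \<in> {x \<in> R. x - y \<in> c}" "f x = f x'"
      then have "(x - y + z) - f x \<in> q" "(x' - y + z) - f x \<in> q" using f by force+
      from ideal_diff[OF q(1) this] have "x - x' \<in> q" by simp
      then show "x = x'" using xx reps_incongruent[OF q(1) R] by (auto simp: incongruent_def)
    qed
    moreover have "f ` {x \<in> R. x - y \<in> c} \<subseteq> {x \<in> R. x - z \<in> c}"
    proof (intro image_subsetI)
      fix x assume x: "x \<in> {x \<in> R. x - y \<in> c}"
      then have fx: "f x \<in> R" "(x - y + z) - f x \<in> c" using f c(2) by auto
      from ideal_diff[OF c(1) _ fx(2), of "x - y"] x have "f x - z \<in> c" by (simp add: algebra_simps)
      then show "f x \<in> {x \<in> R. x - z \<in> c}" using fx by simp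
    qed
    ultimately show ?thesis using finR by (intro card_inj_on_le) auto
  qed
  have eq: "card {x \<in> R. x - z \<in> c} = card {x \<in> R. x - y \<in> c}" if "z \<in> ints" for z
    using incl[OF that y] incl[OF y that] by simp
  have "R = (\<Union>z\<in>Rc. {x \<in> R. x - z \<in> c})" using Rc(1) R by (force simp: reps_def)
  then have "card R = card (\<Union>z\<in>Rc. {x \<in> R. x - z \<in> c})" by simp
  also have "\<dots> = (\<Sum>z\<in>Rc. card {x \<in> R. x - z \<in> c})"
  proof (rule card_UN_disjoint)
    show "\<forall>i\<in>Rc. \<forall>j\<in>Rc. i \<noteq> j \<longrightarrow> {x \<in> R. x - i \<in> c} \<inter> {x \<in> R. x - j \<in> c} = {}"
    proof (intro ballI impI, rule ccontr)
      fix i j assume ij: "i \<in> Rc" "j \<in> Rc" "i \<noteq> j" "{x \<in> R. x - i \<in> c} \<inter> {x \<in> R. x - j \<in> c} \<noteq> {}"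
      then obtain x where "x - i \<in> c" "x - j \<in> c" by auto
      then have "i - j \<in> c" using ideal_diff[OF c(1), of "x - j" "x - i"] by simp
      then show False using ij reps_incongruent[OF c(1) Rc(1)] by (auto simp: incongruent_def)
    qed
  qed (use Rc finR in auto)
  also have "\<dots> = (\<Sum>z\<in>Rc. card {x \<in> R. x - y \<in> c})"
    using Rc(1) by (intro sum.cong refl eq) (auto simp: reps_def)
  also have "\<dots> = nrm c * card {x \<in> R. x - y \<in> c}" using Rc by simp
  finally show ?thesis using nrm_eq[OF q(1) R] by (simp add: mult.commute)
qed

lemma card_class_incongruent:
  assumes q: "is_ideal q" "q \<noteq> {0}" and c: "is_ideal c" "q \<subseteq> c" and S: "incongruent q S" and y: "y \<in> ints"
  shows "card {x \<in> S. x - y \<in> c} * nrm c \<le> nrm q"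
proof -
  obtain R where R: "reps q R" "finite R" "card R = nrm q" using ex_reps[OF q] .
  obtain f where f: "inj_on f S" "\<And>x. x \<in> S \<Longrightarrow> f x \<in> R \<and> x - f x \<in> q"
    by (rule incongruent_embeds[OF q(1) S R(1)]) blast
  have "card {x \<in> S. x - y \<in> c} \<le> card {x \<in> R. x - y \<in> c}"
  proof (rule card_inj_on_le)
    show "inj_on f {x \<in> S. x - y \<in> c}" using f(1) by (rule inj_on_subset) auto
    show "f ` {x \<in> S. x - y \<in> c} \<subseteq> {x \<in> R. x - y \<in> c}"
    proof (intro image_subsetI)
      fix x assume x: "x \<in> {x \<in> S. x - y \<in> c}"
      then have fx: "f x \<in> R" "x - f x \<in> c" using f(2) c(2) by auto
      then have "f x - x \<in> c" using ideal_diff_commute[OF c(1)] by simp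
      then have "f x - y \<in> c" using x ideal_diff_trans[OF c(1)] by blast
      then show "f x \<in> {x \<in> R. x - y \<in> c}" using fx by simp
    qed
  qed (use R in auto)
  then have "card {x \<in> S. x - y \<in> c} * nrm c \<le> card {x \<in> R. x - y \<in> c} * nrm c" by simp
  also have "\<dots> = nrm q" by (rule card_class_reps[OF q c R(1) y])
  finally show ?thesis .
qed

lemma nrm_mono: "is_ideal q \<Longrightarrow> q \<noteq> {0} \<Longrightarrow> is_ideal c \<Longrightarrow> q \<subseteq> c \<Longrightarrow> nrm c \<le> nrm q"
proof -
  assume q: "is_ideal q" "q \<noteq> {0}" and c: "is_ideal c" "q \<subseteq> c"
  obtain R where R: "reps q R" using ex_reps[OF q] .
  define k where "k = card {x \<in> R. x - 0 \<in> c}"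
  have k: "k * nrm c = nrm q" unfolding k_def by (rule card_class_reps[OF q c R]) auto
  moreover have "nrm q > 0" by (rule nrm_pos[OF q])
  ultimately have "k \<ge> 1" by (cases k) auto
  then have "1 * nrm c \<le> k * nrm c" by (intro mult_right_mono) auto
  then show "nrm c \<le> nrm q" using k by simp
qed

text \<open>The Chinese remainder theorem with explicit lift (1 - e) x + e y, which is x modulo a
  and y modulo q.\<close>

lemma nrm_Int_comaximal:
  assumes a: "is_ideal a" "a \<noteq> {0}" and q: "is_ideal q" "q \<noteq> {0}" and e: "e \<in> a" "1 - e \<in> q"
  shows "nrm (a \<inter> q) = nrm a * nrm q"
proof -
  obtain Ra where Ra: "reps a Ra" "finite Ra" "card Ra = nrm a" using ex_reps[OF a] .
  obtain Rq where Rq: "reps q Rq" "finite Rq" "card Rq = nrm q" using ex_reps[OF q] .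
  have eO: "e \<in> ints" "1 - e \<in> ints" using e ideal_ints[OF a(1)] by auto
  define f where "f = (\<lambda>(x, y). (1 - e) * x + e * y)"
  have fa: "f (x, y) - x \<in> a" and fq: "f (x, y) - y \<in> q" if "x \<in> ints" "y \<in> ints" for x y
  proof -
    have "f (x, y) - x = e * (y - x)" by (simp add: f_def algebra_simps)
    then show "f (x, y) - x \<in> a" using ideal_mult'[OF a(1) _ e(1), of "y - x"] that by auto
    have "f (x, y) - y = (1 - e) * (x - y)" by (simp add: f_def algebra_simps)
    then show "f (x, y) - y \<in> q" using ideal_mult'[OF q(1) _ e(2), of "x - y"] that by auto
  qed
  have R_ints: "x \<in> Ra \<Longrightarrow> x \<in> ints" "y \<in> Rq \<Longrightarrow> y \<in> ints" for x y using Ra Rq by (auto simp: reps_def)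
  have unique: "x = x' \<and> y = y'" if "x \<in> Ra" "x' \<in> Ra" "y \<in> Rq" "y' \<in> Rq" "f (x, y) - f (x', y') \<in> a \<inter> q" for x x' y y'
  proof -
    have o: "x \<in> ints" "x' \<in> ints" "y \<in> ints" "y' \<in> ints" using that R_ints by auto
    have "x - f (x, y) \<in> a" using fa[OF o(1) o(3)] ideal_diff_commute[OF a(1)] by simp
    then have "x - f (x', y') \<in> a" using that(5) ideal_diff_trans[OF a(1)] by blast
    then have "x - x' \<in> a" using fa[OF o(2) o(4)] ideal_diff_trans[OF a(1)] by blast
    moreover
    have "y - f (x, y) \<in> q" using fq[OF o(1) o(3)] ideal_diff_commute[OF q(1)] by simp
    then have "y - f (x', y') \<in> q" using that(5) ideal_diff_trans[OF q(1)] by blast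
    then have "y - y' \<in> q" using fq[OF o(2) o(4)] ideal_diff_trans[OF q(1)] by blast
    ultimately show ?thesis using that reps_incongruent[OF a(1) Ra(1)] reps_incongruent[OF q(1) Rq(1)]
      by (auto simp: incongruent_def)
  qed
  have aq: "is_ideal (a \<inter> q)" by (rule is_ideal_Int[OF a(1) q(1)])
  have "reps (a \<inter> q) (f ` (Ra \<times> Rq))"
    unfolding reps_def
  proof (intro conjI ballI)
    show "f ` (Ra \<times> Rq) \<subseteq> ints" using R_ints eO by (auto simp: f_def)
    fix z assume z: "z \<in> ints"
    obtain x where x: "x \<in> Ra" "z - x \<in> a" using reps_ex[OF Ra(1) z] by blast
    obtain y where y: "y \<in> Rq" "z - y \<in> q" using reps_ex[OF Rq(1) z] by blast
    have "z - f (x, y) \<in> a" using x(2) fa[of x y] R_ints x y ideal_diff_commute[OF a(1)] ideal_diff_trans[OF a(1)] by blast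
    moreover have "z - f (x, y) \<in> q" using y(2) fq[of x y] R_ints x y ideal_diff_commute[OF q(1)] ideal_diff_trans[OF q(1)] by blast
    ultimately have z1: "z - f (x, y) \<in> a \<inter> q" by simp
    show "\<exists>!r. r \<in> f ` (Ra \<times> Rq) \<and> z - r \<in> a \<inter> q"
    proof (rule ex1I[of _ "f (x, y)"])
      show "f (x, y) \<in> f ` (Ra \<times> Rq) \<and> z - f (x, y) \<in> a \<inter> q" using x y z1 by auto
      fix r assume r: "r \<in> f ` (Ra \<times> Rq) \<and> z - r \<in> a \<inter> q"
      then obtain x' y' where r': "r = f (x', y')" "x' \<in> Ra" "y' \<in> Rq" by auto
      have "(z - f (x, y)) - (z - r) \<in> a \<inter> q" using r by (intro ideal_diff[OF aq z1]) simp
      then have "f (x', y') - f (x, y) \<in> a \<inter> q" by (simp add: r')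
      from unique[OF r'(2) x(1) r'(3) y(1) this] show "r = f (x, y)" by (simp add: r')
    qed
  qed
  then have "nrm (a \<inter> q) = card (f ` (Ra \<times> Rq))" by (rule nrm_eq[OF aq])
  also have "\<dots> = card (Ra \<times> Rq)"
  proof (rule card_image, rule inj_onI, clarify)
    fix x y x' y' assume "x \<in> Ra" "y \<in> Rq" "x' \<in> Ra" "y' \<in> Rq" "f (x, y) = f (x', y')"
    then show "x = x' \<and> y = y'" using ideal_0[OF aq] by (intro unique) auto
  qed
  finally show ?thesis using Ra Rq by (simp add: card_cartesian_product)
qed

lemma Int_ideal_nonzero:
  assumes I: "is_ideal I" "I \<noteq> {0}" and J: "is_ideal J" "J \<noteq> {0}"
  shows "I \<inter> J \<noteq> {0}"
proof
  assume z: "I \<inter> J = {0}"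
  have "of_int (int (nrm J)) * of_nat (nrm I) \<in> I" by (intro ideal_mult[OF I(1) ints_of_int] nrm_mem I)
  moreover have "of_int (int (nrm I)) * of_nat (nrm J) \<in> J" by (intro ideal_mult[OF J(1) ints_of_int] nrm_mem J)
  ultimately have "of_nat (nrm J) * of_nat (nrm I) \<in> I \<inter> J" by (simp add: mult.commute)
  then show False using z nrm_pos[OF I] nrm_pos[OF J] by simp
qed

text \<open>Write 2 x in the Hermite basis of c. Two elements whose coordinates have the same
  parities differ by an element of c, so there are at most four classes modulo c; this is the origin
  of every factor 4 in the bounds on square roots.\<close>

lemma card_two_torsion:
  assumes q: "is_ideal q" "q \<noteq> {0}" and c: "is_ideal c" "q \<subseteq> c" and S: "incongruent q S"
  shows "card {x \<in> S. 2 * x \<in> c} * nrm c \<le> 4 * nrm q"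
proof -
  have c0: "c \<noteq> {0}" using c q ideal_0[OF q(1)] by auto
  obtain C a b where h: "hnf C a b c" using ideal_hnf[OF c(1) c0] .
  have finS: "finite S" by (rule incongruent_finite[OF q S])
  define T where "T = {x \<in> S. 2 * x \<in> c}"
  have SO: "S \<subseteq> ints" using S by (simp add: incongruent_def)
  have "\<forall>x\<in>T. \<exists>XY. 2 * x = pt (C * (fst XY * a + snd XY * b)) (C * snd XY)"
    using h by (auto simp: T_def hnf_def)
  then obtain g where g: "\<And>x. x \<in> T \<Longrightarrow> 2 * x = pt (C * (fst (g x) * a + snd (g x) * b)) (C * snd (g x))" by metis
  define p where "p = (\<lambda>x. (fst (g x) mod 2, snd (g x) mod 2))"
  have pT: "p ` T \<subseteq> {0,1} \<times> {0,1}" by (auto simp: p_def)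
  have finT: "finite T" using finS by (simp add: T_def)
  have fib: "card {x \<in> T. p x = k} * nrm c \<le> nrm q" for k
  proof (cases "{x \<in> T. p x = k} = {}")
    case True then show ?thesis by (simp only: card.empty)
  next
    case False
    then obtain y where y: "y \<in> T" "p y = k" by blast
    have "{x \<in> T. p x = k} \<subseteq> {x \<in> S. x - y \<in> c}"
    proof
      fix x assume x: "x \<in> {x \<in> T. p x = k}"
      then have par: "even (fst (g x) - fst (g y))" "even (snd (g x) - snd (g y))"
        using y by (auto simp: p_def mod_eq_dvd_iff)
      obtain Z where Z: "fst (g x) - fst (g y) = 2 * Z" using par(1) by (rule evenE)
      obtain Y where Y: "snd (g x) - snd (g y) = 2 * Y" using par(2) by (rule evenE)
      note XY = Z Y
      have "2 * (x - y) = pt (C * (fst (g x) * a + snd (g x) * b)) (C * snd (g x)) - pt (C * (fst (g y) * a + snd (g y) * b)) (C * snd (g y))"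
        using g[of x] g[of y] x y by (simp add: right_diff_distrib)
      also have "\<dots> = pt (C * ((fst (g x) - fst (g y)) * a + (snd (g x) - snd (g y)) * b)) (C * (snd (g x) - snd (g y)))"
        unfolding pt_diff by (simp add: algebra_simps)
      also have "\<dots> = 2 * pt (C * (Z * a + Y * b)) (C * Y)"
        unfolding XY by (simp add: pt_def algebra_simps)
      finally have "x - y = pt (C * (Z * a + Y * b)) (C * Y)" by (metis mult_left_cancel zero_neq_numeral)
      then have "x - y \<in> c" using h by (auto simp: hnf_def)
      then show "x \<in> {x \<in> S. x - y \<in> c}" using x by (simp add: T_def)
    qed
    then have "card {x \<in> T. p x = k} \<le> card {x \<in> S. x - y \<in> c}" using finS by (intro card_mono) auto
    then have "card {x \<in> T. p x = k} * nrm c \<le> card {x \<in> S. x - y \<in> c} * nrm c" by simp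
    also have "\<dots> \<le> nrm q" using y SO by (intro card_class_incongruent[OF q c S]) (auto simp: T_def)
    finally show ?thesis .
  qed
  have "card T = (\<Sum>k\<in>{0,1}\<times>{0,1}. card {x \<in> T. p x = k})"
    using card_eq_sum[of T] sum.group[OF finT _ pT, of "\<lambda>_. 1::nat"] by simp
  then have "card T * nrm c = (\<Sum>k\<in>{0,1}\<times>{0,1}. card {x \<in> T. p x = k} * nrm c)" by (simp only: sum_distrib_right)
  also have "\<dots> \<le> (\<Sum>k\<in>{0::int,1}\<times>{0::int,1}. nrm q)" by (intro sum_mono fib)
  also have "\<dots> = 4 * nrm q" by (simp add: card_cartesian_product)
  finally show ?thesis by (simp add: T_def)
qed

definition ideal_count :: "complex set \<Rightarrow> nat" where
  "ideal_count q = card {g. is_ideal g \<and> q \<subseteq> g}"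

lemma is_ideal_plus_principal:
  assumes c: "is_ideal c" and x: "x \<in> ints"
  shows "is_ideal {x * r + y | r y. r \<in> ints \<and> y \<in> c}"
  unfolding is_ideal_def
proof (intro conjI ballI)
  show "{x * r + y | r y. r \<in> ints \<and> y \<in> c} \<subseteq> ints" using x ideal_ints[OF c] by auto
  show "0 \<in> {x * r + y | r y. r \<in> ints \<and> y \<in> c}"
    using ideal_0[OF c] by (auto intro!: exI[of _ 0])
  fix u v assume "u \<in> {x * r + y | r y. r \<in> ints \<and> y \<in> c}" "v \<in> {x * r + y | r y. r \<in> ints \<and> y \<in> c}"
  then obtain r y r' y' where uv: "u = x * r + y" "v = x * r' + y'" "r \<in> ints" "y \<in> c" "r' \<in> ints" "y' \<in> c" by blast
  then have "u + v = x * (r + r') + (y + y')" by (simp add: algebra_simps)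
  then show "u + v \<in> {x * r + y | r y. r \<in> ints \<and> y \<in> c}" using uv ideal_add[OF c] by blast
next
  fix w u assume w: "w \<in> ints" and "u \<in> {x * r + y | r y. r \<in> ints \<and> y \<in> c}"
  then obtain r y where u: "u = x * r + y" "r \<in> ints" "y \<in> c" by blast
  then have "w * u = x * (w * r) + w * y" by (simp add: algebra_simps)
  then show "w * u \<in> {x * r + y | r y. r \<in> ints \<and> y \<in> c}" using u w ideal_mult[OF c] by blast
qed

definition unit_mod :: "complex set \<Rightarrow> complex \<Rightarrow> bool" where
  "unit_mod q x \<longleftrightarrow> x \<in> ints \<and> (\<exists>y\<in>ints. x * y - 1 \<in> q)"

lemma unit_mod_cancel:
  assumes c: "is_ideal c" and u: "unit_mod c u" and x: "x \<in> ints" and ux: "u * x \<in> c"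
  shows "x \<in> c"
proof -
  obtain y where y: "y \<in> ints" "u * y - 1 \<in> c" using u by (auto simp: unit_mod_def)
  have "y * (u * x) - x * (u * y - 1) \<in> c" by (intro ideal_diff[OF c] ideal_mult[OF c] y x ux)
  also have "y * (u * x) - x * (u * y - 1) = x" by (simp add: algebra_simps)
  finally show ?thesis .
qed

lemma unit_mod_mono: "unit_mod q x \<Longrightarrow> q \<subseteq> c \<Longrightarrow> unit_mod c x"
  by (auto simp: unit_mod_def)

lemma unit_mod_mult:
  assumes q: "is_ideal q" and u: "unit_mod q u" and v: "unit_mod q v" shows "unit_mod q (u * v)"
proof -
  obtain y where y: "y \<in> ints" "u * y - 1 \<in> q" using u by (auto simp: unit_mod_def)
  obtain z where z: "z \<in> ints" "v * z - 1 \<in> q" using v by (auto simp: unit_mod_def)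
  have uv: "u \<in> ints" "v \<in> ints" using u v by (auto simp: unit_mod_def)
  have "(v * z) * (u * y - 1) + (v * z - 1) \<in> q" by (intro ideal_add[OF q] ideal_mult[OF q] y z uv ints_mult)
  also have "(v * z) * (u * y - 1) + (v * z - 1) = (u * v) * (y * z) - 1" by (simp add: algebra_simps)
  finally show ?thesis using uv y z by (auto simp: unit_mod_def)
qed

text \<open>Group the roots \<open>\<rho>\<close> by the ideal generated by \<open>\<rho> - \<sigma>\<close> and \<open>c\<close>: two roots in one group differ
  by a 2-torsion element modulo \<open>c\<close>.\<close>

lemma card_square_roots:
  assumes q: "is_ideal q" "q \<noteq> {0}" and c: "is_ideal c" "q \<subseteq> c" and S: "incongruent q S"
    and \<sigma>: "unit_mod c \<sigma>"
  shows "card {\<rho> \<in> S. \<rho>\<^sup>2 - \<sigma>\<^sup>2 \<in> c} * nrm c \<le> 4 * ideal_count c * nrm q"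
proof -
  have c0: "c \<noteq> {0}" using c q ideal_0[OF q(1)] by auto
  have SO: "S \<subseteq> ints" using S by (simp add: incongruent_def)
  have sO: "\<sigma> \<in> ints" using \<sigma> by (simp add: unit_mod_def)
  define T where "T = {\<rho> \<in> S. \<rho>\<^sup>2 - \<sigma>\<^sup>2 \<in> c}"
  have finS: "finite S" by (rule incongruent_finite[OF q S])
  then have finT: "finite T" by (simp add: T_def)
  define g where "g = (\<lambda>\<rho>. {(\<rho> - \<sigma>) * r + y | r y. r \<in> ints \<and> y \<in> c})"
  define G where "G = {g. is_ideal g \<and> c \<subseteq> g}"
  have finG: "finite G" unfolding G_def by (rule finite_ideals_containing[OF c(1) c0])
  have g_ideal: "is_ideal (g \<rho>)" if "\<rho> \<in> S" for \<rho>
    unfolding g_def using that SO sO by (intro is_ideal_plus_principal[OF c(1)]) auto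
  have g_c: "c \<subseteq> g \<rho>" for \<rho>
  proof
    fix y assume "y \<in> c"
    then show "y \<in> g \<rho>" unfolding g_def by (intro CollectI exI[of _ 0] exI[of _ y]) auto
  qed
  have g_mem: "\<rho> - \<sigma> \<in> g \<rho>" for \<rho>
    unfolding g_def using ideal_0[OF c(1)] by (intro CollectI exI[of _ 1] exI[of _ 0]) auto
  have gT: "g ` T \<subseteq> G" using g_ideal g_c by (auto simp: G_def T_def)
  \<comment> \<open>Modulo c the factor \<rho> + \<sigma> annihilates \<rho> - \<sigma>, hence the
    whole ideal \<open>g \<rho>\<close>. Roots with the same ideal thus annihilate each other's
    generators.\<close>
  have annih: "(\<rho> + \<sigma>) * w \<in> c" if rT: "\<rho> \<in> T" and wg: "w \<in> g \<rho>" for \<rho> w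
  proof -
    obtain r y where ry: "w = (\<rho> - \<sigma>) * r + y" "r \<in> ints" "y \<in> c"
      using wg unfolding g_def by blast
    have "r * (\<rho>\<^sup>2 - \<sigma>\<^sup>2) + (\<rho> + \<sigma>) * y \<in> c"
      using rT ry SO sO by (intro ideal_add[OF c(1)] ideal_mult[OF c(1)]) (auto simp: T_def)
    also have "r * (\<rho>\<^sup>2 - \<sigma>\<^sup>2) + (\<rho> + \<sigma>) * y = (\<rho> + \<sigma>) * w" by (simp add: ry algebra_simps power2_eq_square)
    finally show ?thesis .
  qed
  have fib: "card {\<rho> \<in> T. g \<rho> = h} * nrm c \<le> 4 * nrm q" for h
  proof (cases "{\<rho> \<in> T. g \<rho> = h} = {}")
    case True then show ?thesis by (simp only: card.empty)
  next
    case False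
    then obtain \<tau> where \<tau>: "\<tau> \<in> T" "g \<tau> = h" by blast
    have tO: "\<tau> \<in> ints" using \<tau> SO by (auto simp: T_def)
    have "\<rho> - \<tau> \<in> ints \<and> 2 * (\<rho> - \<tau>) \<in> c" if \<rho>: "\<rho> \<in> T" "g \<rho> = h" for \<rho>
    proof -
      have rO: "\<rho> \<in> ints" using \<rho> SO by (auto simp: T_def)
      have h: "is_ideal h" using g_ideal \<tau> by (auto simp: T_def)
      have "\<rho> - \<sigma> \<in> h" "\<tau> - \<sigma> \<in> h" using g_mem \<rho> \<tau> by auto
      from ideal_diff[OF h this] have d: "\<rho> - \<tau> \<in> h" by simp
      have 1: "(\<rho> + \<sigma>) * (\<rho> - \<tau>) \<in> c" using annih[OF \<rho>(1)] d \<rho>(2) by auto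
      have 2: "(\<rho> + \<sigma>) * (\<rho> - \<sigma>) \<in> c" "(\<tau> + \<sigma>) * (\<rho> - \<sigma>) \<in> c"
        using annih[OF \<rho>(1)] annih[OF \<tau>(1)] g_mem[of \<rho>] \<rho>(2) \<tau>(2) by auto
      \<comment> \<open>All three products lie in c, and they combine to 2 \<sigma> (\<rho> -
        \<tau>), from which the unit \<sigma> cancels.\<close>
      have "(\<rho> + \<sigma>) * (\<rho> - \<tau>) - ((\<rho> + \<sigma>) * (\<rho> - \<sigma>) - (\<tau> + \<sigma>) * (\<rho> - \<sigma>)) \<in> c"
        by (intro ideal_diff[OF c(1)] 1 2)
      also have "(\<rho> + \<sigma>) * (\<rho> - \<tau>) - ((\<rho> + \<sigma>) * (\<rho> - \<sigma>) - (\<tau> + \<sigma>) * (\<rho> - \<sigma>)) = \<sigma> * (2 * (\<rho> - \<tau>))"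
        by (simp add: algebra_simps)
      finally have m: "\<sigma> * (2 * (\<rho> - \<tau>)) \<in> c" .
      have o: "2 * (\<rho> - \<tau>) \<in> ints" using rO tO by auto
      have "2 * (\<rho> - \<tau>) \<in> c" by (rule unit_mod_cancel[OF c(1) \<sigma> o m])
      then show ?thesis using rO tO by auto
    qed
    then have sub: "(\<lambda>\<rho>. \<rho> - \<tau>) ` {\<rho> \<in> T. g \<rho> = h} \<subseteq> {x \<in> (\<lambda>\<rho>. \<rho> - \<tau>) ` S. 2 * x \<in> c}"
      by (auto simp: T_def)
    have S': "incongruent q ((\<lambda>\<rho>. \<rho> - \<tau>) ` S)" using S SO tO by (auto simp: incongruent_def)
    have "card {\<rho> \<in> T. g \<rho> = h} = card ((\<lambda>\<rho>. \<rho> - \<tau>) ` {\<rho> \<in> T. g \<rho> = h})"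
      by (rule card_image[symmetric]) (auto simp: inj_on_def)
    also have "\<dots> \<le> card {x \<in> (\<lambda>\<rho>. \<rho> - \<tau>) ` S. 2 * x \<in> c}" using finS by (intro card_mono sub) auto
    finally have "card {\<rho> \<in> T. g \<rho> = h} * nrm c \<le> card {x \<in> (\<lambda>\<rho>. \<rho> - \<tau>) ` S. 2 * x \<in> c} * nrm c" by simp
    also have "\<dots> \<le> 4 * nrm q" by (rule card_two_torsion[OF q c S'])
    finally show ?thesis .
  qed
  have "card T = (\<Sum>h\<in>G. card {\<rho> \<in> T. g \<rho> = h})"
    using card_eq_sum[of T] sum.group[OF finT finG gT, of "\<lambda>_. 1::nat"] by simp
  then have "card T * nrm c = (\<Sum>h\<in>G. card {\<rho> \<in> T. g \<rho> = h} * nrm c)" by (simp only: sum_distrib_right)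
  also have "\<dots> \<le> (\<Sum>h\<in>G. 4 * nrm q)" by (intro sum_mono fib)
  also have "\<dots> = 4 * ideal_count c * nrm q" by (simp add: ideal_count_def G_def)
  finally show ?thesis by (simp add: T_def)
qed

text \<open>Pigeonhole: the box of coordinates 0, ..., k with k the floor of the square root of the
  index has (k + 1)^2 points, more than there are residues, so two are congruent and their
  difference is small.\<close>

lemma small_element:
  assumes I: "is_ideal I" "I \<noteq> {0}"
  obtains \<beta> where "\<beta> \<in> I" "\<beta> \<noteq> 0" "cmod \<beta> \<le> sqrt (real (nrm I)) * (1 + cmod \<omega>)"
proof -
  obtain R where R: "reps I R" "finite R" "card R = nrm I" using ex_reps[OF I] .
  define k where "k = nat \<lfloor>sqrt (real (nrm I))\<rfloor>"
  have k: "real k \<le> sqrt (real (nrm I))" "sqrt (real (nrm I)) < real k + 1"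
    unfolding k_def by (simp_all add: floor_less_iff)
  have "real (nrm I) < (real k + 1)\<^sup>2" using power_strict_mono[OF k(2), of 2] by simp
  then have "real (nrm I) < real ((k + 1)\<^sup>2)" by (simp add: add.commute)
  then have big: "nrm I < (k + 1)\<^sup>2" by (simp only: of_nat_less_iff)
  define B where "B = {0..int k} \<times> {0..int k}"
  have "nat (int k + 1) = k + 1" by linarith
  then have cardB: "card B = (k + 1)\<^sup>2" by (simp add: B_def card_cartesian_product power2_eq_square)
  have "\<forall>ij. \<exists>r. r \<in> R \<and> pt (fst ij) (snd ij) - r \<in> I"
    using reps_ex[OF R(1) pt_in_ints] by blast
  then obtain f where f0: "\<And>ij. f ij \<in> R \<and> pt (fst ij) (snd ij) - f ij \<in> I" by metis
  have f: "f (i, j) \<in> R \<and> pt i j - f (i, j) \<in> I" for i j using f0[of "(i, j)"] by simp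
  have "\<not> inj_on f B"
  proof
    assume "inj_on f B"
    moreover have "f ` B \<subseteq> R" using f by auto
    ultimately have "card B \<le> card R" using R by (intro card_inj_on_le)
    then show False using big R cardB by simp
  qed
  then obtain i j i' j' where ij: "(i, j) \<in> B" "(i', j') \<in> B" "f (i, j) = f (i', j')" "(i, j) \<noteq> (i', j')"
    by (auto simp: inj_on_def)
  have "pt i j - f (i, j) \<in> I" "pt i' j' - f (i, j) \<in> I" using f[of i j] f[of i' j'] by (simp_all add: ij(3))
  from ideal_diff[OF I(1) this] have "pt i j - pt i' j' \<in> I" by simp
  then have mem: "pt (i - i') (j - j') \<in> I" by (simp add: pt_diff)
  have bd: "\<bar>real_of_int (i - i')\<bar> \<le> real k" "\<bar>real_of_int (j - j')\<bar> \<le> real k" using ij by (auto simp: B_def)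
  have "cmod (pt (i - i') (j - j')) \<le> \<bar>real_of_int (i - i')\<bar> + \<bar>real_of_int (j - j')\<bar> * cmod \<omega>"
    unfolding pt_def by (rule order_trans[OF norm_triangle_ineq]) (simp only: norm_mult norm_of_int order_refl)
  also have "\<dots> \<le> real k + real k * cmod \<omega>" using bd by (intro add_mono mult_right_mono) auto
  also have "\<dots> = real k * (1 + cmod \<omega>)" by (simp add: algebra_simps)
  also have "\<dots> \<le> sqrt (real (nrm I)) * (1 + cmod \<omega>)" using k by (intro mult_right_mono) auto
  finally show ?thesis using that[OF mem] ij by auto
qed

end

section \<open>Quadratic Gauss sums\<close>

context imaginary_quadratic_order
begin

definition reduced_reps :: "complex set \<Rightarrow> complex set \<Rightarrow> bool" where
  "reduced_reps q S \<longleftrightarrow> (\<forall>x\<in>S. unit_mod q x) \<and> (\<forall>x. unit_mod q x \<longrightarrow> (\<exists>!s. s \<in> S \<and> x - s \<in> q))"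

lemma unit_mod_1 [simp]: "is_ideal q \<Longrightarrow> unit_mod q 1"
  using ideal_0[of q] by (auto simp: unit_mod_def intro!: bexI[of _ 1])

lemma reduced_reps_incongruent:
  assumes q: "is_ideal q" and S: "reduced_reps q S" shows "incongruent q S"
  unfolding incongruent_def
proof (intro conjI ballI impI)
  show "S \<subseteq> ints" using S by (auto simp: reduced_reps_def unit_mod_def)
  fix x y assume xy: "x \<in> S" "y \<in> S" "x - y \<in> q"
  then have "\<exists>!r. r \<in> S \<and> x - r \<in> q" using S by (auto simp: reduced_reps_def)
  moreover have "x - x \<in> q" using ideal_0[OF q] by simp
  ultimately show "x = y" using xy by blast
qed

text \<open>\<phi> need not map \<open>T\<close> into itself, only into classes met by
  \<open>T\<close>. Injectivity modulo q and finiteness make the induced map on representatives a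
  permutation.\<close>

lemma sum_reindex_mod:
  assumes q: "is_ideal q" and T: "finite T" "incongruent q T"
    and per: "\<And>x y. x \<in> ints \<Longrightarrow> y \<in> ints \<Longrightarrow> x - y \<in> q \<Longrightarrow> F x = F y"
    and \<phi>O: "\<And>t. t \<in> T \<Longrightarrow> \<phi> t \<in> ints"
    and \<phi>: "\<And>t. t \<in> T \<Longrightarrow> \<exists>t'\<in>T. \<phi> t - t' \<in> q"
    and inj: "\<And>t t'. t \<in> T \<Longrightarrow> t' \<in> T \<Longrightarrow> \<phi> t - \<phi> t' \<in> q \<Longrightarrow> t - t' \<in> q"
  shows "(\<Sum>t\<in>T. F (\<phi> t)) = (\<Sum>t\<in>T. F t)"
proof -
  have TO: "T \<subseteq> ints" using T by (simp add: incongruent_def)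
  have "\<forall>t\<in>T. \<exists>t'. t' \<in> T \<and> \<phi> t - t' \<in> q" using \<phi> by blast
  then obtain h where h: "\<And>t. t \<in> T \<Longrightarrow> h t \<in> T \<and> \<phi> t - h t \<in> q" by metis
  have "inj_on h T"
  proof (rule inj_onI)
    fix t t' assume t: "t \<in> T" "t' \<in> T" "h t = h t'"
    have "\<phi> t - h t \<in> q" "\<phi> t' - h t \<in> q" using h[OF t(1)] h[OF t(2)] t(3) by auto
    from ideal_diff[OF q this] have "\<phi> t - \<phi> t' \<in> q" by simp
    then have "t - t' \<in> q" by (rule inj[OF t(1,2)])
    then show "t = t'" using T t by (auto simp: incongruent_def)
  qed
  moreover have "h ` T \<subseteq> T" using h by auto
  ultimately have "bij_betw h T T" using endo_inj_surj[OF T(1)] by (simp add: bij_betw_def)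
  then have "(\<Sum>t\<in>T. F t) = (\<Sum>t\<in>T. F (h t))" by (rule sum.reindex_bij_betw[symmetric])
  also have "\<dots> = (\<Sum>t\<in>T. F (\<phi> t))"
    using h TO \<phi>O by (intro sum.cong refl per[symmetric]) auto
  finally show ?thesis by simp
qed

end

section \<open>Additive characters modulo an ideal and their quadratic Gauss sums\<close>

locale additive_character = imaginary_quadratic_order +
  fixes q :: "complex set" and \<psi> :: "complex \<Rightarrow> complex"
  assumes q: "is_ideal q" "q \<noteq> {0}"
    and psi_add: "x \<in> ints \<Longrightarrow> y \<in> ints \<Longrightarrow> \<psi> (x + y) = \<psi> x * \<psi> y"
    and norm_psi: "x \<in> ints \<Longrightarrow> norm (\<psi> x) = 1"
    and psi_q: "x \<in> q \<Longrightarrow> \<psi> x = 1"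
begin

lemma psi_0: "\<psi> 0 = 1" using psi_q[OF ideal_0[OF q(1)]] .

lemma psi_minus: "x \<in> ints \<Longrightarrow> \<psi> (- x) = cnj (\<psi> x)"
proof -
  assume x: "x \<in> ints"
  have "\<psi> x * \<psi> (- x) = 1" using psi_add[of x "-x"] x psi_0 by auto
  moreover have "\<psi> x * cnj (\<psi> x) = 1" using norm_psi[OF x] by (simp add: complex_norm_square[symmetric])
  moreover have "\<psi> x \<noteq> 0" using norm_psi[OF x] by auto
  ultimately show ?thesis by (metis mult_left_cancel)
qed

lemma psi_cong: "x \<in> ints \<Longrightarrow> y \<in> ints \<Longrightarrow> x - y \<in> q \<Longrightarrow> \<psi> x = \<psi> y"
  using psi_add[of "x - y" y] psi_q[of "x - y"] by auto

text \<open>The largest ideal on which \<psi> is trivial, equivalently the annihilator of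
  \<psi>.\<close>

definition kernel_ideal :: "complex set" where
  "kernel_ideal = {x \<in> ints. \<forall>y\<in>ints. \<psi> (x * y) = 1}"

lemma is_ideal_kernel: "is_ideal kernel_ideal"
  unfolding is_ideal_def kernel_ideal_def
proof (intro conjI ballI)
  fix x y assume "x \<in> {x \<in> ints. \<forall>y\<in>ints. \<psi> (x * y) = 1}" "y \<in> {x \<in> ints. \<forall>y\<in>ints. \<psi> (x * y) = 1}"
  then show "x + y \<in> {x \<in> ints. \<forall>y\<in>ints. \<psi> (x * y) = 1}"
    by (auto simp: distrib_right psi_add ints_mult)
next
  fix r x assume r: "r \<in> ints" and x: "x \<in> {x \<in> ints. \<forall>y\<in>ints. \<psi> (x * y) = 1}"
  have "\<psi> (r * x * y) = 1" if "y \<in> ints" for y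
  proof -
    have "r * y \<in> ints" using r that by auto
    then have "\<psi> (x * (r * y)) = 1" using x by blast
    then show ?thesis by (simp add: mult_ac)
  qed
  then show "r * x \<in> {x \<in> ints. \<forall>y\<in>ints. \<psi> (x * y) = 1}" using r x by auto
qed (auto simp: psi_0)

lemma q_subset_kernel: "q \<subseteq> kernel_ideal"
  using ideal_mult'[OF q(1)] ideal_ints[OF q(1)] by (auto simp: kernel_ideal_def intro!: psi_q)

text \<open>Orthogonality: outside the kernel some y has \<open>\<psi> (x * y) \<noteq> 1\<close>,
  and the shift of \<beta> by y multiplies the sum by this value while only permuting its
  terms.\<close>

lemma sum_psi_reps:
  assumes R: "reps q R" and x: "x \<in> ints"
  shows "(\<Sum>\<beta>\<in>R. \<psi> (\<beta> * x)) = (if x \<in> kernel_ideal then of_nat (nrm q) else 0)"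
proof (cases "x \<in> kernel_ideal")
  case True
  have "(\<Sum>\<beta>\<in>R. \<psi> (\<beta> * x)) = (\<Sum>\<beta>\<in>R. 1)"
    using True R by (intro sum.cong refl) (auto simp: kernel_ideal_def reps_def mult.commute)
  then show ?thesis using True nrm_eq[OF q(1) R] by simp
next
  case False
  then obtain y where y: "y \<in> ints" "\<psi> (x * y) \<noteq> 1" using x by (auto simp: kernel_ideal_def)
  have inc: "incongruent q R" by (rule reps_incongruent[OF q(1) R])
  have RO: "R \<subseteq> ints" using R by (simp add: reps_def)
  have "(\<Sum>\<beta>\<in>R. \<psi> ((\<beta> + y) * x)) = (\<Sum>\<beta>\<in>R. \<psi> (\<beta> * x))"
  proof (rule sum_reindex_mod[OF q(1) incongruent_finite(1)[OF q inc] inc, of "\<lambda>\<beta>. \<psi> (\<beta> * x)" "\<lambda>\<beta>. \<beta> + y"])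
    fix u v assume uv: "u \<in> ints" "v \<in> ints" "u - v \<in> q"
    then have "u * x - v * x \<in> q" using ideal_mult'[OF q(1) x uv(3)] by (simp add: left_diff_distrib)
    then show "\<psi> (u * x) = \<psi> (v * x)" using uv x by (intro psi_cong) auto
  next
    fix t assume "t \<in> R"
    then have "t + y \<in> ints" using RO y by auto
    then show "t + y \<in> ints" "\<exists>t'\<in>R. t + y - t' \<in> q" using reps_ex[OF R] by auto
  qed simp
  moreover have "(\<Sum>\<beta>\<in>R. \<psi> ((\<beta> + y) * x)) = \<psi> (x * y) * (\<Sum>\<beta>\<in>R. \<psi> (\<beta> * x))"
    unfolding sum_distrib_left
  proof (rule sum.cong[OF refl])
    fix \<beta> assume "\<beta> \<in> R"
    then have "\<beta> * x \<in> ints" "x * y \<in> ints" using RO x y by auto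
    then show "\<psi> ((\<beta> + y) * x) = \<psi> (x * y) * \<psi> (\<beta> * x)"
      using psi_add[of "\<beta> * x" "x * y"] by (simp add: algebra_simps)
  qed
  ultimately have "(\<psi> (x * y) - 1) * (\<Sum>\<beta>\<in>R. \<psi> (\<beta> * x)) = 0" by (simp add: algebra_simps)
  then show ?thesis using y False by simp
qed

lemma ideal_count_kernel_le: "ideal_count kernel_ideal \<le> ideal_count q"
  unfolding ideal_count_def using q_subset_kernel finite_ideals_containing(1)[OF q]
  by (intro card_mono) auto

definition gauss_sum :: "complex set \<Rightarrow> complex \<Rightarrow> complex" where
  "gauss_sum S \<beta> = (\<Sum>\<rho>\<in>S. \<psi> (\<beta> * \<rho>\<^sup>2))"

lemma gauss_sum_cong:
  assumes S: "reduced_reps q S" and xy: "x \<in> ints" "y \<in> ints" "x - y \<in> q"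
  shows "gauss_sum S x = gauss_sum S y"
  unfolding gauss_sum_def
proof (intro sum.cong refl psi_cong)
  fix \<rho> assume "\<rho> \<in> S"
  then have r: "\<rho>\<^sup>2 \<in> ints" using S by (auto simp: reduced_reps_def unit_mod_def)
  then show "x * \<rho>\<^sup>2 \<in> ints" "y * \<rho>\<^sup>2 \<in> ints" using xy by auto
  show "x * \<rho>\<^sup>2 - y * \<rho>\<^sup>2 \<in> q" using ideal_mult'[OF q(1) r xy(3)] by (simp add: left_diff_distrib)
qed

text \<open>Multiplication by the unit u permutes the reduced residues, and the square of u can be
  absorbed into the summation variable.\<close>

lemma gauss_sum_square:
  assumes S: "reduced_reps q S" and u: "unit_mod q u" and \<beta>: "\<beta> \<in> ints"
  shows "gauss_sum S (\<beta> * u\<^sup>2) = gauss_sum S \<beta>"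
proof -
  have inc: "incongruent q S" by (rule reduced_reps_incongruent[OF q(1) S])
  have SO: "S \<subseteq> ints" using inc by (simp add: incongruent_def)
  have uO: "u \<in> ints" using u by (simp add: unit_mod_def)
  have "(\<Sum>\<rho>\<in>S. \<psi> (\<beta> * (u * \<rho>)\<^sup>2)) = (\<Sum>\<rho>\<in>S. \<psi> (\<beta> * \<rho>\<^sup>2))"
  proof (rule sum_reindex_mod[OF q(1) incongruent_finite(1)[OF q inc] inc, of "\<lambda>\<rho>. \<psi> (\<beta> * \<rho>\<^sup>2)" "\<lambda>\<rho>. u * \<rho>"])
    fix x y assume xy: "x \<in> ints" "y \<in> ints" "x - y \<in> q"
    have "(\<beta> * (x + y)) * (x - y) \<in> q" using xy \<beta> by (intro ideal_mult[OF q(1)]) auto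
    then have "\<beta> * x\<^sup>2 - \<beta> * y\<^sup>2 \<in> q" by (simp add: power2_eq_square algebra_simps)
    then show "\<psi> (\<beta> * x\<^sup>2) = \<psi> (\<beta> * y\<^sup>2)" using xy \<beta> by (intro psi_cong) auto
  next
    fix t assume t: "t \<in> S"
    then show "u * t \<in> ints" using SO uO by auto
    have "unit_mod q (u * t)" using t S by (intro unit_mod_mult[OF q(1) u]) (auto simp: reduced_reps_def)
    then show "\<exists>t'\<in>S. u * t - t' \<in> q" using S by (auto simp: reduced_reps_def)
  next
    fix t t' assume t: "t \<in> S" "t' \<in> S" "u * t - u * t' \<in> q"
    then have m: "u * (t - t') \<in> q" by (simp add: algebra_simps)
    have o: "t - t' \<in> ints" using t SO by auto
    show "t - t' \<in> q" by (rule unit_mod_cancel[OF q(1) u o m])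
  qed
  then show ?thesis by (simp add: gauss_sum_def power_mult_distrib mult_ac)
qed

lemma card_roots_q:
  assumes S: "reduced_reps q S"
  shows "card {u \<in> S. u\<^sup>2 - r \<in> q} \<le> 4 * ideal_count q"
proof (cases "{u \<in> S. u\<^sup>2 - r \<in> q} = {}")
  case True then show ?thesis by (simp only: card.empty)
next
  case False
  then obtain v where v: "v \<in> S" "v\<^sup>2 - r \<in> q" by blast
  have inc: "incongruent q S" by (rule reduced_reps_incongruent[OF q(1) S])
  have "{u \<in> S. u\<^sup>2 - r \<in> q} \<subseteq> {u \<in> S. u\<^sup>2 - v\<^sup>2 \<in> q}"
    using v ideal_diff[OF q(1), of "_ - r" "v\<^sup>2 - r"] by auto
  then have "card {u \<in> S. u\<^sup>2 - r \<in> q} \<le> card {u \<in> S. u\<^sup>2 - v\<^sup>2 \<in> q}"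
    using incongruent_finite(1)[OF q inc] by (intro card_mono) auto
  moreover have "card {u \<in> S. u\<^sup>2 - v\<^sup>2 \<in> q} * nrm q \<le> 4 * ideal_count q * nrm q"
    using v S by (intro card_square_roots[OF q q(1) subset_refl inc]) (auto simp: reduced_reps_def)
  ultimately show ?thesis using nrm_pos[OF q] by simp
qed

text \<open>Expanding the square and summing over \<beta> leaves, by orthogonality, the pairs with
  \<rho>^2 congruent to \<sigma>^2 modulo the kernel c, each with weight N q. For every \<sigma>
  there are at most 4 \<open>ideal_count q\<close> N q / N c such \<rho>, which is where the saving
  in N c arises.\<close>

lemma sum_norm_gauss_sum_reps:
  assumes S: "reduced_reps q S" and R: "reps q R" and \<alpha>: "unit_mod q \<alpha>"
  shows "(\<Sum>\<beta>\<in>R. (norm (gauss_sum S (\<alpha> * \<beta>)))\<^sup>2) * real (nrm kernel_ideal) \<le>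
     4 * real (ideal_count q) * (real (nrm q))\<^sup>2 * real (card S)"
proof -
  define c where "c = kernel_ideal"
  note c = is_ideal_kernel[folded c_def] q_subset_kernel[folded c_def]
  have inc: "incongruent q S" by (rule reduced_reps_incongruent[OF q(1) S])
  have finS: "finite S" by (rule incongruent_finite(1)[OF q inc])
  have SO: "S \<subseteq> ints" using inc by (simp add: incongruent_def)
  have RO: "R \<subseteq> ints" using R by (simp add: reps_def)
  have aO: "\<alpha> \<in> ints" using \<alpha> by (simp add: unit_mod_def)
  \<comment> \<open>Since q is contained in c, \<alpha> is a unit modulo c too and cancels.\<close>
  have mem: "\<alpha> * (\<rho>\<^sup>2 - \<sigma>\<^sup>2) \<in> c \<longleftrightarrow> \<rho>\<^sup>2 - \<sigma>\<^sup>2 \<in> c" if "\<rho> \<in> S" "\<sigma> \<in> S" for \<rho> \<sigma>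
    using that SO unit_mod_cancel[OF c(1) unit_mod_mono[OF \<alpha> c(2)], of "\<rho>\<^sup>2 - \<sigma>\<^sup>2"] ideal_mult[OF c(1) aO]
    by blast
  have summand: "\<psi> (\<alpha> * \<beta> * \<rho>\<^sup>2) * cnj (\<psi> (\<alpha> * \<beta> * \<sigma>\<^sup>2)) = \<psi> (\<beta> * (\<alpha> * (\<rho>\<^sup>2 - \<sigma>\<^sup>2)))"
    if "\<beta> \<in> R" "\<rho> \<in> S" "\<sigma> \<in> S" for \<beta> \<rho> \<sigma>
  proof -
    have o: "\<alpha> * \<beta> * \<rho>\<^sup>2 \<in> ints" "\<alpha> * \<beta> * \<sigma>\<^sup>2 \<in> ints" using that SO RO aO by auto
    have "\<psi> (\<alpha> * \<beta> * \<rho>\<^sup>2 + - (\<alpha> * \<beta> * \<sigma>\<^sup>2)) = \<psi> (\<alpha> * \<beta> * \<rho>\<^sup>2) * cnj (\<psi> (\<alpha> * \<beta> * \<sigma>\<^sup>2))"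
      using o by (subst psi_add) (auto simp: psi_minus)
    then show ?thesis by (simp add: algebra_simps)
  qed
  have "complex_of_real (\<Sum>\<beta>\<in>R. (norm (gauss_sum S (\<alpha> * \<beta>)))\<^sup>2) =
      (\<Sum>\<beta>\<in>R. gauss_sum S (\<alpha> * \<beta>) * cnj (gauss_sum S (\<alpha> * \<beta>)))"
    unfolding of_real_sum complex_norm_square ..
  also have "\<dots> = (\<Sum>\<beta>\<in>R. \<Sum>\<rho>\<in>S. \<Sum>\<sigma>\<in>S. \<psi> (\<beta> * (\<alpha> * (\<rho>\<^sup>2 - \<sigma>\<^sup>2))))"
    unfolding gauss_sum_def cnj_sum sum_product by (intro sum.cong refl summand)
  also have "\<dots> = (\<Sum>\<rho>\<in>S. \<Sum>\<beta>\<in>R. \<Sum>\<sigma>\<in>S. \<psi> (\<beta> * (\<alpha> * (\<rho>\<^sup>2 - \<sigma>\<^sup>2))))" by (rule sum.swap)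
  also have "\<dots> = (\<Sum>\<rho>\<in>S. \<Sum>\<sigma>\<in>S. \<Sum>\<beta>\<in>R. \<psi> (\<beta> * (\<alpha> * (\<rho>\<^sup>2 - \<sigma>\<^sup>2))))"
    by (intro sum.cong refl sum.swap)
  also have "\<dots> = (\<Sum>\<rho>\<in>S. \<Sum>\<sigma>\<in>S. if \<rho>\<^sup>2 - \<sigma>\<^sup>2 \<in> c then of_nat (nrm q) else 0)"
  proof (intro sum.cong refl)
    fix \<rho> \<sigma> assume rs: "\<rho> \<in> S" "\<sigma> \<in> S"
    then have "\<alpha> * (\<rho>\<^sup>2 - \<sigma>\<^sup>2) \<in> ints" using SO aO by auto
    from sum_psi_reps[OF R this]
    show "(\<Sum>\<beta>\<in>R. \<psi> (\<beta> * (\<alpha> * (\<rho>\<^sup>2 - \<sigma>\<^sup>2)))) = (if \<rho>\<^sup>2 - \<sigma>\<^sup>2 \<in> c then of_nat (nrm q) else 0)"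
      using mem[OF rs] by (simp add: c_def)
  qed
  also have "\<dots> = of_real (\<Sum>\<sigma>\<in>S. real (card {\<rho> \<in> S. \<rho>\<^sup>2 - \<sigma>\<^sup>2 \<in> c}) * real (nrm q))"
    by (subst sum.swap) (simp add: finS sum.If_cases Int_def conj_commute)
  finally have eq: "(\<Sum>\<beta>\<in>R. (norm (gauss_sum S (\<alpha> * \<beta>)))\<^sup>2) = (\<Sum>\<sigma>\<in>S. real (card {\<rho> \<in> S. \<rho>\<^sup>2 - \<sigma>\<^sup>2 \<in> c}) * real (nrm q))"
    by (simp only: of_real_eq_iff)
  have "(\<Sum>\<beta>\<in>R. (norm (gauss_sum S (\<alpha> * \<beta>)))\<^sup>2) * real (nrm c) =
      (\<Sum>\<sigma>\<in>S. real (card {\<rho> \<in> S. \<rho>\<^sup>2 - \<sigma>\<^sup>2 \<in> c} * nrm c) * real (nrm q))"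
    unfolding eq sum_distrib_right by (simp add: mult_ac)
  also have "\<dots> \<le> (\<Sum>\<sigma>\<in>S. real (4 * ideal_count q * nrm q) * real (nrm q))"
  proof (intro sum_mono mult_right_mono, unfold of_nat_le_iff)
    fix \<sigma> assume s: "\<sigma> \<in> S"
    have "unit_mod c \<sigma>" using S s unit_mod_mono[OF _ c(2)] by (auto simp: reduced_reps_def)
    then have "card {\<rho> \<in> S. \<rho>\<^sup>2 - \<sigma>\<^sup>2 \<in> c} * nrm c \<le> 4 * ideal_count c * nrm q"
      by (rule card_square_roots[OF q c inc])
    also have "\<dots> \<le> 4 * ideal_count q * nrm q" using ideal_count_kernel_le by (simp add: c_def)
    finally show "card {\<rho> \<in> S. \<rho>\<^sup>2 - \<sigma>\<^sup>2 \<in> c} * nrm c \<le> 4 * ideal_count q * nrm q" .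
  qed simp
  also have "\<dots> = 4 * real (ideal_count q) * (real (nrm q))\<^sup>2 * real (card S)"
    by (simp add: power2_eq_square mult_ac)
  finally show ?thesis by (simp add: c_def)
qed

text \<open>The sum is invariant under multiplying its argument by the square of a unit, so averaging
  over such squares bounds it by the mean square over all residues.\<close>

lemma norm_gauss_sum:
  assumes S: "reduced_reps q S" and \<alpha>: "unit_mod q \<alpha>"
  shows "norm (gauss_sum S \<alpha>) \<le> 4 * real (ideal_count q) * real (nrm q) / sqrt (real (nrm kernel_ideal))"
proof -
  obtain R where R: "reps q R" "finite R" using ex_reps[OF q] .
  define T where "T = real (ideal_count q)"
  define N where "N = real (nrm q)"
  define C where "C = real (nrm kernel_ideal)"
  have aO: "\<alpha> \<in> ints" using \<alpha> by (simp add: unit_mod_def)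
  have inc: "incongruent q S" by (rule reduced_reps_incongruent[OF q(1) S])
  have finS: "finite S" by (rule incongruent_finite(1)[OF q inc])
  have SO: "S \<subseteq> ints" using inc by (simp add: incongruent_def)
  have RO: "R \<subseteq> ints" using R by (simp add: reps_def)
  have "S \<noteq> {}" using S unit_mod_1[OF q(1)] by (auto simp: reduced_reps_def)
  then have cS: "card S > 0" using finS by (simp add: card_gt_0_iff)
  have c0: "C > 0"
  proof -
    have "kernel_ideal \<noteq> {0}" using q_subset_kernel q ideal_0[OF q(1)] by auto
    then show ?thesis unfolding C_def using nrm_pos[OF is_ideal_kernel] by simp
  qed
  have "\<forall>u\<in>S. \<exists>r. r \<in> R \<and> u\<^sup>2 - r \<in> q" using reps_ex[OF R(1)] SO by blast
  then obtain r where r: "\<And>u. u \<in> S \<Longrightarrow> r u \<in> R \<and> u\<^sup>2 - r u \<in> q" by metis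
  have g: "gauss_sum S \<alpha> = gauss_sum S (\<alpha> * r u)" if u: "u \<in> S" for u
  proof -
    have "gauss_sum S \<alpha> = gauss_sum S (\<alpha> * u\<^sup>2)"
      using S u by (intro gauss_sum_square[OF S _ aO, symmetric]) (auto simp: reduced_reps_def)
    also have "\<dots> = gauss_sum S (\<alpha> * r u)"
    proof (rule gauss_sum_cong[OF S])
      show "\<alpha> * u\<^sup>2 \<in> ints" "\<alpha> * r u \<in> ints" using r[OF u] u SO RO aO by auto
      show "\<alpha> * u\<^sup>2 - \<alpha> * r u \<in> q" using ideal_mult[OF q(1) aO, of "u\<^sup>2 - r u"] r[OF u] by (simp add: right_diff_distrib)
    qed
    finally show ?thesis .
  qed
  have "real (card S) * (norm (gauss_sum S \<alpha>))\<^sup>2 = (\<Sum>u\<in>S. (norm (gauss_sum S (\<alpha> * r u)))\<^sup>2)"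
  proof -
    have "(\<Sum>u\<in>S. (norm (gauss_sum S (\<alpha> * r u)))\<^sup>2) = (\<Sum>u\<in>S. (norm (gauss_sum S \<alpha>))\<^sup>2)"
      by (intro sum.cong refl) (simp only: g[symmetric])
    then show ?thesis by simp
  qed
  also have "\<dots> = (\<Sum>\<beta>\<in>R. \<Sum>u\<in>{u \<in> S. r u = \<beta>}. (norm (gauss_sum S (\<alpha> * r u)))\<^sup>2)"
    using r by (intro sum.group[symmetric] finS R) auto
  also have "\<dots> = (\<Sum>\<beta>\<in>R. real (card {u \<in> S. r u = \<beta>}) * (norm (gauss_sum S (\<alpha> * \<beta>)))\<^sup>2)"
    by (intro sum.cong refl) simp
  \<comment> \<open>At most \<open>4 * T\<close> units square to a given class, so the sum over
    squares is at most that multiple of the complete sum over \<beta>. The factor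
    \<open>card S\<close> then occurs on both sides and cancels.\<close>
  also have "\<dots> \<le> (\<Sum>\<beta>\<in>R. (4 * T) * (norm (gauss_sum S (\<alpha> * \<beta>)))\<^sup>2)"
  proof (intro sum_mono mult_right_mono)
    fix \<beta> assume "\<beta> \<in> R"
    have "card {u \<in> S. r u = \<beta>} \<le> card {u \<in> S. u\<^sup>2 - \<beta> \<in> q}"
      using r finS by (intro card_mono) auto
    also have "\<dots> \<le> 4 * ideal_count q" by (rule card_roots_q[OF S])
    finally show "real (card {u \<in> S. r u = \<beta>}) \<le> 4 * T" unfolding T_def by linarith
  qed simp
  finally have "real (card S) * (norm (gauss_sum S \<alpha>))\<^sup>2 * C \<le> 4 * T * ((\<Sum>\<beta>\<in>R. (norm (gauss_sum S (\<alpha> * \<beta>)))\<^sup>2) * C)"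
    using c0 by (simp add: sum_distrib_left mult.assoc)
  also have "\<dots> \<le> 4 * T * (4 * T * N\<^sup>2 * real (card S))"
    unfolding T_def N_def C_def by (intro mult_left_mono sum_norm_gauss_sum_reps[OF S R(1) \<alpha>]) simp
  finally have "real (card S) * ((norm (gauss_sum S \<alpha>))\<^sup>2 * C) \<le> real (card S) * (4 * T * N)\<^sup>2"
    by (simp add: power2_eq_square mult_ac)
  then have "(norm (gauss_sum S \<alpha>))\<^sup>2 * C \<le> (4 * T * N)\<^sup>2" using cS by simp
  then have "(norm (gauss_sum S \<alpha>) * sqrt C)\<^sup>2 \<le> (4 * T * N)\<^sup>2" using c0 by (simp add: power_mult_distrib)
  then have "norm (gauss_sum S \<alpha>) * sqrt C \<le> 4 * T * N"
    by (rule power2_le_imp_le) (simp add: T_def N_def)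
  then show ?thesis using c0 by (simp add: T_def N_def C_def field_simps)
qed

end

section \<open>Sums over dual lattices\<close>

text \<open>In a grid of mesh d / 2 two points of one cell are closer than d, so each cell holds at
  most one point of \<open>L\<close>.\<close>

lemma separated_finite_card:
  fixes L :: "complex set"
  assumes d: "d > 0" and sep: "\<And>x y. x \<in> L \<Longrightarrow> y \<in> L \<Longrightarrow> x \<noteq> y \<Longrightarrow> cmod (x - y) \<ge> d" and W: "W \<ge> 0"
  shows "finite {w \<in> L. cmod w \<le> W}" and "real (card {w \<in> L. cmod w \<le> W}) \<le> (4 * W / d + 2)\<^sup>2"
proof -
  define f where "f = (\<lambda>w. (\<lfloor>2 * Re w / d\<rfloor>, \<lfloor>2 * Im w / d\<rfloor>))"
  define m where "m = \<lfloor>2 * W / d\<rfloor>"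
  define B where "B = {- m - 1..m} \<times> {- m - 1..m}"
  have inj: "inj_on f {w \<in> L. cmod w \<le> W}"
  proof (rule inj_onI, rule ccontr)
    fix x y assume xy: "x \<in> {w \<in> L. cmod w \<le> W}" "y \<in> {w \<in> L. cmod w \<le> W}" "f x = f y" "x \<noteq> y"
    have "\<bar>2 * Re x / d - 2 * Re y / d\<bar> < 1" "\<bar>2 * Im x / d - 2 * Im y / d\<bar> < 1"
      using xy(3) unfolding f_def prod.inject by linarith+
    moreover have "\<bar>a - b\<bar> < d / 2" if "\<bar>2 * a / d - 2 * b / d\<bar> < 1" for a b
    proof -
      have "2 * a / d - 2 * b / d = (2 * a - 2 * b) / d" by (simp add: diff_divide_distrib)
      then have "\<bar>2 * a - 2 * b\<bar> < d" using that d by simp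
      then show ?thesis by linarith
    qed
    ultimately have lt: "\<bar>Re (x - y)\<bar> < d / 2" "\<bar>Im (x - y)\<bar> < d / 2" by simp_all
    have "cmod (x - y) \<le> \<bar>Re (x - y)\<bar> + \<bar>Im (x - y)\<bar>" by (rule cmod_le)
    then have "cmod (x - y) < d" using lt by linarith
    moreover have "cmod (x - y) \<ge> d" using xy(1,2,4) by (intro sep) simp_all
    ultimately show False by linarith
  qed
  have "f ` {w \<in> L. cmod w \<le> W} \<subseteq> B"
  proof (intro image_subsetI)
    fix w assume w: "w \<in> {w \<in> L. cmod w \<le> W}"
    then have ri: "\<bar>Re w\<bar> \<le> W" "\<bar>Im w\<bar> \<le> W" using abs_Re_le_cmod[of w] abs_Im_le_cmod[of w] by auto
    have "\<lfloor>2 * u / d\<rfloor> \<in> {- m - 1..m}" if "\<bar>u\<bar> \<le> W" for u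
    proof -
      have "\<bar>2 * u / d\<bar> \<le> 2 * W / d" using that d by (simp add: abs_mult divide_right_mono)
      then show ?thesis unfolding m_def atLeastAtMost_iff by linarith
    qed
    then show "f w \<in> B" using ri by (simp add: f_def B_def)
  qed
  moreover have finB: "finite B" by (simp add: B_def)
  ultimately show "finite {w \<in> L. cmod w \<le> W}" and le: "real (card {w \<in> L. cmod w \<le> W}) \<le> (4 * W / d + 2)\<^sup>2"
  proof -
    assume sub: "f ` {w \<in> L. cmod w \<le> W} \<subseteq> B"
    show "finite {w \<in> L. cmod w \<le> W}" by (rule inj_on_finite[OF inj sub finB])
    have m0: "m \<ge> 0" using W d by (simp add: m_def)
    have "card {w \<in> L. cmod w \<le> W} \<le> card B" by (rule card_inj_on_le[OF inj sub finB])
    also have "card B = nat (2 * m + 2) * nat (2 * m + 2)" by (simp add: B_def card_cartesian_product add.commute)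
    finally have "real (card {w \<in> L. cmod w \<le> W}) \<le> real (nat (2 * m + 2) * nat (2 * m + 2))"
      by (simp only: of_nat_le_iff)
    also have "\<dots> = (2 * of_int m + 2)\<^sup>2" using m0 by (simp add: power2_eq_square)
    also have "\<dots> \<le> (4 * W / d + 2)\<^sup>2"
    proof (rule power_mono)
      have "of_int m \<le> 2 * W / d" by (simp add: m_def)
      then show "2 * real_of_int m + 2 \<le> 4 * W / d + 2" by simp
    qed (use m0 in simp)
    finally show "real (card {w \<in> L. cmod w \<le> W}) \<le> (4 * W / d + 2)\<^sup>2" .
  qed
qed

text \<open>Without 0 the count has no additive constant: for W < d it is empty, otherwise 4 W / d +
  2 \<le> 6 W / d. The homogeneous form lets the shells of small radius be summed as well.\<close>

lemma card_nonzero_ball: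
  fixes L :: "complex set"
  assumes d: "d > 0" and sep: "\<And>x y. x \<in> L \<Longrightarrow> y \<in> L \<Longrightarrow> x \<noteq> y \<Longrightarrow> cmod (x - y) \<ge> d" and zero: "0 \<in> L"
    and W: "W \<ge> 0"
  shows "real (card {w \<in> L. w \<noteq> 0 \<and> cmod w \<le> W}) \<le> 36 * (W / d)\<^sup>2"
proof (cases "W < d")
  case True
  have "{w \<in> L. w \<noteq> 0 \<and> cmod w \<le> W} = {}" using sep[OF _ zero] True by force
  then show ?thesis by (simp only: card.empty) simp
next
  case False
  have "card {w \<in> L. w \<noteq> 0 \<and> cmod w \<le> W} \<le> card {w \<in> L. cmod w \<le> W}"
    using separated_finite_card(1)[where L=L, OF d sep W] by (intro card_mono) auto
  moreover have "real (card {w \<in> L. cmod w \<le> W}) \<le> (4 * W / d + 2)\<^sup>2"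
    by (rule separated_finite_card(2)[OF d sep W])
  ultimately have "real (card {w \<in> L. w \<noteq> 0 \<and> cmod w \<le> W}) \<le> (4 * W / d + 2)\<^sup>2" by linarith
  also have "\<dots> \<le> (6 * (W / d))\<^sup>2"
  proof (rule power_mono)
    have "W / d \<ge> 1" using False d by simp
    then show "4 * W / d + 2 \<le> 6 * (W / d)" by simp
    show "0 \<le> 4 * W / d + 2" using W d by simp
  qed
  finally show ?thesis by (simp add: power_mult_distrib power_divide)
qed

lemma sum_two_powr_abs_int:
  assumes J: "finite J" shows "(\<Sum>j\<in>J. 2 powr (- \<bar>real_of_int j\<bar>)) \<le> 4"
proof -
  define I where "I = (\<lambda>j. nat \<bar>j\<bar>) ` J"
  have finI: "finite I" unfolding I_def using J by (rule finite_imageI)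
  have eq: "2 powr (- real i) = (1/2) ^ i" for i
    by (simp add: powr_minus powr_realpow power_one_over inverse_eq_divide)
  have fibre: "(\<Sum>j\<in>{j \<in> J. nat \<bar>j\<bar> = i}. 2 powr (- \<bar>real_of_int j\<bar>)) \<le> 2 * 2 powr (- real i)" for i
  proof -
    have val: "2 powr (- \<bar>real_of_int j\<bar>) \<le> 2 powr (- real i)" if "j \<in> {j \<in> J. nat \<bar>j\<bar> = i}" for j
    proof -
      have "\<bar>real_of_int j\<bar> = real i" using that by (simp only: mem_Collect_eq) linarith
      then show ?thesis by simp
    qed
    have sub: "{j \<in> J. nat \<bar>j\<bar> = i} \<subseteq> {int i, - int i}"
    proof
      fix j assume "j \<in> {j \<in> J. nat \<bar>j\<bar> = i}"
      then have "j = int i \<or> j = - int i" unfolding mem_Collect_eq by linarith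
      then show "j \<in> {int i, - int i}" by blast
    qed
    have "card {j \<in> J. nat \<bar>j\<bar> = i} \<le> card {int i, - int i}" by (rule card_mono[OF _ sub]) simp
    also have "\<dots> \<le> 2" by (simp add: card_insert_if)
    finally have "real (card {j \<in> J. nat \<bar>j\<bar> = i}) \<le> 2" by linarith
    then have "real (card {j \<in> J. nat \<bar>j\<bar> = i}) * 2 powr (- real i) \<le> 2 * 2 powr (- real i)"
      by (rule mult_right_mono) simp
    with sum_bounded_above[OF val] show ?thesis by (rule order_trans)
  qed
  have "(\<Sum>j\<in>J. 2 powr (- \<bar>real_of_int j\<bar>)) = (\<Sum>i\<in>I. \<Sum>j\<in>{j \<in> J. nat \<bar>j\<bar> = i}. 2 powr (- \<bar>real_of_int j\<bar>))"
    unfolding I_def using finI by (intro sum.group[symmetric] J) (simp_all add: I_def)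
  also have "\<dots> \<le> (\<Sum>i\<in>I. 2 * 2 powr (- real i))" by (intro sum_mono fibre)
  also have "\<dots> = 2 * (\<Sum>i\<in>I. (1/2) ^ i)" unfolding eq by (simp add: sum_distrib_left)
  also have "\<dots> \<le> 2 * suminf (\<lambda>i. (1/2::real) ^ i)"
    using finI by (intro mult_left_mono sum_le_suminf) auto
  also have "\<dots> = 4" by (simp add: suminf_geometric)
  finally show ?thesis .
qed

text \<open>Dyadic decomposition with shells \<open>4 ^ j < \<delta> |w| \<le> 4 ^ (j + 1)\<close>; the ratio 4 keeps the
  exponent \<open>3/2\<close> integral.\<close>

lemma sum_decay_separated:
  fixes L :: "complex set"
  assumes d: "d > 0" and sep: "\<And>x y. x \<in> L \<Longrightarrow> y \<in> L \<Longrightarrow> x \<noteq> y \<Longrightarrow> cmod (x - y) \<ge> d" and zero: "0 \<in> L"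
    and \<delta>: "\<delta> > 0" and Z: "finite Z" "Z \<subseteq> L - {0}"
  shows "(\<Sum>w\<in>Z. cmod w powr (-3/2) * min 1 ((\<delta> * cmod w) powr (-3/2))) \<le> 2304 * \<delta> powr (-1/2) / d\<^sup>2"
proof -
  \<comment> \<open>Ceiling minus one makes the lower end of each shell strict and the upper end
    attained.\<close>
  define sh where "sh = (\<lambda>w. \<lceil>log 4 (\<delta> * cmod w)\<rceil> - 1)"
  define J where "J = sh ` Z"
  have finJ: "finite J" using Z by (simp add: J_def)
  define F where "F = (\<lambda>w. cmod w powr (-3/2) * min 1 ((\<delta> * cmod w) powr (-3/2)))"
  \<comment> \<open>576 is 36 * 16: a shell reaches out to 4 u / \<delta>, and
    \<open>card_nonzero_ball\<close> squares this radius. Summing over shells gives another factor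
    4, hence 2304.\<close>
  define K where "K = 576 * \<delta> powr (-1/2) / d\<^sup>2"
  have shell: "4 powr real_of_int (sh w) < \<delta> * cmod w" "\<delta> * cmod w \<le> 4 powr (real_of_int (sh w) + 1)" if "w \<in> Z" for w
  proof -
    have "w \<noteq> 0" using that Z by auto
    then have pos: "\<delta> * cmod w > 0" using \<delta> by simp
    have "real_of_int (sh w) < log 4 (\<delta> * cmod w)" "log 4 (\<delta> * cmod w) \<le> real_of_int (sh w) + 1"
      unfolding sh_def by linarith+
    then show "4 powr real_of_int (sh w) < \<delta> * cmod w" "\<delta> * cmod w \<le> 4 powr (real_of_int (sh w) + 1)"
      using pos by (simp_all add: less_log_iff log_le_iff)
  qed
  have inner: "(\<Sum>w\<in>{w \<in> Z. sh w = j}. F w) \<le> K * 2 powr (- \<bar>real_of_int j\<bar>)" for j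
  proof -
    define u where "u = 4 powr real_of_int j"
    have u: "u > 0" by (simp add: u_def)
    have u8: "u powr (-3/2) = 8 powr (- real_of_int j)"
    proof -
      have "(4::real) = 2 powr 2" "(8::real) = 2 powr 3" by simp_all
      then show ?thesis unfolding u_def by (simp only: powr_powr) simp
    qed
    have Fle: "F w \<le> \<delta> powr (3/2) * (8 powr (- real_of_int j) * min 1 (8 powr (- real_of_int j)))"
      if w: "w \<in> {w \<in> Z. sh w = j}" for w
    proof -
      have uw: "u < \<delta> * cmod w" using shell(1)[of w] w by (simp add: u_def)
      have "(\<delta> * cmod w) powr (-3/2) \<le> u powr (-3/2)" using u uw by (intro powr_mono2') auto
      then have le: "(\<delta> * cmod w) powr (-3/2) \<le> 8 powr (- real_of_int j)" unfolding u8 .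
      have "cmod w powr (-3/2) = \<delta> powr (3/2) * (\<delta> * cmod w) powr (-3/2)"
        using \<delta> by (simp add: powr_mult powr_minus field_simps)
      then have "F w = \<delta> powr (3/2) * ((\<delta> * cmod w) powr (-3/2) * min 1 ((\<delta> * cmod w) powr (-3/2)))"
        by (simp add: F_def)
      also have "\<dots> \<le> \<delta> powr (3/2) * (8 powr (- real_of_int j) * min 1 (8 powr (- real_of_int j)))"
        using le by (intro mult_left_mono mult_mono) auto
      finally show ?thesis .
    qed
    have cnt: "real (card {w \<in> Z. sh w = j}) \<le> 36 * (4 * u / (\<delta> * d))\<^sup>2"
    proof -
      have "{w \<in> Z. sh w = j} \<subseteq> {w \<in> L. w \<noteq> 0 \<and> cmod w \<le> 4 * u / \<delta>}"
      proof
        fix w assume w: "w \<in> {w \<in> Z. sh w = j}"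
        then have "\<delta> * cmod w \<le> 4 * u" using shell(2)[of w] by (simp add: u_def powr_add mult.commute)
        then show "w \<in> {w \<in> L. w \<noteq> 0 \<and> cmod w \<le> 4 * u / \<delta>}" using w Z \<delta> by (auto simp: field_simps)
      qed
      moreover have "finite {w \<in> L. w \<noteq> 0 \<and> cmod w \<le> 4 * u / \<delta>}"
        using separated_finite_card(1)[where L=L, OF d sep, of "4 * u / \<delta>"] u \<delta> by (auto elim!: rev_finite_subset)
      ultimately have "real (card {w \<in> Z. sh w = j}) \<le> real (card {w \<in> L. w \<noteq> 0 \<and> cmod w \<le> 4 * u / \<delta>})"
        by (simp add: card_mono)
      also have "\<dots> \<le> 36 * (4 * u / \<delta> / d)\<^sup>2" using u \<delta> by (intro card_nonzero_ball[OF d sep zero]) auto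
      finally show ?thesis by simp
    qed
    have "(\<Sum>w\<in>{w \<in> Z. sh w = j}. F w) \<le> real (card {w \<in> Z. sh w = j}) * (\<delta> powr (3/2) * (8 powr (- real_of_int j) * min 1 (8 powr (- real_of_int j))))"
      using Fle by (intro sum_bounded_above)
    also have "\<dots> \<le> 36 * (4 * u / (\<delta> * d))\<^sup>2 * (\<delta> powr (3/2) * (8 powr (- real_of_int j) * min 1 (8 powr (- real_of_int j))))"
      using cnt by (intro mult_right_mono) auto
    also have "\<dots> = (576 * (\<delta> powr (3/2) / \<delta>\<^sup>2) / d\<^sup>2) * (u\<^sup>2 * 8 powr (- real_of_int j) * min 1 (8 powr (- real_of_int j)))"
      by (simp add: power_mult_distrib power_divide)
    also have "\<delta> powr (3/2) / \<delta>\<^sup>2 = \<delta> powr (-1/2)"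
    proof -
      have "\<delta> powr (-1/2) = \<delta> powr (3/2 - 2)" by simp
      also have "\<dots> = \<delta> powr (3/2) / \<delta>\<^sup>2" unfolding powr_diff using \<delta> by simp
      finally show ?thesis by simp
    qed
    \<comment> \<open>Point count times decay grows like 16^j 8^(-j) = 2^j, which is summable for j
      < 0. For j \<ge> 0 the minimum supplies 8^(-j) \<le> 4^(-j) and leaves 2^(-j).\<close>
    also have "576 * \<delta> powr (-1/2) / d\<^sup>2 * (u\<^sup>2 * 8 powr (- real_of_int j) * min 1 (8 powr (- real_of_int j))) \<le> K * 2 powr (- \<bar>real_of_int j\<bar>)"
      unfolding K_def
    proof (rule mult_left_mono)
      have e: "u\<^sup>2 * 8 powr (- real_of_int j) = 2 powr real_of_int j"
      proof -
        have "u\<^sup>2 = 2 powr (4 * real_of_int j)"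
        proof -
          have "u\<^sup>2 = u powr 2" using u by simp
          also have "\<dots> = (2 powr 2) powr (real_of_int j * 2)" unfolding u_def by (simp add: powr_powr)
          finally show ?thesis unfolding powr_powr by simp
        qed
        moreover have "8 powr (- real_of_int j) = 2 powr (- 3 * real_of_int j)"
        proof -
          have "(8::real) = 2 powr 3" by simp
          then have "8 powr (- real_of_int j) = (2 powr 3) powr (- real_of_int j)" by (simp only:)
          then show ?thesis unfolding powr_powr by simp
        qed
        ultimately have "u\<^sup>2 * 8 powr (- real_of_int j) = 2 powr (4 * real_of_int j + (- 3 * real_of_int j))"
          by (simp only: powr_add)
        then show ?thesis by simp
      qed
      show "u\<^sup>2 * 8 powr (- real_of_int j) * min 1 (8 powr (- real_of_int j)) \<le> 2 powr (- \<bar>real_of_int j\<bar>)"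
      proof (cases "j \<ge> 0")
        case True
        have "8 powr (- real_of_int j) \<le> 4 powr (- real_of_int j)" using True by (intro powr_mono2') auto
        then have "2 powr real_of_int j * min 1 (8 powr (- real_of_int j)) \<le> 2 powr real_of_int j * 4 powr (- real_of_int j)"
          by (intro mult_left_mono) auto
        also have "4 powr (- real_of_int j) = (2 powr 2) powr (- real_of_int j)" by simp
        also have "2 powr real_of_int j * (2 powr 2) powr (- real_of_int j) = 2 powr (- real_of_int j)"
          unfolding powr_powr powr_add[symmetric] by simp
        finally show ?thesis unfolding e using True by simp
      next
        case False
        have "2 powr real_of_int j * min 1 (8 powr (- real_of_int j)) \<le> 2 powr real_of_int j * 1"
          by (intro mult_left_mono) auto
        then show ?thesis unfolding e using False by simp
      qed
    qed simp
    finally show ?thesis .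
  qed
  have "(\<Sum>w\<in>Z. F w) = (\<Sum>j\<in>J. \<Sum>w\<in>{w \<in> Z. sh w = j}. F w)"
    unfolding J_def using Z finJ by (intro sum.group[symmetric]) auto
  also have "\<dots> \<le> (\<Sum>j\<in>J. K * 2 powr (- \<bar>real_of_int j\<bar>))" by (intro sum_mono inner)
  also have "\<dots> = K * (\<Sum>j\<in>J. 2 powr (- \<bar>real_of_int j\<bar>))" by (simp add: sum_distrib_left)
  also have "\<dots> \<le> K * 4" using sum_two_powr_abs_int[OF finJ] by (intro mult_left_mono) (auto simp: K_def)
  finally show ?thesis by (simp add: F_def K_def)
qed

section \<open>Dual lattices of ideals\<close>

context imaginary_quadratic_order
begin

text \<open>\<open>2 * Re\<close> is the trace of the field, so this is the dual for the trace form.\<close>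

definition dual :: "complex set \<Rightarrow> complex set" where
  "dual I = {w. \<forall>z\<in>I. 2 * Re (w * z) \<in> \<int>}"

text \<open>The reciprocal of |\<omega> - cnj \<omega>| times the constant of
  \<open>small_element\<close>.\<close>

definition dual_const :: real where
  "dual_const = 1 / (2 * Im \<omega> * (1 + cmod \<omega>))"

lemma dual_const_pos: "dual_const > 0"
  using Im_pos by (simp add: dual_const_def add_pos_nonneg)

lemma dual_0 [simp]: "0 \<in> dual I" by (simp add: dual_def)

lemma dual_diff: "x \<in> dual I \<Longrightarrow> y \<in> dual I \<Longrightarrow> x - y \<in> dual I"
proof -
  assume xy: "x \<in> dual I" "y \<in> dual I"
  have "2 * Re ((x - y) * z) = 2 * Re (x * z) - 2 * Re (y * z)" for z by (simp add: algebra_simps)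
  then show ?thesis using xy unfolding dual_def by (simp only: mem_Collect_eq) (blast intro: Ints_diff)
qed

lemma cmod_ints_ge_1: "z \<in> ints \<Longrightarrow> z \<noteq> 0 \<Longrightarrow> cmod z \<ge> 1"
proof -
  assume "z \<in> ints" "z \<noteq> 0"
  then obtain x y where z: "z = pt x y" "(x, y) \<noteq> (0, 0)" by (auto elim!: intsE)
  have "norm_form x y \<ge> 1" using norm_form_pos[OF z(2)] by simp
  then have "(cmod z)\<^sup>2 \<ge> 1\<^sup>2" unfolding z(1) cmod_pt by simp
  then show ?thesis by (rule power2_le_imp_le) simp
qed

text \<open>For a small \<beta> in \<open>I\<close> put v = w \<beta>. The traces i of v and j of v
  \<omega> are integers, and v (\<omega> - cnj \<omega>) = j - i cnj \<omega> is a nonzero element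
  of the order, so its modulus is at least 1. Dividing by |\<beta>| bounds |w| uniformly in
  \<open>I\<close>.\<close>

lemma dual_min:
  assumes I: "is_ideal I" "I \<noteq> {0}" and w: "w \<in> dual I" "w \<noteq> 0"
  shows "cmod w \<ge> dual_const / sqrt (real (nrm I))"
proof -
  obtain \<beta> where \<beta>: "\<beta> \<in> I" "\<beta> \<noteq> 0" "cmod \<beta> \<le> sqrt (real (nrm I)) * (1 + cmod \<omega>)"
    using small_element[OF I] .
  define v where "v = w * \<beta>"
  have v0: "v \<noteq> 0" using w \<beta> by (simp add: v_def)
  have "2 * Re (w * \<beta>) \<in> \<int>" using w \<beta> by (auto simp: dual_def)
  then obtain i where i: "2 * Re v = of_int i" unfolding v_def by (auto elim: Ints_cases)
  have "\<beta> * \<omega> \<in> I" using ideal_mult'[OF I(1) ints_omega \<beta>(1)] .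
  then have "2 * Re (w * (\<beta> * \<omega>)) \<in> \<int>" using w by (auto simp: dual_def)
  then obtain j where j: "2 * Re (v * \<omega>) = of_int j" unfolding v_def by (auto elim: Ints_cases simp: mult.assoc)
  have ci: "of_int i = v + cnj v" using i by (simp add: complex_eq_iff)
  have cj: "of_int j = v * \<omega> + cnj v * cnj \<omega>" using j by (auto simp: complex_eq_iff mult.commute)
  have eq: "v * (\<omega> - cnj \<omega>) = of_int j - of_int i * cnj \<omega>" unfolding ci cj by (simp add: algebra_simps)
  have "of_int j - of_int i * cnj \<omega> \<in> ints" by (intro ints_diff ints_mult ints_cnj) auto
  moreover have diff: "\<omega> - cnj \<omega> = of_real (2 * Im \<omega>) * \<i>" by (simp add: complex_eq_iff)
  then have "\<omega> - cnj \<omega> \<noteq> 0" using Im_pos by simp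
  ultimately have "cmod (v * (\<omega> - cnj \<omega>)) \<ge> 1" using v0 eq by (metis cmod_ints_ge_1 mult_eq_0_iff)
  then have "1 \<le> cmod w * cmod \<beta> * (2 * Im \<omega>)"
    unfolding diff v_def using Im_pos by (simp add: norm_mult)
  also have "\<dots> \<le> cmod w * (sqrt (real (nrm I)) * (1 + cmod \<omega>)) * (2 * Im \<omega>)"
    using \<beta> Im_pos by (intro mult_right_mono mult_left_mono) auto
  finally have "1 \<le> cmod w * sqrt (real (nrm I)) * (2 * Im \<omega> * (1 + cmod \<omega>))" by (simp add: algebra_simps)
  moreover have "2 * Im \<omega> * (1 + cmod \<omega>) > 0" using Im_pos by (simp add: add_pos_nonneg)
  ultimately have "dual_const \<le> cmod w * sqrt (real (nrm I))" by (simp add: dual_const_def field_simps)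
  moreover have "sqrt (real (nrm I)) > 0" using nrm_pos[OF I] by simp
  ultimately show ?thesis by (simp add: field_simps)
qed

lemma dual_decay_sum:
  assumes I: "is_ideal I" "I \<noteq> {0}" and \<delta>: "\<delta> > 0" and Z: "finite Z" "Z \<subseteq> dual I - {0}"
  shows "(\<Sum>w\<in>Z. cmod w powr (-3/2) * min 1 ((\<delta> * cmod w) powr (-3/2))) \<le> 2304 / dual_const\<^sup>2 * \<delta> powr (-1/2) * real (nrm I)"
proof -
  have "(\<Sum>w\<in>Z. cmod w powr (-3/2) * min 1 ((\<delta> * cmod w) powr (-3/2))) \<le> 2304 * \<delta> powr (-1/2) / (dual_const / sqrt (real (nrm I)))\<^sup>2"
  proof (rule sum_decay_separated[OF _ _ _ \<delta> Z])
    show "dual_const / sqrt (real (nrm I)) > 0" using dual_const_pos nrm_pos[OF I] by simp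
    show "dual_const / sqrt (real (nrm I)) \<le> cmod (x - y)" if "x \<in> dual I" "y \<in> dual I" "x \<noteq> y" for x y
      using that by (intro dual_min[OF I] dual_diff) auto
  qed simp
  also have "\<dots> = 2304 / dual_const\<^sup>2 * \<delta> powr (-1/2) * real (nrm I)" by (simp add: power_divide)
  finally show ?thesis .
qed

lemma ideal_separated:
  assumes I: "is_ideal I" "I \<noteq> {0}" and x: "x - y \<in> I" "x \<noteq> y"
  shows "cmod (x - y) \<ge> sqrt (real (nrm I))"
  using cmod_ge_nrm[OF I x(1)] x(2) by (intro real_le_lsqrt) auto

end

section \<open>Counting points in residue classes\<close>

lemma integrable_continuous_bounded_support:
  fixes g :: "real \<times> real \<Rightarrow> complex"
  assumes "continuous_on UNIV g" "\<And>p. norm p > B \<Longrightarrow> g p = 0"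
  shows "integrable lborel g"
proof -
  have "integrable lborel (\<lambda>p. indicator (cball (0::real\<times>real) \<bar>B\<bar>) p *\<^sub>R g p)"
    by (intro borel_integrable_compact continuous_on_subset[OF assms(1)]) auto
  also have "(\<lambda>p. indicator (cball (0::real\<times>real) \<bar>B\<bar>) p *\<^sub>R g p) = g"
    using assms(2) by (force simp: indicator_def fun_eq_iff)
  finally show ?thesis .
qed

text \<open>Shows that a function of bounded support still has bounded support after the affine
  change of variables.\<close>

lemma triangular_bound:
  fixes A B C x y :: real
  assumes A: "A > 0" and C: "C > 0" and b: "norm (X0 + x * A + y * B, Y0 + y * C) \<le> r"
  shows "norm (x, y) \<le> (r + \<bar>X0\<bar> + (r + \<bar>Y0\<bar>) / C * \<bar>B\<bar>) / A + (r + \<bar>Y0\<bar>) / C"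
proof -
  have "\<bar>Y0 + y * C\<bar> \<le> r" "\<bar>X0 + x * A + y * B\<bar> \<le> r"
    using b norm_snd_le[of "Y0 + y * C" "X0 + x * A + y * B"] norm_fst_le[of "X0 + x * A + y * B" "Y0 + y * C"] by auto
  then have 1: "\<bar>y * C\<bar> \<le> r + \<bar>Y0\<bar>" and 2: "\<bar>x * A + y * B\<bar> \<le> r + \<bar>X0\<bar>" by linarith+
  have y: "\<bar>y\<bar> \<le> (r + \<bar>Y0\<bar>) / C" using 1 C by (simp add: abs_mult field_simps)
  have "\<bar>y * B\<bar> \<le> (r + \<bar>Y0\<bar>) / C * \<bar>B\<bar>" unfolding abs_mult using y by (intro mult_right_mono) auto
  then have "\<bar>x * A\<bar> \<le> r + \<bar>X0\<bar> + (r + \<bar>Y0\<bar>) / C * \<bar>B\<bar>" using 2 by linarith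
  then have "\<bar>x\<bar> \<le> (r + \<bar>X0\<bar> + (r + \<bar>Y0\<bar>) / C * \<bar>B\<bar>) / A" using A by (simp add: abs_mult field_simps)
  then show ?thesis using y norm_Pair_le[of x y] by simp
qed

text \<open>The first vector of a Hermite basis is real, so passing to lattice coordinates is a
  triangular map and two one-dimensional affine substitutions give the determinant A C.\<close>

lemma integral_triangular:
  fixes g :: "real \<times> real \<Rightarrow> complex"
  assumes g: "continuous_on UNIV g" "\<And>p. norm p > r \<Longrightarrow> g p = 0" and A: "A > 0" and C: "C > 0"
  shows "(LINT p|lborel. g (X0 + fst p * A + snd p * B, Y0 + snd p * C)) = (LINT p|lborel. g p) / of_real (A * C)"
proof -
  define h where "h = (\<lambda>p. g (X0 + fst p * A + snd p * B, Y0 + snd p * C))"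
  have hc: "continuous_on UNIV h"
    unfolding h_def by (intro continuous_on_compose2[OF g(1)] continuous_intros) auto
  have hs: "h p = 0" if "norm p > (\<bar>r\<bar> + \<bar>X0\<bar> + (\<bar>r\<bar> + \<bar>Y0\<bar>) / C * \<bar>B\<bar>) / A + (\<bar>r\<bar> + \<bar>Y0\<bar>) / C" for p
  proof -
    have "norm (X0 + fst p * A + snd p * B, Y0 + snd p * C) > \<bar>r\<bar>"
      using triangular_bound[OF A C, of X0 "fst p" "snd p" B Y0 "\<bar>r\<bar>"] that by (force simp: not_le[symmetric])
    then show ?thesis unfolding h_def by (intro g(2)) simp
  qed
  have hi: "integrable (lborel \<Otimes>\<^sub>M lborel) (\<lambda>(x, y). h (x, y))"
    unfolding lborel_prod using integrable_continuous_bounded_support[OF hc hs] by simp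
  have gi: "integrable (lborel \<Otimes>\<^sub>M lborel) (\<lambda>(x, y). g (x, y))"
    unfolding lborel_prod using integrable_continuous_bounded_support[OF g] by simp
  have "(LINT p|lborel. h p) = (LINT y|lborel. LINT x|lborel. h (x, y))"
    using lborel_pair.integral_snd[OF hi] by (simp add: lborel_prod)
  also have "\<dots> = (LINT y|lborel. (LINT x|lborel. g (x, Y0 + C * y)) / of_real A)"
  proof (rule Bochner_Integration.integral_cong[OF refl])
    fix y :: real
    have "(LINT x|lborel. g (x, Y0 + C * y)) = of_real A * (LINT x|lborel. g ((X0 + y * B) + A * x, Y0 + C * y))"
      using lborel_integral_real_affine[of A "\<lambda>x. g (x, Y0 + C * y)" "X0 + y * B"] A by (simp add: scaleR_conv_of_real)
    also have "(\<lambda>x. g ((X0 + y * B) + A * x, Y0 + C * y)) = (\<lambda>x. h (x, y))"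
      by (simp add: h_def algebra_simps)
    finally show "(LINT x|lborel. h (x, y)) = (LINT x|lborel. g (x, Y0 + C * y)) / of_real A" using A by simp
  qed
  also have "\<dots> = (LINT y|lborel. (LINT x|lborel. g (x, Y0 + C * y))) / of_real A" by simp
  also have "(LINT y|lborel. (LINT x|lborel. g (x, Y0 + C * y))) = (LINT y|lborel. LINT x|lborel. g (x, y)) / of_real C"
    using lborel_integral_real_affine[of C "\<lambda>y. LINT x|lborel. g (x, y)" Y0] C by (simp add: scaleR_conv_of_real)
  also have "(LINT y|lborel. LINT x|lborel. g (x, y)) = (LINT p|lborel. g p)"
    using lborel_pair.integral_snd[OF gi] by (simp add: lborel_prod)
  finally show ?thesis by (simp add: h_def mult.commute)
qed

text \<open>Reduces bounds for the sum over all frequencies to bounds for finite sets of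
  them.\<close>

lemma has_sum_norm_le:
  fixes f :: "'a \<Rightarrow> 'b::real_normed_vector"
  assumes "(f has_sum s) A" "\<And>Z. finite Z \<Longrightarrow> Z \<subseteq> A \<Longrightarrow> norm (sum f Z) \<le> b"
  shows "norm s \<le> b"
proof (rule Lim_norm_ubound)
  show "(sum f \<longlongrightarrow> s) (finite_subsets_at_top A)" using assms(1) by (simp add: has_sum_def)
  show "\<forall>\<^sub>F Z in finite_subsets_at_top A. norm (sum f Z) \<le> b"
    by (rule eventually_finite_subsets_at_top_weakI) (rule assms(2))
qed simp

text \<open>Since \<open>e \<in> \<aa>\<close> and \<open>e \<equiv> 1\<close> modulo \<open>\<qq>\<close>, multiplication by \<open>e\<close> lifts residues modulo \<open>\<qq>\<close> to \<open>\<aa>\<close>.\<close>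

locale residue_count = imaginary_quadratic_order +
  fixes \<aa> \<qq> S :: "complex set" and \<alpha> e :: complex and c0 a0 b0 :: int
  assumes \<aa>: "is_ideal \<aa>" "\<aa> \<noteq> {0}" and \<qq>: "is_ideal \<qq>" "\<qq> \<noteq> {0}"
    and e: "e \<in> \<aa>" "1 - e \<in> \<qq>"
    and \<alpha>: "unit_mod \<qq> \<alpha>" and S: "reduced_reps \<qq> S"
    and hnf: "hnf c0 a0 b0 (\<aa> \<inter> \<qq>)"
begin

text \<open>In real coordinates the basis of \<aa> \<inter> \<qq> consists of the vectors
  (\<open>A\<close>, 0) and (\<open>Bx\<close>, \<open>Cy\<close>).\<close>

definition A :: real where "A = of_int (c0 * a0)"
definition Bx :: real where "Bx = of_int (c0 * b0) + of_int c0 * Re \<omega>"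
definition Cy :: real where "Cy = of_int c0 * Im \<omega>"

lemma A_pos: "A > 0" and Cy_pos: "Cy > 0"
  using hnf Im_pos by (auto simp: A_def Cy_def hnf_def)

definition lat :: "int \<times> int \<Rightarrow> complex" where
  "lat k = pt (c0 * (fst k * a0 + snd k * b0)) (c0 * snd k)"

lemma Re_lat: "Re (lat k) = of_int (fst k) * A + of_int (snd k) * Bx"
  and Im_lat: "Im (lat k) = of_int (snd k) * Cy"
  by (simp_all add: lat_def pt_def A_def Bx_def Cy_def algebra_simps)

lemma inj_lat: "inj lat"
  using hnf by (auto simp: inj_def lat_def hnf_def prod_eq_iff)

lemma range_lat: "range lat = \<aa> \<inter> \<qq>"
proof -
  have "range lat = {pt (c0 * (x * a0 + y * b0)) (c0 * y) | x y. True}"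
    by (force simp: lat_def image_def)
  then show ?thesis using hnf by (simp add: hnf_def)
qed

text \<open>The pair (\<xi>, \<eta>) solves \<xi> A = fst k and \<xi> Bx + \<eta> Cy = snd k, so it
  is the dual basis combination with index k. The number \<open>w k\<close> encodes the same
  frequency through the trace form.\<close>

definition \<xi> :: "int \<times> int \<Rightarrow> real" where "\<xi> k = of_int (fst k) / A"
definition \<eta> :: "int \<times> int \<Rightarrow> real" where "\<eta> k = (of_int (snd k) - of_int (fst k) * Bx / A) / Cy"
definition w :: "int \<times> int \<Rightarrow> complex" where "w k = Complex (\<xi> k / 2) (- \<eta> k / 2)"

lemma Re_w_mult: "2 * Re (w k * z) = \<xi> k * Re z + \<eta> k * Im z"
  by (simp add: w_def)

lemma w_lat: "2 * Re (w k * lat l) = of_int (fst k * fst l + snd k * snd l)"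
  unfolding Re_w_mult Re_lat Im_lat \<xi>_def \<eta>_def using A_pos Cy_pos by (simp add: field_simps)

lemma norm_xi_eta: "norm (\<xi> k, \<eta> k) = 2 * cmod (w k)"
proof -
  have "cmod (w k) = sqrt (((\<xi> k)\<^sup>2 + (\<eta> k)\<^sup>2) / 2\<^sup>2)"
    by (simp add: w_def cmod_def power_divide add_divide_distrib)
  then show ?thesis by (simp add: real_sqrt_divide norm_Pair)
qed

lemma inj_w: "inj w"
proof (rule injI)
  fix k l assume "w k = w l"
  then have 1: "\<xi> k = \<xi> l" "\<eta> k = \<eta> l" by (simp_all add: w_def)
  then have "fst k = fst l" using A_pos by (simp add: \<xi>_def)
  moreover then have "snd k = snd l" using 1(2) A_pos Cy_pos by (simp add: \<eta>_def)
  ultimately show "k = l" by (simp add: prod_eq_iff)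
qed

lemma w_0 [simp]: "w 0 = 0" by (simp add: w_def \<xi>_def \<eta>_def complex_eq_iff)

lemma w_eq_0_iff: "w k = 0 \<longleftrightarrow> k = 0"
  using inj_w w_0 by (metis injD)

definition N\<aa> :: real where "N\<aa> = real (nrm \<aa>)"
definition N\<qq> :: real where "N\<qq> = real (nrm \<qq>)"
definition \<tau> :: real where "\<tau> = real (ideal_count \<qq>)"

lemma N_pos: "N\<aa> > 0" "N\<qq> > 0" using nrm_pos \<aa> \<qq> by (auto simp: N\<aa>_def N\<qq>_def)

lemma nrm_Int: "is_ideal c \<Longrightarrow> \<qq> \<subseteq> c \<Longrightarrow> nrm (\<aa> \<inter> c) = nrm \<aa> * nrm c"
  using nrm_Int_comaximal[of \<aa> c e] \<aa> \<qq> e ideal_0[OF \<qq>(1)] by auto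

lemma Int_nonzero: "is_ideal c \<Longrightarrow> \<qq> \<subseteq> c \<Longrightarrow> \<aa> \<inter> c \<noteq> {0}"
  using Int_ideal_nonzero[OF \<aa>, of c] \<qq> ideal_0[OF \<qq>(1)] by auto

lemma covolume: "A * Cy = N\<aa> * N\<qq> * Im \<omega>"
proof -
  have "int (nrm (\<aa> \<inter> \<qq>)) = c0 * c0 * a0" by (rule nrm_hnf[OF is_ideal_Int[OF \<aa>(1) \<qq>(1)] hnf])
  then have "int (nrm \<aa>) * int (nrm \<qq>) = c0 * c0 * a0" using nrm_Int[OF \<qq>(1)] by simp
  then have "N\<aa> * N\<qq> = of_int (c0 * c0 * a0)" unfolding N\<aa>_def N\<qq>_def
    by (metis of_int_mult of_int_of_nat_eq)
  then show ?thesis by (simp add: A_def Cy_def mult_ac)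
qed

definition ftF :: "real \<Rightarrow> real \<Rightarrow> int \<times> int \<Rightarrow> complex" where
  "ftF R \<delta> k = ft (smooth_disc R \<delta>) (\<xi> k) (\<eta> k)"

definition smooth_pt :: "real \<Rightarrow> real \<Rightarrow> complex \<Rightarrow> real" where
  "smooth_pt R \<delta> z = smooth_disc R \<delta> (Re z, Im z)"

text \<open>1024 is 32 * 32, one factor for each of the two discs that are convolved; the rest is
  the constant of \<open>dual_decay_sum\<close>.\<close>

definition decay_const :: real where
  "decay_const = 1024 * 2304 / dual_const\<^sup>2"

text \<open>All frequencies lie in the dual of \<aa> \<inter> \<qq>. The freedom in \<open>J\<close>
  matters for those in the sparser dual of a larger ideal \<aa> \<inter> c: for them the bound
  involves N \<aa> N c in place of N \<aa> N \<qq>.\<close>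

lemma sum_ftF:
  assumes R: "R \<ge> 0" and \<delta>: "\<delta> > 0" and J: "is_ideal J" "J \<noteq> {0}"
    and K: "finite K" "0 \<notin> K" "\<And>k. k \<in> K \<Longrightarrow> w k \<in> dual J"
  shows "(\<Sum>k\<in>K. norm (ftF R \<delta> k)) \<le> decay_const * sqrt R * \<delta> powr (-1/2) * real (nrm J)"
proof -
  define F where "F = (\<lambda>w. cmod w powr (-3/2) * min 1 ((\<delta> * cmod w) powr (-3/2)))"
  have "norm (ftF R \<delta> k) \<le> 1024 * sqrt R * F (w k)" if k: "k \<in> K" for k
  proof -
    have k0: "k \<noteq> 0" using k K by auto
    then have wp: "cmod (w k) > 0" using w_eq_0_iff by simp
    then have "(\<xi> k, \<eta> k) \<noteq> 0" using norm_xi_eta[of k] by auto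
    from norm_ft_smooth_disc[OF R \<delta> this]
    have "norm (ftF R \<delta> k) \<le> 32 * sqrt R * (2 * cmod (w k)) powr (-3/2) * min 1 (32 * (\<delta> * (2 * cmod (w k))) powr (-3/2))"
      by (simp add: ftF_def norm_xi_eta)
    also have "\<dots> \<le> 32 * sqrt R * cmod (w k) powr (-3/2) * (32 * min 1 ((\<delta> * cmod (w k)) powr (-3/2)))"
    proof (intro mult_mono)
      show "(2 * cmod (w k)) powr (-3/2) \<le> cmod (w k) powr (-3/2)" using wp by (intro powr_mono2') auto
      have "(\<delta> * (2 * cmod (w k))) powr (-3/2) \<le> (\<delta> * cmod (w k)) powr (-3/2)"
        using wp \<delta> by (intro powr_mono2') auto
      then show "min 1 (32 * (\<delta> * (2 * cmod (w k))) powr (-3/2)) \<le> 32 * min 1 ((\<delta> * cmod (w k)) powr (-3/2))"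
        by (simp add: min_def)
    qed (use R in auto)
    finally show ?thesis by (simp add: F_def)
  qed
  then have "(\<Sum>k\<in>K. norm (ftF R \<delta> k)) \<le> (\<Sum>k\<in>K. 1024 * sqrt R * F (w k))" by (rule sum_mono)
  also have "\<dots> = 1024 * sqrt R * (\<Sum>x\<in>w ` K. F x)"
    unfolding sum_distrib_left by (subst sum.reindex) (auto intro: inj_on_subset[OF inj_w])
  also have "\<dots> \<le> 1024 * sqrt R * (2304 / dual_const\<^sup>2 * \<delta> powr (-1/2) * real (nrm J))"
  proof (rule mult_left_mono)
    show "(\<Sum>x\<in>w ` K. F x) \<le> 2304 / dual_const\<^sup>2 * \<delta> powr (-1/2) * real (nrm J)"
      unfolding F_def using K w_eq_0_iff by (intro dual_decay_sum[OF J \<delta>]) auto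
  qed (use R in simp)
  finally show ?thesis by (simp add: decay_const_def mult_ac)
qed

lemma w_dual: "w k \<in> dual (\<aa> \<inter> \<qq>)"
  unfolding dual_def range_lat[symmetric] by (auto simp: w_lat simp del: times_complex.sel)

text \<open>Poisson summation for the smoothed disc pulled back to lattice coordinates around z. The
  translation produces the phase, the change of variables the covolume, and absolute summability is
  \<open>sum_ftF\<close> for \<aa> \<inter> \<qq> together with the single term at 0.\<close>

lemma poisson_lattice:
  assumes R: "R \<ge> 0" and \<delta>: "\<delta> > 0"
  shows "((\<lambda>k. cis (2 * pi * (2 * Re (w k * z))) * ftF R \<delta> k / of_real (A * Cy)) has_sum
     of_real (\<Sum>\<^sub>\<infinity>l. smooth_pt R \<delta> (z + lat l))) UNIV"
proof -
  define H where "H = (\<lambda>p. smooth_disc R \<delta> (Re z + fst p * A + snd p * Bx, Im z + snd p * Cy))"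
  define B0 where "B0 = (R + \<delta> + \<bar>Re z\<bar> + (R + \<delta> + \<bar>Im z\<bar>) / Cy * \<bar>Bx\<bar>) / A + (R + \<delta> + \<bar>Im z\<bar>) / Cy"
  have Fc: "continuous_on UNIV (smooth_disc R \<delta>)" by (rule continuous_smooth_disc[OF R \<delta>])
  interpret compactly_supported H B0
  proof
    show "continuous_on UNIV H"
      unfolding H_def by (intro continuous_on_compose2[OF Fc] continuous_intros) auto
    fix p :: "real \<times> real" assume "norm p > B0"
    then have "norm (Re z + fst p * A + snd p * Bx, Im z + snd p * Cy) > R + \<delta>"
      using triangular_bound[OF A_pos Cy_pos, of "Re z" "fst p" "snd p" Bx "Im z" "R + \<delta>"]
      by (force simp: B0_def not_le[symmetric])
    then show "H p = 0" unfolding H_def by (rule smooth_disc_eq_0[OF R \<delta>])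
  qed
  have ftH: "ft H (of_int (fst k)) (of_int (snd k)) = cis (2 * pi * (2 * Re (w k * z))) * ftF R \<delta> k / of_real (A * Cy)" for k
  proof -
    define g where "g = (\<lambda>p. complex_of_real (smooth_disc R \<delta> p) * cis (- (2 * pi * (\<xi> k * fst p + \<eta> k * snd p))))"
    have gc: "continuous_on UNIV g" unfolding g_def using Fc by (intro continuous_intros)
    have gs: "g p = 0" if "norm p > R + \<delta>" for p using smooth_disc_eq_0[OF R \<delta> that] by (simp add: g_def)
    have ph: "\<xi> k * (Re z + x * A + y * Bx) + \<eta> k * (Im z + y * Cy) =
        2 * Re (w k * z) + (of_int (fst k) * x + of_int (snd k) * y)" for x y
      unfolding Re_w_mult \<xi>_def \<eta>_def using A_pos Cy_pos by (simp add: field_simps)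
    have "ft H (of_int (fst k)) (of_int (snd k)) =
        (LINT p|lborel. cis (2 * pi * (2 * Re (w k * z))) * g (Re z + fst p * A + snd p * Bx, Im z + snd p * Cy))"
      unfolding ft_def
    proof (rule Bochner_Integration.integral_cong[OF refl])
      fix p :: "real \<times> real"
      define t where "t = 2 * Re (w k * z)"
      define v where "v = of_int (fst k) * fst p + of_int (snd k) * snd p"
      have "cis (2 * pi * t) * cis (- (2 * pi * (t + v))) = cis (- (2 * pi * v))"
        by (simp add: cis_mult algebra_simps)
      then show "complex_of_real (H p) * cis (- (2 * pi * (of_int (fst k) * fst p + of_int (snd k) * snd p))) =
          cis (2 * pi * (2 * Re (w k * z))) * g (Re z + fst p * A + snd p * Bx, Im z + snd p * Cy)"
        unfolding g_def H_def fst_conv snd_conv ph t_def[symmetric] v_def[symmetric] by (simp add: mult_ac)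
    qed
    also have "\<dots> = cis (2 * pi * (2 * Re (w k * z))) * (LINT p|lborel. g p) / of_real (A * Cy)"
      by (simp add: integral_triangular[OF gc gs A_pos Cy_pos])
    finally show ?thesis by (simp add: g_def ftF_def ft_def)
  qed
  have aq: "is_ideal (\<aa> \<inter> \<qq>)" "\<aa> \<inter> \<qq> \<noteq> {0}"
    using is_ideal_Int[OF \<aa>(1) \<qq>(1)] Int_nonzero[OF \<qq>(1)] by auto
  define b where "b = decay_const * sqrt R * \<delta> powr (-1/2) * real (nrm (\<aa> \<inter> \<qq>))"
  have bnd: "(\<Sum>k\<in>Z. norm (ftF R \<delta> k)) \<le> b" if "finite Z" "Z \<subseteq> UNIV - {0}" for Z
    unfolding b_def using that w_dual by (intro sum_ftF[OF R \<delta> aq]) auto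
  have "(\<lambda>k. norm (ftF R \<delta> k)) summable_on (UNIV - {0})"
  proof (rule nonneg_bdd_above_summable_on)
    show "bdd_above (sum (\<lambda>k. norm (ftF R \<delta> k)) ` {F. F \<subseteq> UNIV - {0} \<and> finite F})"
      by (rule bdd_aboveI[of _ b]) (auto intro!: bnd)
  qed simp
  then have "(\<lambda>k. norm (ftF R \<delta> k)) summable_on insert 0 (UNIV - {0})" by (subst summable_on_insert_iff)
  then have "(\<lambda>k. norm (ftF R \<delta> k)) summable_on UNIV" by (simp add: insert_absorb insert_Diff_if)
  then have "(\<lambda>k. norm (ftF R \<delta> k) * (1 / (A * Cy))) summable_on UNIV" by (rule summable_on_cmult_left)
  then have "(\<lambda>k. norm (ft H (of_int (fst k)) (of_int (snd k)))) summable_on UNIV"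
    unfolding ftH using A_pos Cy_pos by (simp add: norm_mult norm_divide)
  from poisson_summation[OF this] have "((\<lambda>k. ft H (of_int (fst k)) (of_int (snd k))) has_sum of_real (\<Sum>\<^sub>\<infinity>l. H (int_point l))) UNIV" .
  moreover have "H (int_point l) = smooth_pt R \<delta> (z + lat l)" for l
    by (simp add: H_def int_point_def smooth_pt_def Re_lat Im_lat add.assoc)
  ultimately show ?thesis unfolding ftH by simp
qed

end

lemma has_sum_finite_family:
  fixes f :: "'i \<Rightarrow> 'a \<Rightarrow> 'b::real_normed_vector"
  assumes "finite I" "\<And>i. i \<in> I \<Longrightarrow> (f i has_sum s i) A"
  shows "((\<lambda>x. \<Sum>i\<in>I. f i x) has_sum (\<Sum>i\<in>I. s i)) A"
  using assms by (induction rule: finite_induct) (auto intro!: has_sum_add)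

section \<open>The frequency sum weighted by Gauss sums\<close>

context residue_count
begin

definition shift :: "complex \<Rightarrow> complex" where "shift \<rho> = e * (\<alpha> * \<rho>\<^sup>2)"

text \<open>The pairing with \<open>w k\<close> is integral only on \<aa> \<inter> \<qq>. The factor
  \<open>e\<close> carries \<qq> into this intersection, which turns the phase into a character
  modulo \<qq>.\<close>

definition psi :: "int \<times> int \<Rightarrow> complex \<Rightarrow> complex" where
  "psi k x = cis (2 * pi * (2 * Re (w k * (e * x))))"

lemma S_unit: "\<rho> \<in> S \<Longrightarrow> unit_mod \<qq> \<rho>" using S by (simp add: reduced_reps_def)

lemma S_ints: "\<rho> \<in> S \<Longrightarrow> \<rho> \<in> ints" using S_unit by (simp add: unit_mod_def)

lemma S_incongruent: "incongruent \<qq> S" by (rule reduced_reps_incongruent[OF \<qq>(1) S])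

lemma finite_S: "finite S" by (rule incongruent_finite(1)[OF \<qq> S_incongruent])

lemma card_S_le: "real (card S) \<le> N\<qq>"
  using incongruent_finite(2)[OF \<qq> S_incongruent] by (simp add: N\<qq>_def)

lemma alpha_ints: "\<alpha> \<in> ints" using \<alpha> by (simp add: unit_mod_def)

lemma e_ints: "e \<in> ints" using e ideal_ints[OF \<aa>(1)] by blast

lemma cis_int: "x \<in> \<int> \<Longrightarrow> cis (2 * pi * x) = 1" by (rule cis_multiple_2pi)

lemma cis_eq_1_int: assumes "cis (2 * pi * x) = 1" shows "x \<in> \<int>"
proof -
  have "cos (2 * pi * x) = 1" using assms by (metis cis.sel(1) one_complex.sel(1))
  then obtain m :: int where "2 * pi * x = of_int m * 2 * pi" using cos_one_2pi_int by blast
  then have "x = of_int m" by simp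
  then show ?thesis by simp
qed

lemma additive_character_psi: "additive_character \<omega> s n \<qq> (psi k)"
proof unfold_locales
  show "is_ideal \<qq>" "\<qq> \<noteq> {0}" by (rule \<qq>)+
  show "psi k (x + y) = psi k x * psi k y" for x y
  proof -
    have "2 * Re (w k * (e * (x + y))) = 2 * Re (w k * (e * x)) + 2 * Re (w k * (e * y))"
      unfolding distrib_left by simp
    then show ?thesis by (simp only: psi_def cis_mult distrib_left)
  qed
  show "norm (psi k x) = 1" for x by (simp add: psi_def)
  show "psi k x = 1" if x: "x \<in> \<qq>" for x
  proof -
    have "e * x \<in> \<aa> \<inter> \<qq>"
      using ideal_mult'[OF \<aa>(1) ideal_ints[OF \<qq>(1) x] e(1)] ideal_mult[OF \<qq>(1) e_ints x] by simp
    then have "2 * Re (w k * (e * x)) \<in> \<int>" using w_dual[of k] unfolding dual_def by blast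
    then show ?thesis unfolding psi_def by (rule cis_int)
  qed
qed

text \<open>The annihilator \<open>kernel_ideal\<close> of the character \<open>psi k\<close>, made
  available as a function of k.\<close>

definition kern :: "int \<times> int \<Rightarrow> complex set" where
  "kern k = {x \<in> ints. \<forall>y\<in>ints. psi k (x * y) = 1}"

lemma kern_props:
  shows kern_ideal: "is_ideal (kern k)" and kern_super: "\<qq> \<subseteq> kern k"
    and kern_sum: "norm (\<Sum>\<rho>\<in>S. psi k (\<alpha> * \<rho>\<^sup>2)) \<le> 4 * \<tau> * N\<qq> / sqrt (real (nrm (kern k)))"
proof -
  interpret P: additive_character \<omega> s n \<qq> "psi k" by (rule additive_character_psi)
  have k: "P.kernel_ideal = kern k" unfolding P.kernel_ideal_def kern_def ..
  show "is_ideal (kern k)" "\<qq> \<subseteq> kern k" using P.is_ideal_kernel P.q_subset_kernel by (simp_all add: k)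
  show "norm (\<Sum>\<rho>\<in>S. psi k (\<alpha> * \<rho>\<^sup>2)) \<le> 4 * \<tau> * N\<qq> / sqrt (real (nrm (kern k)))"
    using P.norm_gauss_sum[OF S \<alpha>] unfolding P.gauss_sum_def k \<tau>_def N\<qq>_def .
qed

text \<open>Split z = (1 - e) z + e z. The first part lies in \<aa> \<inter> \<qq>, where
  \<open>w k\<close> is integral; on the second the pairing is the phase of \<open>psi k z\<close>,
  trivial on the kernel.\<close>

lemma w_dual_kern: "w k \<in> dual (\<aa> \<inter> kern k)"
  unfolding dual_def
proof (intro CollectI ballI)
  fix z assume z: "z \<in> \<aa> \<inter> kern k"
  then have zO: "z \<in> ints" using ideal_ints[OF \<aa>(1)] by blast
  have "(1 - e) * z \<in> \<aa> \<inter> \<qq>"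
    using z ideal_mult'[OF \<qq>(1) zO e(2)] ideal_mult[OF \<aa>(1), of "1 - e" z] e_ints by auto
  then have 1: "2 * Re (w k * ((1 - e) * z)) \<in> \<int>" using w_dual[of k] unfolding dual_def by blast
  have "psi k (z * 1) = 1" using z ints_1 unfolding kern_def by blast
  then have 2: "2 * Re (w k * (e * z)) \<in> \<int>" unfolding psi_def by (intro cis_eq_1_int) simp
  have "w k * z = w k * ((1 - e) * z) + w k * (e * z)" by (simp add: algebra_simps)
  then have "2 * Re (w k * z) = 2 * Re (w k * ((1 - e) * z)) + 2 * Re (w k * (e * z))"
    by (simp only: plus_complex.sel distrib_left)
  then show "2 * Re (w k * z) \<in> \<int>" using 1 2 by (simp only: Ints_add)
qed

lemma decay_const_nonneg: "decay_const \<ge> 0" by (simp add: decay_const_def)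

text \<open>Grouped by annihilator c, the Gauss sum contributes (N c)^(-1/2) and the dual lattice N
  c; the product is at most (N \<qq>)^(1/2). One factor \<tau> is from the Gauss sums, the other
  counts the possible c.\<close>

lemma sum_ftF_gauss:
  assumes R: "R \<ge> 0" and \<delta>: "\<delta> > 0" and K: "finite K" "0 \<notin> K"
  shows "(\<Sum>k\<in>K. norm (ftF R \<delta> k) * norm (\<Sum>\<rho>\<in>S. psi k (\<alpha> * \<rho>\<^sup>2))) \<le>
     4 * decay_const * \<tau>\<^sup>2 * (sqrt R * \<delta> powr (-1/2)) * N\<aa> * N\<qq> * sqrt N\<qq>"
proof -
  define G where "G = {g. is_ideal g \<and> \<qq> \<subseteq> g}"
  have finG: "finite G" and cardG: "real (card G) = \<tau>"
    unfolding G_def \<tau>_def ideal_count_def using finite_ideals_containing(1)[OF \<qq>] by auto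
  have kG: "kern ` K \<subseteq> G" using kern_ideal kern_super unfolding G_def by blast
  define E where "E = decay_const * (sqrt R * \<delta> powr (-1/2))"
  have E: "E \<ge> 0" using R decay_const_nonneg by (simp add: E_def)
  have inner: "(\<Sum>k\<in>{k \<in> K. kern k = c}. norm (ftF R \<delta> k) * norm (\<Sum>\<rho>\<in>S. psi k (\<alpha> * \<rho>\<^sup>2))) \<le> 4 * \<tau> * N\<qq> * E * N\<aa> * sqrt N\<qq>"
    if c: "c \<in> G" for c
  proof -
    have ci: "is_ideal c" "\<qq> \<subseteq> c" using c by (auto simp: G_def)
    have c0: "c \<noteq> {0}" using ci \<qq> ideal_0[OF \<qq>(1)] by auto
    define Nc where "Nc = real (nrm c)"
    have Nc: "Nc > 0" "Nc \<le> N\<qq>" unfolding Nc_def N\<qq>_def using nrm_pos[OF ci(1) c0] nrm_mono[OF \<qq> ci] by auto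
    have "(\<Sum>k\<in>{k \<in> K. kern k = c}. norm (ftF R \<delta> k) * norm (\<Sum>\<rho>\<in>S. psi k (\<alpha> * \<rho>\<^sup>2))) \<le>
        (\<Sum>k\<in>{k \<in> K. kern k = c}. norm (ftF R \<delta> k) * (4 * \<tau> * N\<qq> / sqrt Nc))"
      using kern_sum by (intro sum_mono mult_left_mono) (auto simp: Nc_def)
    also have "\<dots> = (4 * \<tau> * N\<qq> / sqrt Nc) * (\<Sum>k\<in>{k \<in> K. kern k = c}. norm (ftF R \<delta> k))"
      by (simp add: sum_distrib_left mult.commute)
    also have "\<dots> \<le> (4 * \<tau> * N\<qq> / sqrt Nc) * (decay_const * sqrt R * \<delta> powr (-1/2) * real (nrm (\<aa> \<inter> c)))"
    proof (rule mult_left_mono)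
      show "(\<Sum>k\<in>{k \<in> K. kern k = c}. norm (ftF R \<delta> k)) \<le> decay_const * sqrt R * \<delta> powr (-1/2) * real (nrm (\<aa> \<inter> c))"
      proof (rule sum_ftF[OF R \<delta> is_ideal_Int[OF \<aa>(1) ci(1)] Int_nonzero[OF ci]])
        show "w k \<in> dual (\<aa> \<inter> c)" if "k \<in> {k \<in> K. kern k = c}" for k
          using w_dual_kern[of k] that by simp
      qed (use K in auto)
      show "0 \<le> 4 * \<tau> * N\<qq> / sqrt Nc" using Nc N_pos by (simp add: \<tau>_def)
    qed
    also have "\<dots> = 4 * \<tau> * N\<qq> * E * N\<aa> * (Nc / sqrt Nc)"
      unfolding nrm_Int[OF ci] by (simp add: E_def N\<aa>_def Nc_def)
    also have "Nc / sqrt Nc = sqrt Nc" using Nc by (simp add: real_div_sqrt)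
    also have "4 * \<tau> * N\<qq> * E * N\<aa> * sqrt Nc \<le> 4 * \<tau> * N\<qq> * E * N\<aa> * sqrt N\<qq>"
      using Nc N_pos E by (intro mult_left_mono) (auto simp: \<tau>_def)
    finally show ?thesis .
  qed
  have "(\<Sum>k\<in>K. norm (ftF R \<delta> k) * norm (\<Sum>\<rho>\<in>S. psi k (\<alpha> * \<rho>\<^sup>2))) =
      (\<Sum>c\<in>G. \<Sum>k\<in>{k \<in> K. kern k = c}. norm (ftF R \<delta> k) * norm (\<Sum>\<rho>\<in>S. psi k (\<alpha> * \<rho>\<^sup>2)))"
    by (rule sum.group[symmetric, OF K(1) finG kG])
  also have "\<dots> \<le> (\<Sum>c\<in>G. 4 * \<tau> * N\<qq> * E * N\<aa> * sqrt N\<qq>)" by (intro sum_mono inner)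
  also have "\<dots> = 4 * decay_const * \<tau>\<^sup>2 * (sqrt R * \<delta> powr (-1/2)) * N\<aa> * N\<qq> * sqrt N\<qq>"
    by (simp add: cardG E_def power2_eq_square mult_ac)
  finally show ?thesis .
qed

definition error_const :: real where "error_const = 4 * decay_const / Im \<omega>"

text \<open>Each of the \<open>card S\<close> residue classes meets \<aa> in a translate of a
  lattice of covolume \<open>N\<aa> * N\<qq> * Im \<omega>\<close>; the coefficient is for the
  squared radius.\<close>

definition main_coeff :: real where "main_coeff = real (card S) * pi / (N\<aa> * N\<qq> * Im \<omega>)"

lemma error_const_nonneg: "error_const \<ge> 0"
  using Im_pos decay_const_nonneg by (simp add: error_const_def)

text \<open>Summing the Poisson formula over \<rho> for each frequency collects the phases into a
  Gauss sum. The frequency 0 yields the main term, and the remaining ones are bounded through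
  \<open>sum_ftF_gauss\<close>.\<close>

lemma smooth_count:
  assumes R: "R \<ge> 0" and \<delta>: "\<delta> > 0"
  shows "\<bar>(\<Sum>\<rho>\<in>S. \<Sum>\<^sub>\<infinity>l. smooth_pt R \<delta> (shift \<rho> + lat l)) - main_coeff * R\<^sup>2\<bar> \<le>
     error_const * \<tau>\<^sup>2 * sqrt N\<qq> * (sqrt R * \<delta> powr (-1/2))"
proof -
  define V where "V = N\<aa> * N\<qq> * Im \<omega>"
  have V: "V > 0" using N_pos Im_pos by (simp add: V_def)
  define T where "T = (\<Sum>\<rho>\<in>S. \<Sum>\<^sub>\<infinity>l. smooth_pt R \<delta> (shift \<rho> + lat l))"
  define f where "f = (\<lambda>k. (\<Sum>\<rho>\<in>S. psi k (\<alpha> * \<rho>\<^sup>2)) * ftF R \<delta> k / of_real V)"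
  have "((\<lambda>k. \<Sum>\<rho>\<in>S. psi k (\<alpha> * \<rho>\<^sup>2) * ftF R \<delta> k / of_real V) has_sum
      (\<Sum>\<rho>\<in>S. of_real (\<Sum>\<^sub>\<infinity>l. smooth_pt R \<delta> (shift \<rho> + lat l)))) UNIV"
  proof (rule has_sum_finite_family[OF finite_S])
    fix \<rho> assume "\<rho> \<in> S"
    show "((\<lambda>k. psi k (\<alpha> * \<rho>\<^sup>2) * ftF R \<delta> k / of_real V) has_sum of_real (\<Sum>\<^sub>\<infinity>l. smooth_pt R \<delta> (shift \<rho> + lat l))) UNIV"
      using poisson_lattice[OF R \<delta>, of "shift \<rho>"] unfolding psi_def shift_def covolume V_def .
  qed
  then have f: "(f has_sum of_real T) UNIV"
    unfolding f_def T_def of_real_sum sum_distrib_right sum_divide_distrib .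
  have f0: "f 0 = of_real (main_coeff * R\<^sup>2)"
  proof -
    have "ftF R \<delta> 0 = of_real (pi * R\<^sup>2)"
      unfolding ftF_def using ft_smooth_disc_0[OF R \<delta>] by (simp add: \<xi>_def \<eta>_def)
    then show ?thesis by (simp add: f_def psi_def main_coeff_def V_def)
  qed
  have "(f has_sum (of_real T - f 0)) (UNIV - {0})"
    by (rule has_sum_Diff[OF f has_sum_finiteI]) auto
  then have "norm (of_real T - f 0) \<le> 4 * decay_const * \<tau>\<^sup>2 * (sqrt R * \<delta> powr (-1/2)) * N\<aa> * N\<qq> * sqrt N\<qq> / V"
  proof (rule has_sum_norm_le)
    fix Z :: "(int \<times> int) set" assume Z: "finite Z" "Z \<subseteq> UNIV - {0}"
    have "norm (sum f Z) \<le> (\<Sum>k\<in>Z. norm (f k))" by (rule norm_sum)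
    also have "\<dots> = (\<Sum>k\<in>Z. norm (ftF R \<delta> k) * norm (\<Sum>\<rho>\<in>S. psi k (\<alpha> * \<rho>\<^sup>2))) / V"
      unfolding f_def sum_divide_distrib using V by (simp add: norm_mult norm_divide mult.commute)
    also have "\<dots> \<le> 4 * decay_const * \<tau>\<^sup>2 * (sqrt R * \<delta> powr (-1/2)) * N\<aa> * N\<qq> * sqrt N\<qq> / V"
      using V Z by (intro divide_right_mono sum_ftF_gauss[OF R \<delta>]) auto
    finally show "norm (sum f Z) \<le> 4 * decay_const * \<tau>\<^sup>2 * (sqrt R * \<delta> powr (-1/2)) * N\<aa> * N\<qq> * sqrt N\<qq> / V" .
  qed
  also have "\<dots> = error_const * \<tau>\<^sup>2 * sqrt N\<qq> * (sqrt R * \<delta> powr (-1/2))"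
    using N_pos Im_pos by (simp add: V_def error_const_def field_simps)
  also have "of_real T - f 0 = complex_of_real (T - main_coeff * R\<^sup>2)" by (simp add: f0)
  finally show ?thesis unfolding norm_of_real T_def .
qed

section \<open>The sharp count between two smoothed counts\<close>

definition solutions :: "complex \<Rightarrow> real \<Rightarrow> complex set" where
  "solutions \<rho> R = {z \<in> \<aa>. z - \<alpha> * \<rho>\<^sup>2 \<in> \<qq> \<and> cmod z \<le> R}"

definition hits :: "complex \<Rightarrow> real \<Rightarrow> (int \<times> int) set" where
  "hits \<rho> R = {l. cmod (shift \<rho> + lat l) \<le> R}"

lemma finite_hits: "R \<ge> 0 \<Longrightarrow> finite (hits \<rho> R)"
proof -
  assume R: "R \<ge> 0"
  define L where "L = (\<lambda>l. shift \<rho> + lat l) ` UNIV"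
  have I: "is_ideal (\<aa> \<inter> \<qq>)" "\<aa> \<inter> \<qq> \<noteq> {0}"
    using is_ideal_Int[OF \<aa>(1) \<qq>(1)] Int_nonzero[OF \<qq>(1)] by auto
  have "finite {z \<in> L. cmod z \<le> R}"
  proof (rule separated_finite_card(1)[OF _ _ R])
    show "sqrt (real (nrm (\<aa> \<inter> \<qq>))) > 0" using nrm_pos[OF I] by simp
    fix x y assume xy: "x \<in> L" "y \<in> L" "x \<noteq> y"
    then obtain k l where kl: "x = shift \<rho> + lat k" "y = shift \<rho> + lat l" by (auto simp: L_def)
    have "lat k \<in> \<aa> \<inter> \<qq>" "lat l \<in> \<aa> \<inter> \<qq>" unfolding range_lat[symmetric] by auto
    from ideal_diff[OF I(1) this] have "x - y \<in> \<aa> \<inter> \<qq>" by (simp add: kl)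
    then show "cmod (x - y) \<ge> sqrt (real (nrm (\<aa> \<inter> \<qq>)))" using xy by (intro ideal_separated[OF I])
  qed
  moreover have "(\<lambda>l. shift \<rho> + lat l) ` hits \<rho> R \<subseteq> {z \<in> L. cmod z \<le> R}"
    by (auto simp: hits_def L_def)
  moreover have "inj_on (\<lambda>l. shift \<rho> + lat l) (hits \<rho> R)" using inj_lat by (auto simp: inj_on_def inj_def)
  ultimately show ?thesis using inj_on_finite by blast
qed

text \<open>\<open>shift \<rho>\<close> lies in \<aa> and is congruent to \<alpha> \<rho>^2 modulo
  \<qq>, so the solutions form its translate by \<aa> \<inter> \<qq>, cut off by the disc.\<close>

lemma card_solutions: assumes \<rho>: "\<rho> \<in> S" shows "card (solutions \<rho> R) = card (hits \<rho> R)"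
proof -
  have x: "\<alpha> * \<rho>\<^sup>2 \<in> ints" using S_ints[OF \<rho>] alpha_ints by auto
  have sa: "shift \<rho> \<in> \<aa>" unfolding shift_def by (rule ideal_mult'[OF \<aa>(1) x e(1)])
  have "(1 - e) * (\<alpha> * \<rho>\<^sup>2) \<in> \<qq>" by (rule ideal_mult'[OF \<qq>(1) x e(2)])
  then have sq: "\<alpha> * \<rho>\<^sup>2 - shift \<rho> \<in> \<qq>" by (simp add: shift_def algebra_simps)
  have "solutions \<rho> R = (\<lambda>l. shift \<rho> + lat l) ` hits \<rho> R"
  proof (intro Set.set_eqI iffI)
    fix z assume z: "z \<in> solutions \<rho> R"
    have "z - shift \<rho> \<in> \<aa>" using z sa ideal_diff[OF \<aa>(1)] by (auto simp: solutions_def)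
    moreover have "z - shift \<rho> \<in> \<qq>" using z sq ideal_diff_trans[OF \<qq>(1)] by (auto simp: solutions_def)
    ultimately have "z - shift \<rho> \<in> range lat" by (simp add: range_lat)
    then obtain l where l: "z - shift \<rho> = lat l" by auto
    then have "z = shift \<rho> + lat l" by (simp add: algebra_simps)
    moreover then have "l \<in> hits \<rho> R" using z by (simp add: hits_def solutions_def)
    ultimately show "z \<in> (\<lambda>l. shift \<rho> + lat l) ` hits \<rho> R" by blast
  next
    fix z assume "z \<in> (\<lambda>l. shift \<rho> + lat l) ` hits \<rho> R"
    then obtain l where l: "z = shift \<rho> + lat l" "cmod z \<le> R" by (auto simp: hits_def)
    have m: "lat l \<in> \<aa>" "lat l \<in> \<qq>" using range_lat by auto
    have "z \<in> \<aa>" unfolding l using ideal_add[OF \<aa>(1) sa m(1)] .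
    moreover have "lat l - (\<alpha> * \<rho>\<^sup>2 - shift \<rho>) \<in> \<qq>" by (rule ideal_diff[OF \<qq>(1) m(2) sq])
    then have "z - \<alpha> * \<rho>\<^sup>2 \<in> \<qq>" by (simp add: l algebra_simps)
    ultimately show "z \<in> solutions \<rho> R" using l by (simp add: solutions_def)
  qed
  moreover have "inj_on (\<lambda>l. shift \<rho> + lat l) (hits \<rho> R)" using inj_lat by (auto simp: inj_on_def inj_def)
  ultimately show ?thesis by (simp add: card_image)
qed

lemma infsum_smooth_pt:
  assumes R: "R \<ge> 0" and \<delta>: "\<delta> > 0"
  shows "(\<Sum>\<^sub>\<infinity>l. smooth_pt R \<delta> (shift \<rho> + lat l)) = (\<Sum>l\<in>hits \<rho> (R + \<delta>). smooth_pt R \<delta> (shift \<rho> + lat l))"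
proof -
  have "smooth_pt R \<delta> (shift \<rho> + lat l) = 0" if "l \<notin> hits \<rho> (R + \<delta>)" for l
    unfolding smooth_pt_def using that
    by (intro smooth_disc_eq_0[OF R \<delta>]) (auto simp: hits_def norm_Pair cmod_def)
  then have "(\<Sum>\<^sub>\<infinity>l. smooth_pt R \<delta> (shift \<rho> + lat l)) = (\<Sum>\<^sub>\<infinity>l\<in>hits \<rho> (R + \<delta>). smooth_pt R \<delta> (shift \<rho> + lat l))"
    by (intro infsum_cong_neutral) auto
  then show ?thesis using finite_hits[of "R + \<delta>"] R \<delta> by simp
qed

text \<open>Smoothing the disc of radius R + \<delta> leaves the value 1 on the disc of radius R,
  giving a majorant.\<close>

lemma count_le_smooth:
  assumes R: "R \<ge> 0" and \<delta>: "\<delta> > 0"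
  shows "real (card (hits \<rho> R)) \<le> (\<Sum>\<^sub>\<infinity>l. smooth_pt (R + \<delta>) \<delta> (shift \<rho> + lat l))"
proof -
  have R': "R + \<delta> \<ge> 0" using R \<delta> by simp
  have "real (card (hits \<rho> R)) = (\<Sum>l\<in>hits \<rho> R. smooth_pt (R + \<delta>) \<delta> (shift \<rho> + lat l))"
  proof -
    have "smooth_pt (R + \<delta>) \<delta> (shift \<rho> + lat l) = 1" if "l \<in> hits \<rho> R" for l
      unfolding smooth_pt_def using that
      by (intro smooth_disc_eq_1[OF R' \<delta>]) (auto simp: hits_def norm_Pair cmod_def)
    then show ?thesis by simp
  qed
  also have "\<dots> \<le> (\<Sum>l\<in>hits \<rho> (R + \<delta> + \<delta>). smooth_pt (R + \<delta>) \<delta> (shift \<rho> + lat l))"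
  proof (rule sum_mono2)
    show "finite (hits \<rho> (R + \<delta> + \<delta>))" using R \<delta> by (intro finite_hits) simp
    show "hits \<rho> R \<subseteq> hits \<rho> (R + \<delta> + \<delta>)" using \<delta> by (auto simp: hits_def)
  qed (simp add: smooth_pt_def smooth_disc_nonneg[OF R' \<delta>])
  finally show ?thesis by (simp add: infsum_smooth_pt[OF R' \<delta>])
qed

text \<open>The smoothed disc is at most 1 and vanishes beyond R + \<delta>; applied with R -
  \<delta> it gives the minorant for radius R.\<close>

lemma smooth_le_count:
  assumes R: "R \<ge> 0" and \<delta>: "\<delta> > 0"
  shows "(\<Sum>\<^sub>\<infinity>l. smooth_pt R \<delta> (shift \<rho> + lat l)) \<le> real (card (hits \<rho> (R + \<delta>)))"
proof -
  have "(\<Sum>l\<in>hits \<rho> (R + \<delta>). smooth_pt R \<delta> (shift \<rho> + lat l)) \<le> (\<Sum>l\<in>hits \<rho> (R + \<delta>). 1)"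
    by (intro sum_mono) (simp add: smooth_pt_def smooth_disc_le_1[OF R \<delta>])
  then show ?thesis by (simp add: infsum_smooth_pt[OF R \<delta>])
qed

text \<open>From \<delta> \<le> R the area changes by at most 3 R \<delta> in either direction and
  sqrt (R + \<delta>) \<le> 2 sqrt R; these are the constants 3 and 2.\<close>

lemma count_estimate:
  assumes \<delta>: "\<delta> > 0" "\<delta> \<le> R"
  shows "\<bar>(\<Sum>\<rho>\<in>S. real (card (solutions \<rho> R))) - main_coeff * R\<^sup>2\<bar> \<le>
     3 * main_coeff * R * \<delta> + 2 * error_const * \<tau>\<^sup>2 * sqrt N\<qq> * (sqrt R * \<delta> powr (-1/2))"
proof -
  have R: "R \<ge> 0" using \<delta> by simp
  define E where "E = error_const * \<tau>\<^sup>2 * sqrt N\<qq> * \<delta> powr (-1/2)"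
  have E: "E \<ge> 0" using error_const_nonneg N_pos by (simp add: E_def)
  have mc: "main_coeff \<ge> 0" using N_pos Im_pos by (simp add: main_coeff_def)
  define T where "T = (\<Sum>\<rho>\<in>S. real (card (solutions \<rho> R)))"
  have T: "T = (\<Sum>\<rho>\<in>S. real (card (hits \<rho> R)))"
    unfolding T_def by (intro sum.cong refl) (simp add: card_solutions)
  have up: "T \<le> main_coeff * (R + \<delta>)\<^sup>2 + E * sqrt (R + \<delta>)"
  proof -
    have "T \<le> (\<Sum>\<rho>\<in>S. \<Sum>\<^sub>\<infinity>l. smooth_pt (R + \<delta>) \<delta> (shift \<rho> + lat l))"
      unfolding T by (intro sum_mono count_le_smooth[OF R \<delta>(1)])
    also have "\<dots> \<le> main_coeff * (R + \<delta>)\<^sup>2 + error_const * \<tau>\<^sup>2 * sqrt N\<qq> * (sqrt (R + \<delta>) * \<delta> powr (-1/2))"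
      using smooth_count[of "R + \<delta>" \<delta>] R \<delta> by linarith
    finally show ?thesis by (simp add: E_def mult_ac)
  qed
  have lo: "T \<ge> main_coeff * (R - \<delta>)\<^sup>2 - E * sqrt (R - \<delta>)"
  proof -
    have R': "R - \<delta> \<ge> 0" using \<delta> by simp
    have "(\<Sum>\<rho>\<in>S. \<Sum>\<^sub>\<infinity>l. smooth_pt (R - \<delta>) \<delta> (shift \<rho> + lat l)) \<le> T"
      unfolding T using smooth_le_count[OF R' \<delta>(1)] by (intro sum_mono) simp
    moreover have "(\<Sum>\<rho>\<in>S. \<Sum>\<^sub>\<infinity>l. smooth_pt (R - \<delta>) \<delta> (shift \<rho> + lat l)) \<ge>
        main_coeff * (R - \<delta>)\<^sup>2 - error_const * \<tau>\<^sup>2 * sqrt N\<qq> * (sqrt (R - \<delta>) * \<delta> powr (-1/2))"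
      using smooth_count[OF R' \<delta>(1)] by linarith
    ultimately show ?thesis by (simp add: E_def mult_ac)
  qed
  have s1: "E * sqrt (R + \<delta>) \<le> E * (2 * sqrt R)"
  proof (intro mult_left_mono E)
    have "sqrt (R + \<delta>) \<le> sqrt (4 * R)" using \<delta> R by simp
    then show "sqrt (R + \<delta>) \<le> 2 * sqrt R" by (simp add: real_sqrt_mult)
  qed
  have s2: "E * sqrt (R - \<delta>) \<le> E * (2 * sqrt R)"
  proof (intro mult_left_mono E)
    have "sqrt (R - \<delta>) \<le> sqrt (4 * R)" using \<delta> R by simp
    then show "sqrt (R - \<delta>) \<le> 2 * sqrt R" by (simp add: real_sqrt_mult)
  qed
  have "\<delta>\<^sup>2 \<le> R * \<delta>" using \<delta> by (simp add: power2_eq_square mult_right_mono)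
  then have "(R + \<delta>)\<^sup>2 \<le> R\<^sup>2 + 3 * (R * \<delta>)" "(R - \<delta>)\<^sup>2 \<ge> R\<^sup>2 - 3 * (R * \<delta>)"
    using R \<delta> by (auto simp: power2_eq_square algebra_simps)
  then have "main_coeff * (R + \<delta>)\<^sup>2 \<le> main_coeff * (R\<^sup>2 + 3 * (R * \<delta>))" "main_coeff * (R - \<delta>)\<^sup>2 \<ge> main_coeff * (R\<^sup>2 - 3 * (R * \<delta>))"
    using mc by (auto intro!: mult_left_mono)
  then have "\<bar>T - main_coeff * R\<^sup>2\<bar> \<le> main_coeff * (3 * (R * \<delta>)) + E * (2 * sqrt R)"
    using up lo s1 s2 by (simp add: algebra_simps abs_le_iff)
  then show ?thesis by (simp add: T_def E_def mult_ac)
qed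

end

section \<open>The elementary count for small t and the choice of the smoothing scale\<close>

context residue_count
begin

lemma card_roots_le: "card {\<rho> \<in> S. z - \<alpha> * \<rho>\<^sup>2 \<in> \<qq>} \<le> 4 * ideal_count \<qq>"
proof (cases "{\<rho> \<in> S. z - \<alpha> * \<rho>\<^sup>2 \<in> \<qq>} = {}")
  case True then show ?thesis by (simp only: card.empty)
next
  case False
  then obtain \<sigma> where \<sigma>: "\<sigma> \<in> S" "z - \<alpha> * \<sigma>\<^sup>2 \<in> \<qq>" by blast
  have "{\<rho> \<in> S. z - \<alpha> * \<rho>\<^sup>2 \<in> \<qq>} \<subseteq> {\<rho> \<in> S. \<rho>\<^sup>2 - \<sigma>\<^sup>2 \<in> \<qq>}"
  proof
    fix \<rho> assume \<rho>: "\<rho> \<in> {\<rho> \<in> S. z - \<alpha> * \<rho>\<^sup>2 \<in> \<qq>}"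
    have "(z - \<alpha> * \<sigma>\<^sup>2) - (z - \<alpha> * \<rho>\<^sup>2) \<in> \<qq>" using \<rho> by (intro ideal_diff[OF \<qq>(1) \<sigma>(2)]) simp
    then have m: "\<alpha> * (\<rho>\<^sup>2 - \<sigma>\<^sup>2) \<in> \<qq>" by (simp add: algebra_simps)
    have o: "\<rho>\<^sup>2 - \<sigma>\<^sup>2 \<in> ints" using S_ints \<rho> \<sigma> by auto
    have "\<rho>\<^sup>2 - \<sigma>\<^sup>2 \<in> \<qq>" by (rule unit_mod_cancel[OF \<qq>(1) \<alpha> o m])
    then show "\<rho> \<in> {\<rho> \<in> S. \<rho>\<^sup>2 - \<sigma>\<^sup>2 \<in> \<qq>}" using \<rho> by simp
  qed
  then have "card {\<rho> \<in> S. z - \<alpha> * \<rho>\<^sup>2 \<in> \<qq>} \<le> card {\<rho> \<in> S. \<rho>\<^sup>2 - \<sigma>\<^sup>2 \<in> \<qq>}"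
    using finite_S by (intro card_mono) auto
  moreover have "card {\<rho> \<in> S. \<rho>\<^sup>2 - \<sigma>\<^sup>2 \<in> \<qq>} * nrm \<qq> \<le> 4 * ideal_count \<qq> * nrm \<qq>"
    by (rule card_square_roots[OF \<qq> \<qq>(1) subset_refl S_incongruent S_unit[OF \<sigma>(1)]])
  ultimately show ?thesis using nrm_pos[OF \<qq>] by simp
qed

text \<open>If 0 is congruent to \<alpha> \<rho>^2 with unit \<alpha> and \<rho>, then 1 lies in
  \<qq> and there is only one residue class. This keeps the term of the trivial count that does not
  grow with t free of \<tau>.\<close>

lemma card_roots_0_le: "card {\<rho> \<in> S. 0 - \<alpha> * \<rho>\<^sup>2 \<in> \<qq>} \<le> 1"
proof (cases "{\<rho> \<in> S. 0 - \<alpha> * \<rho>\<^sup>2 \<in> \<qq>} = {}")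
  case True then show ?thesis by (simp only: card.empty)
next
  case False
  then obtain \<sigma> where \<sigma>: "\<sigma> \<in> S" "- (\<alpha> * \<sigma>\<^sup>2) \<in> \<qq>" by auto
  have sO: "\<sigma> \<in> ints" by (rule S_ints[OF \<sigma>(1)])
  have m: "\<alpha> * (\<sigma> * \<sigma>) \<in> \<qq>" using ideal_minus[OF \<qq>(1) \<sigma>(2)] by (simp add: power2_eq_square)
  have "\<sigma> * \<sigma> \<in> \<qq>" using unit_mod_cancel[OF \<qq>(1) \<alpha> ints_mult[OF sO sO] m] .
  then have "\<sigma> \<in> \<qq>" using unit_mod_cancel[OF \<qq>(1) S_unit[OF \<sigma>(1)] sO] by blast
  then have m1: "\<sigma> * 1 \<in> \<qq>" by simp
  have one: "1 \<in> \<qq>" using unit_mod_cancel[OF \<qq>(1) S_unit[OF \<sigma>(1)] ints_1 m1] .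
  have all: "x \<in> \<qq>" if "x \<in> ints" for x using ideal_mult[OF \<qq>(1) that one] by simp
  have "\<rho> = \<sigma>" if "\<rho> \<in> S" for \<rho>
  proof -
    have "\<rho> - \<sigma> \<in> \<qq>" using S_ints[OF that] sO by (intro all) auto
    then show ?thesis using S_incongruent that \<sigma> by (auto simp: incongruent_def)
  qed
  then have "{\<rho> \<in> S. 0 - \<alpha> * \<rho>\<^sup>2 \<in> \<qq>} \<subseteq> {\<sigma>}" by auto
  then show ?thesis using card_mono[of "{\<sigma>}"] by fastforce
qed

text \<open>Exchange the sums: each nonzero z in the disc has at most 4 \<tau> square roots, and
  there are at most 36 R^2 / N \<aa> such z, whence 144. The point z = 0 is treated
  separately.\<close>

lemma trivial_count:
  assumes R: "R \<ge> 0"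
  shows "(\<Sum>\<rho>\<in>S. real (card (solutions \<rho> R))) \<le> 1 + 144 * \<tau> * (R\<^sup>2 / N\<aa>)"
proof -
  define Z where "Z = {z \<in> \<aa>. cmod z \<le> R}"
  define d where "d = sqrt N\<aa>"
  have d: "d > 0" using N_pos by (simp add: d_def)
  have sep: "cmod (x - y) \<ge> d" if "x \<in> \<aa>" "y \<in> \<aa>" "x \<noteq> y" for x y
    unfolding d_def N\<aa>_def using ideal_diff[OF \<aa>(1) that(1,2)] that by (intro ideal_separated[OF \<aa>])
  have finZ: "finite Z" unfolding Z_def by (rule separated_finite_card(1)[OF d sep R])
  have "card (Z - {0}) = card {z \<in> \<aa>. z \<noteq> 0 \<and> cmod z \<le> R}" by (rule arg_cong[of _ _ card]) (auto simp: Z_def)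
  then have cZ: "real (card (Z - {0})) \<le> 36 * (R\<^sup>2 / N\<aa>)"
    using card_nonzero_ball[OF d sep ideal_0[OF \<aa>(1)] R] N_pos by (simp add: d_def power_divide)
  have Z0: "0 \<in> Z" using ideal_0[OF \<aa>(1)] R by (simp add: Z_def)
  have "(\<Sum>\<rho>\<in>S. card (solutions \<rho> R)) = (\<Sum>\<rho>\<in>S. \<Sum>z\<in>Z. of_bool (z - \<alpha> * \<rho>\<^sup>2 \<in> \<qq>))"
  proof (rule sum.cong[OF refl])
    fix \<rho>
    have "solutions \<rho> R = Z \<inter> {z. z - \<alpha> * \<rho>\<^sup>2 \<in> \<qq>}" by (auto simp: solutions_def Z_def)
    then show "card (solutions \<rho> R) = (\<Sum>z\<in>Z. of_bool (z - \<alpha> * \<rho>\<^sup>2 \<in> \<qq>))"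
      using finZ by (simp add: of_bool_def sum.If_cases)
  qed
  also have "\<dots> = (\<Sum>z\<in>Z. \<Sum>\<rho>\<in>S. of_bool (z - \<alpha> * \<rho>\<^sup>2 \<in> \<qq>))" by (rule sum.swap)
  also have "\<dots> = (\<Sum>z\<in>Z. card {\<rho> \<in> S. z - \<alpha> * \<rho>\<^sup>2 \<in> \<qq>})"
    using finite_S by (simp add: of_bool_def sum.If_cases Int_def)
  also have "\<dots> = card {\<rho> \<in> S. 0 - \<alpha> * \<rho>\<^sup>2 \<in> \<qq>} + (\<Sum>z\<in>Z - {0}. card {\<rho> \<in> S. z - \<alpha> * \<rho>\<^sup>2 \<in> \<qq>})"
    by (rule sum.remove[OF finZ Z0])
  also have "\<dots> \<le> 1 + (\<Sum>z\<in>Z - {0}. 4 * ideal_count \<qq>)"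
    by (intro add_mono card_roots_0_le sum_mono card_roots_le)
  also have "\<dots> = 1 + card (Z - {0}) * (4 * ideal_count \<qq>)" by simp
  finally have "real (\<Sum>\<rho>\<in>S. card (solutions \<rho> R)) \<le> real (1 + card (Z - {0}) * (4 * ideal_count \<qq>))"
    by (simp only: of_nat_le_iff)
  also have "\<dots> = 1 + real (card (Z - {0})) * (4 * \<tau>)" by (simp add: \<tau>_def)
  also have "\<dots> \<le> 1 + 36 * (R\<^sup>2 / N\<aa>) * (4 * \<tau>)"
    using cZ by (intro add_left_mono mult_right_mono) (auto simp: \<tau>_def)
  finally show ?thesis by (simp add: mult_ac)
qed

lemma main_coeff_le: "main_coeff * R\<^sup>2 \<le> pi / Im \<omega> * (R\<^sup>2 / N\<aa>)"
proof -
  have "main_coeff = real (card S) / N\<qq> * (pi / (N\<aa> * Im \<omega>))" by (simp add: main_coeff_def)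
  also have "\<dots> \<le> 1 * (pi / (N\<aa> * Im \<omega>))" using card_S_le N_pos Im_pos by (intro mult_right_mono) auto
  finally have "main_coeff * R\<^sup>2 \<le> pi / (N\<aa> * Im \<omega>) * R\<^sup>2" by (intro mult_right_mono) auto
  then show ?thesis by (simp add: mult_ac)
qed

lemma N_ge_1: "N\<qq> \<ge> 1" "N\<aa> \<ge> 1"
  using nrm_pos[OF \<qq>] nrm_pos[OF \<aa>] by (auto simp: N\<qq>_def N\<aa>_def)

lemma tau_ge_1: "\<tau> \<ge> 1"
proof -
  have "card {\<qq>} \<le> card {g. is_ideal g \<and> \<qq> \<subseteq> g}"
    using finite_ideals_containing(1)[OF \<qq>] \<qq> by (intro card_mono) auto
  then show ?thesis by (simp add: \<tau>_def ideal_count_def)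
qed

text \<open>With \<open>T = t / N \<aa>\<close>, the choice \<open>\<delta> = R (\<surd>(N \<qq>) / T)\<^sup>2\<^sup>/\<^sup>3\<close> balances the two error terms; it needs
  \<open>T \<ge> \<surd>(N \<qq>)\<close>, and below this threshold the trivial count is good enough.\<close>

lemma final_estimate:
  assumes t: "t \<ge> 0" and \<epsilon>: "\<epsilon> > 0" and M: "\<tau>\<^sup>2 \<le> M * N\<qq> powr \<epsilon>"
  shows "\<bar>(\<Sum>\<rho>\<in>S. real (card (solutions \<rho> (sqrt t)))) - main_coeff * t\<bar> \<le>
     (3 * pi / Im \<omega> + 2 * error_const * M + 144 * M + 1) *
       ((t / N\<aa>) powr (1/3) * N\<qq> powr (1/3 + \<epsilon>) + N\<qq> powr (1/2))"
proof -
  define T where "T = t / N\<aa>"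
  have T: "T \<ge> 0" using t N_pos by (simp add: T_def)
  define P where "P = pi / Im \<omega>"
  have P: "P \<ge> 0" using Im_pos by (simp add: P_def)
  define Z where "Z = T powr (1/3) * N\<qq> powr (1/3)"
  define Y where "Y = N\<qq> powr \<epsilon>"
  have Y: "Y \<ge> 1" unfolding Y_def using N_ge_1 \<epsilon> by (intro ge_one_powr_ge_zero) auto
  have XY: "T powr (1/3) * N\<qq> powr (1/3 + \<epsilon>) = Z * Y" by (simp add: Z_def Y_def powr_add)
  have X0: "Z \<ge> 0" by (simp add: Z_def)
  have sq: "N\<qq> powr (1/2) = sqrt N\<qq>" using N_pos by (simp add: powr_half_sqrt)
  have M0: "M \<ge> 0"
  proof -
    have "0 \<le> M * Y" using M unfolding Y_def by (rule order_trans[OF zero_le_power2])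
    then show ?thesis using Y by (simp add: zero_le_mult_iff)
  qed
  have sqrt1: "sqrt N\<qq> \<ge> 1" using N_ge_1 by simp
  have XleXY: "Z \<le> Z * Y" using mult_left_mono[OF Y X0] by simp
  have e0: "error_const \<ge> 0" by (rule error_const_nonneg)
  define W where "W = (\<Sum>\<rho>\<in>S. real (card (solutions \<rho> (sqrt t)))) - main_coeff * t"
  have "\<bar>W\<bar> \<le> (3 * P + 2 * error_const * M + 144 * M) * (Z * Y) + 1 * sqrt N\<qq>"
  proof (cases "T \<ge> sqrt N\<qq>")
    case True
    have T0: "T > 0" using True sqrt1 by linarith
    have tT: "t = T * N\<aa>" using N_pos by (simp add: T_def)
    have t0: "t > 0" using T0 N_pos by (simp add: tT)
    define \<theta> where "\<theta> = (sqrt N\<qq> / T) powr (2/3)"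
    have \<theta>: "\<theta> > 0" "\<theta> \<le> 1"
      using True T0 N_pos powr_mono2[of "2/3" "sqrt N\<qq> / T" 1] by (auto simp: \<theta>_def)
    define R where "R = sqrt t"
    have R: "R > 0" "R\<^sup>2 = t" using t0 by (auto simp: R_def)
    \<comment> \<open>\<theta> stands for \<delta> / R. With this choice both scaled errors, T
      \<theta> and \<open>sqrt N\<qq> * \<theta> powr (-1/2)\<close>, equal \<open>Z\<close>, the
      cube root of T N \<qq>.\<close>
    have Tth: "T * \<theta> = Z"
    proof -
      have "\<theta> = N\<qq> powr (1/3) * T powr (-2/3)"
        unfolding \<theta>_def sq[symmetric] using N_pos T0 by (simp add: powr_divide powr_powr powr_minus_divide)
      then have "T * \<theta> = N\<qq> powr (1/3) * (T powr 1 * T powr (-2/3))" using T0 by simp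
      also have "T powr 1 * T powr (-2/3) = T powr (1/3)" unfolding powr_add[symmetric] by simp
      finally show ?thesis by (simp add: Z_def mult.commute)
    qed
    have th2: "sqrt N\<qq> * \<theta> powr (-1/2) = Z"
    proof -
      have "\<theta> powr (-1/2) = (sqrt N\<qq> / T) powr (-1/3)" unfolding \<theta>_def by (simp add: powr_powr)
      also have "\<dots> = N\<qq> powr (-1/6) * T powr (1/3)"
        unfolding sq[symmetric] using N_pos T0 by (simp add: powr_divide powr_powr powr_minus_divide)
      finally have "sqrt N\<qq> * \<theta> powr (-1/2) = (N\<qq> powr (1/2) * N\<qq> powr (-1/6)) * T powr (1/3)" by (simp add: sq)
      also have "N\<qq> powr (1/2) * N\<qq> powr (-1/6) = N\<qq> powr (1/3)" unfolding powr_add[symmetric] by simp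
      finally show ?thesis by (simp add: Z_def mult.commute)
    qed
    have "\<bar>W\<bar> \<le> 3 * main_coeff * R * (R * \<theta>) + 2 * error_const * \<tau>\<^sup>2 * sqrt N\<qq> * (sqrt R * (R * \<theta>) powr (-1/2))"
      using count_estimate[of "R * \<theta>" R] R \<theta> by (simp add: W_def R_def)
    also have "3 * main_coeff * R * (R * \<theta>) = 3 * (main_coeff * R\<^sup>2) * \<theta>" by (simp add: power2_eq_square)
    also have "\<dots> \<le> 3 * (P * (R\<^sup>2 / N\<aa>)) * \<theta>"
      using main_coeff_le[of R] \<theta> by (intro mult_right_mono mult_left_mono) (auto simp: P_def)
    also have "\<dots> = 3 * P * Z" unfolding Tth[symmetric] R T_def by simp
    also have "sqrt R * (R * \<theta>) powr (-1/2) = \<theta> powr (-1/2)"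
    proof -
      have "sqrt R * (R * \<theta>) powr (-1/2) = (R powr (1/2) * R powr (-1/2)) * \<theta> powr (-1/2)"
        using R \<theta> by (simp add: powr_mult powr_half_sqrt)
      also have "R powr (1/2) * R powr (-1/2) = 1" unfolding powr_add[symmetric] using R by simp
      finally show ?thesis by simp
    qed
    also have "2 * error_const * \<tau>\<^sup>2 * sqrt N\<qq> * \<theta> powr (-1/2) = 2 * error_const * Z * \<tau>\<^sup>2"
      unfolding th2[symmetric] by simp
    also have "2 * error_const * Z * \<tau>\<^sup>2 \<le> 2 * error_const * Z * (M * Y)"
      using M e0 X0 by (intro mult_left_mono) (auto simp: Y_def)
    finally have "\<bar>W\<bar> \<le> 3 * P * Z + 2 * error_const * Z * (M * Y)" by simp
    moreover have "3 * P * Z \<le> 3 * P * (Z * Y)" using XleXY P by (intro mult_left_mono) auto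
    moreover have "0 \<le> 144 * M * (Z * Y)" using M0 X0 Y by simp
    moreover have "(3 * P + 2 * error_const * M + 144 * M) * (Z * Y) + 1 * sqrt N\<qq> =
        3 * P * (Z * Y) + 2 * error_const * Z * (M * Y) + 144 * M * (Z * Y) + sqrt N\<qq>"
      by (simp add: algebra_simps)
    ultimately show ?thesis using sqrt1 by linarith
  next
    case False
    \<comment> \<open>Below the threshold T = T^(1/3) T^(2/3) with T^(2/3) \<le> (N \<qq>)^(1/3), so
      the count and the main term are both absorbed by the error.\<close>
    have TX: "T \<le> Z"
    proof -
      have "T powr (2/3) \<le> (sqrt N\<qq>) powr (2/3)" using False T by (intro powr_mono2) auto
      also have "\<dots> = N\<qq> powr (1/3)" unfolding sq[symmetric] by (simp add: powr_powr)
      finally have "T powr (1/3) * T powr (2/3) \<le> Z" unfolding Z_def by (intro mult_left_mono) auto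
      also have "T powr (1/3) * T powr (2/3) = T" unfolding powr_add[symmetric] using T by simp
      finally show ?thesis .
    qed
    have Rt: "sqrt t \<ge> 0" "(sqrt t)\<^sup>2 = t" using t by auto
    \<comment> \<open>The trivial count is linear in \<tau>; since \<tau> \<ge> 1, the hypothesis on
      its square applies.\<close>
    have "\<tau> * 1 \<le> \<tau> * \<tau>" using tau_ge_1 by (intro mult_left_mono) auto
    then have tM: "\<tau> \<le> M * Y" using M by (simp add: power2_eq_square Y_def)
    have "(\<Sum>\<rho>\<in>S. real (card (solutions \<rho> (sqrt t)))) \<le> 1 + 144 * \<tau> * T"
      using trivial_count[OF Rt(1)] Rt by (simp add: T_def)
    also have "144 * \<tau> * T \<le> 144 * (M * Y) * Z" using tM TX T M0 Y tau_ge_1 by (intro mult_mono) auto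
    finally have 1: "(\<Sum>\<rho>\<in>S. real (card (solutions \<rho> (sqrt t)))) \<le> 1 + 144 * M * (Z * Y)" by (simp add: mult_ac)
    have "main_coeff * t \<le> P * T" using main_coeff_le[of "sqrt t"] Rt by (simp add: P_def T_def)
    also have "\<dots> \<le> P * (Z * Y)" using TX XleXY P by (intro mult_left_mono) auto
    finally have 2: "main_coeff * t \<le> P * (Z * Y)" .
    have 3: "(\<Sum>\<rho>\<in>S. real (card (solutions \<rho> (sqrt t)))) \<ge> 0" by (intro sum_nonneg) auto
    have 4: "main_coeff * t \<ge> 0" using N_pos Im_pos t by (simp add: main_coeff_def)
    have XY0: "Z * Y \<ge> 0" using X0 Y by simp
    have 5: "0 \<le> P * (Z * Y)" "0 \<le> error_const * M * (Z * Y)" "0 \<le> M * (Z * Y)"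
      using P e0 M0 XY0 by (auto intro!: mult_nonneg_nonneg)
    have "\<bar>W\<bar> \<le> 1 + 144 * M * (Z * Y) + P * (Z * Y)" unfolding W_def using 1 2 3 4 5 by linarith
    moreover have "(3 * P + 2 * error_const * M + 144 * M) * (Z * Y) + 1 * sqrt N\<qq> =
        3 * (P * (Z * Y)) + 2 * (error_const * M * (Z * Y)) + 144 * (M * (Z * Y)) + sqrt N\<qq>"
      by (simp add: algebra_simps)
    ultimately show ?thesis using 5 sqrt1 by linarith
  qed
  also have "\<dots> \<le> (3 * P + 2 * error_const * M + 144 * M + 1) * (Z * Y) + (3 * P + 2 * error_const * M + 144 * M + 1) * sqrt N\<qq>"
  proof -
    define k where "k = 3 * P + 2 * error_const * M + 144 * M"
    have "k \<ge> 0" using P e0 M0 by (simp add: k_def)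
    then have "0 \<le> k * sqrt N\<qq>" "0 \<le> Z * Y" using X0 Y N_pos by auto
    then have "k * (Z * Y) + 1 * sqrt N\<qq> \<le> (k + 1) * (Z * Y) + (k + 1) * sqrt N\<qq>"
      by (simp add: distrib_right)
    then show ?thesis unfolding k_def .
  qed
  also have "\<dots> = (3 * P + 2 * error_const * M + 144 * M + 1) * (Z * Y + sqrt N\<qq>)" by (simp add: algebra_simps)
  finally show ?thesis unfolding W_def P_def XY[symmetric] sq T_def by simp
qed

end

section \<open>Constants that depend only on the order and \<epsilon>\<close>

context imaginary_quadratic_order
begin

text \<open>\<open>ideal_count\<close> is bounded by the cube of the divisor function and is then
  squared, so the divisor bound is taken with exponent \<epsilon> / 6.\<close>

lemma ideal_count_bound:
  assumes \<epsilon>: "(\<epsilon>::real) > 0"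
  obtains M where "M \<ge> 0" "\<And>q. is_ideal q \<Longrightarrow> q \<noteq> {0} \<Longrightarrow> (real (ideal_count q))\<^sup>2 \<le> M * real (nrm q) powr \<epsilon>"
proof -
  obtain C where C: "C \<ge> 1" "\<And>n. n > 0 \<Longrightarrow> real (divisor_count n) \<le> C * real n powr (\<epsilon> / 6)"
    using divisor_count_le_powr[of "\<epsilon> / 6"] \<epsilon> by auto
  define D where "D = real (nat \<bar>s\<^sup>2 - 4 * n\<bar>)"
  show ?thesis
  proof (rule that[of "(D * C ^ 3)\<^sup>2"])
    fix q assume q: "is_ideal q" "q \<noteq> {0}"
    define N where "N = real (nrm q)"
    have N: "nrm q > 0" "N > 0" using nrm_pos[OF q] by (auto simp: N_def)
    have "real (ideal_count q) \<le> real (nat \<bar>s\<^sup>2 - 4 * n\<bar> * divisor_count (nrm q) ^ 3)"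
      unfolding ideal_count_def of_nat_le_iff by (rule finite_ideals_containing(2)[OF q])
    also have "\<dots> = D * real (divisor_count (nrm q)) ^ 3" by (simp add: D_def)
    also have "\<dots> \<le> D * (C * N powr (\<epsilon> / 6)) ^ 3"
      using C(2)[OF N(1)] by (intro mult_left_mono power_mono) (auto simp: D_def N_def)
    also have "\<dots> = D * C ^ 3 * N powr (\<epsilon> / 2)"
      using N by (simp add: power_mult_distrib powr_power)
    finally have "(real (ideal_count q))\<^sup>2 \<le> (D * C ^ 3 * N powr (\<epsilon> / 2))\<^sup>2" by (intro power_mono) auto
    also have "\<dots> = (D * C ^ 3)\<^sup>2 * N powr \<epsilon>"
      using N by (simp add: power_mult_distrib powr_power)
    finally show "(real (ideal_count q))\<^sup>2 \<le> (D * C ^ 3)\<^sup>2 * real (nrm q) powr \<epsilon>" by (simp add: N_def)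
  qed simp
qed

theorem square_class_count:
  assumes \<epsilon>: "(\<epsilon>::real) > 0"
  obtains C where "C > 0"
    "\<And>\<aa> \<qq> e \<alpha> S t. is_ideal \<aa> \<Longrightarrow> \<aa> \<noteq> {0} \<Longrightarrow> is_ideal \<qq> \<Longrightarrow> \<qq> \<noteq> {0} \<Longrightarrow> e \<in> \<aa> \<Longrightarrow> 1 - e \<in> \<qq> \<Longrightarrow>
      unit_mod \<qq> \<alpha> \<Longrightarrow> reduced_reps \<qq> S \<Longrightarrow> t \<ge> 0 \<Longrightarrow>
      \<bar>(\<Sum>\<rho>\<in>S. real (card {z \<in> \<aa>. z - \<alpha> * \<rho>\<^sup>2 \<in> \<qq> \<and> (cmod z)\<^sup>2 \<le> t}))
         - real (card S) * pi / (real (nrm \<aa>) * real (nrm \<qq>) * Im \<omega>) * t\<bar>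
      \<le> C * ((t / real (nrm \<aa>)) powr (1/3) * real (nrm \<qq>) powr (1/3 + \<epsilon>) + real (nrm \<qq>) powr (1/2))"
proof -
  obtain M where M: "M \<ge> 0" "\<And>q. is_ideal q \<Longrightarrow> q \<noteq> {0} \<Longrightarrow> (real (ideal_count q))\<^sup>2 \<le> M * real (nrm q) powr \<epsilon>"
    by (rule ideal_count_bound[OF \<epsilon>]) blast
  \<comment> \<open>This is \<open>error_const\<close> written out: the constant has to be fixed
    before the ideals, and it involves \<omega> alone.\<close>
  define E where "E = 4 * (1024 * 2304 / dual_const\<^sup>2) / Im \<omega>"
  have E: "E \<ge> 0" using Im_pos by (simp add: E_def)
  define C where "C = 3 * pi / Im \<omega> + 2 * E * M + 144 * M + 1"
  have "C > 0" unfolding C_def using M(1) E Im_pos by (intro add_nonneg_pos add_nonneg_nonneg) auto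
  then show ?thesis
  proof (rule that)
    fix \<aa> \<qq> S :: "complex set" and e \<alpha> :: complex and t :: real
    assume a: "is_ideal \<aa>" "\<aa> \<noteq> {0}" "is_ideal \<qq>" "\<qq> \<noteq> {0}" "e \<in> \<aa>" "1 - e \<in> \<qq>"
      "unit_mod \<qq> \<alpha>" "reduced_reps \<qq> S" "t \<ge> 0"
    have ne: "\<aa> \<inter> \<qq> \<noteq> {0}" by (rule Int_ideal_nonzero[OF a(1-4)])
    obtain c0 a0 b0 where h: "hnf c0 a0 b0 (\<aa> \<inter> \<qq>)" using ideal_hnf[OF is_ideal_Int[OF a(1,3)] ne] .
    interpret residue_count \<omega> s n \<aa> \<qq> S \<alpha> e c0 a0 b0
      by unfold_locales (rule a h)+
    have sol: "solutions \<rho> (sqrt t) = {z \<in> \<aa>. z - \<alpha> * \<rho>\<^sup>2 \<in> \<qq> \<and> (cmod z)\<^sup>2 \<le> t}" for \<rho>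
      unfolding solutions_def using a(9) real_sqrt_le_iff[of "(cmod _)\<^sup>2" t] by auto
    have err: "error_const = E" by (simp add: error_const_def decay_const_def E_def)
    have "\<tau>\<^sup>2 \<le> M * N\<qq> powr \<epsilon>" unfolding \<tau>_def N\<qq>_def by (rule M(2)[OF a(3,4)])
    from final_estimate[OF a(9) \<epsilon> this]
    show "\<bar>(\<Sum>\<rho>\<in>S. real (card {z \<in> \<aa>. z - \<alpha> * \<rho>\<^sup>2 \<in> \<qq> \<and> (cmod z)\<^sup>2 \<le> t}))
         - real (card S) * pi / (real (nrm \<aa>) * real (nrm \<qq>) * Im \<omega>) * t\<bar>
      \<le> C * ((t / real (nrm \<aa>)) powr (1/3) * real (nrm \<qq>) powr (1/3 + \<epsilon>) + real (nrm \<qq>) powr (1/2))"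
      unfolding sol main_coeff_def N\<aa>_def N\<qq>_def err C_def .
  qed
qed

end

section \<open>The ring of integers\<close>

lemma complex_ring_simps [simp]:
  "carrier complex_ring = UNIV" "x \<otimes>\<^bsub>complex_ring\<^esub> y = x * y" "x \<oplus>\<^bsub>complex_ring\<^esub> y = x + y"
  "\<one>\<^bsub>complex_ring\<^esub> = 1" "\<zero>\<^bsub>complex_ring\<^esub> = 0"
  by (simp_all add: ring_of_type_algebra_def)

lemma ring_of_integers_simps [simp]:
  "carrier (ring_of_integers K) = {x \<in> K. algebraic_int x}"
  "x \<otimes>\<^bsub>ring_of_integers K\<^esub> y = x * y" "x \<oplus>\<^bsub>ring_of_integers K\<^esub> y = x + y"
  "\<one>\<^bsub>ring_of_integers K\<^esub> = 1" "\<zero>\<^bsub>ring_of_integers K\<^esub> = 0"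
  by (simp_all add: ring_of_integers_def ring_of_type_algebra_def)

text \<open>Extracts only that two vectors span; independence is recovered in
  \<open>rat_span\<close> from the irrationality of z.\<close>

lemma dimension_2_rat:
  assumes "ring.dimension complex_ring 2 \<rat> K"
  obtains v1 v2 where "K = {k1 * v1 + k2 * v2 | k1 k2. k1 \<in> \<rat> \<and> k2 \<in> \<rat>}"
proof -
  interpret R: ring "complex_ring" by (rule ring_from_type_algebra)
  have line: "R.line_extension \<rat> v E = {k * v + x | k x. k \<in> \<rat> \<and> x \<in> E}" for v E
    unfolding R.line_extension_def set_add_def' r_coset_def by auto
  have "R.dimension (Suc (Suc 0)) \<rat> K" using assms by (simp add: numeral_2_eq_2)
  then obtain v1 E1 where 1: "K = R.line_extension \<rat> v1 E1" "R.dimension (Suc 0) \<rat> E1"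
    by (auto elim: R.dimension.cases)
  from 1(2) obtain v2 E2 where 2: "E1 = R.line_extension \<rat> v2 E2" "R.dimension 0 \<rat> E2"
    by (auto elim: R.dimension.cases)
  have E2: "E2 = {0}" using 2(2) by (auto elim: R.dimension.cases)
  have "E1 = {k * v2 | k. k \<in> \<rat>}" unfolding 2(1) line E2 by auto
  then have "K = {k1 * v1 + k2 * v2 | k1 k2. k1 \<in> \<rat> \<and> k2 \<in> \<rat>}" unfolding 1(1) line by blast
  then show ?thesis by (rule that)
qed

text \<open>That sums and products of algebraic integers are algebraic integers is not proved here: it is part
  of every hypothesis \<open>ideal I (ring_of_integers K)\<close>.\<close>

locale imaginary_quadratic =
  fixes K :: "complex set"
  assumes K: "imaginary_quadratic_field K" and ring_int: "ring (ring_of_integers K)"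
begin

lemma K_1: "1 \<in> K" and K_mult: "x \<in> K \<Longrightarrow> y \<in> K \<Longrightarrow> x * y \<in> K"
  and K_add: "x \<in> K \<Longrightarrow> y \<in> K \<Longrightarrow> x + y \<in> K" and K_minus: "x \<in> K \<Longrightarrow> - x \<in> K"
proof -
  have sf: "subfield K complex_ring" using K by (simp add: imaginary_quadratic_field_def)
  interpret R: ring "complex_ring" by (rule ring_from_type_algebra)
  note sr = subfieldE(1)[OF sf]
  show "1 \<in> K" using subringE(3)[OF sr] by simp
  show "x \<in> K \<Longrightarrow> y \<in> K \<Longrightarrow> x * y \<in> K" using subringE(6)[OF sr] by simp
  show "x \<in> K \<Longrightarrow> y \<in> K \<Longrightarrow> x + y \<in> K" using subringE(7)[OF sr] by simp
  assume x: "x \<in> K"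
  have "\<ominus>\<^bsub>complex_ring\<^esub> x = - x"
    using R.minus_equality[of "- x" x] by simp
  then show "- x \<in> K" using subringE(5)[OF sr x] by simp
qed

lemma K_dimension: "ring.dimension complex_ring 2 \<rat> K"
  using K by (simp add: imaginary_quadratic_field_def)

lemma rat_subset: "\<rat> \<subseteq> K" and rat_mult: "k \<in> \<rat> \<Longrightarrow> x \<in> K \<Longrightarrow> k * x \<in> K"
proof -
  obtain v1 v2 where v: "K = {k1 * v1 + k2 * v2 | k1 k2. k1 \<in> \<rat> \<and> k2 \<in> \<rat>}"
    by (rule dimension_2_rat[OF K_dimension])
  show sm: "k * x \<in> K" if kx: "k \<in> \<rat>" "x \<in> K" for k x
  proof -
    obtain k1 k2 where x: "x = k1 * v1 + k2 * v2" "k1 \<in> \<rat>" "k2 \<in> \<rat>" using kx v by blast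
    have "k * x = (k * k1) * v1 + (k * k2) * v2" by (simp add: x algebra_simps)
    moreover have "k * k1 \<in> \<rat>" "k * k2 \<in> \<rat>" using kx x by auto
    ultimately show ?thesis unfolding v by blast
  qed
  show "\<rat> \<subseteq> K" using sm[OF _ K_1] by auto
qed

text \<open>Cramer's rule for the coordinates of 1, z and y. If the determinant vanished, z would be
  a quotient of rational coordinates.\<close>

lemma rat_span:
  assumes z: "z \<in> K" "z \<notin> \<rat>" and y: "y \<in> K"
  obtains u v where "u \<in> \<rat>" "v \<in> \<rat>" "y = u + v * z"
proof -
  obtain v1 v2 where v: "K = {k1 * v1 + k2 * v2 | k1 k2. k1 \<in> \<rat> \<and> k2 \<in> \<rat>}"
    by (rule dimension_2_rat[OF K_dimension])
  obtain p0 q0 where 0: "1 = p0 * v1 + q0 * v2" "p0 \<in> \<rat>" "q0 \<in> \<rat>" using K_1 v by blast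
  obtain p1 q1 where 1: "z = p1 * v1 + q1 * v2" "p1 \<in> \<rat>" "q1 \<in> \<rat>" using z v by blast
  obtain p2 q2 where 2: "y = p2 * v1 + q2 * v2" "p2 \<in> \<rat>" "q2 \<in> \<rat>" using y v by blast
  define d where "d = p0 * q1 - p1 * q0"
  have "d \<noteq> 0"
  proof
    assume d: "d = 0"
    have a: "p1 - p0 * z = 0"
    proof -
      have "p1 - p0 * z = p1 * (p0 * v1 + q0 * v2) - p0 * (p1 * v1 + q1 * v2)" unfolding 0(1)[symmetric] 1(1)[symmetric] by simp
      also have "\<dots> = - d * v2" by (simp add: d_def algebra_simps)
      finally show ?thesis using d by simp
    qed
    have b: "q1 - q0 * z = 0"
    proof -
      have "q1 - q0 * z = q1 * (p0 * v1 + q0 * v2) - q0 * (p1 * v1 + q1 * v2)" unfolding 0(1)[symmetric] 1(1)[symmetric] by simp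
      also have "\<dots> = d * v1" by (simp add: d_def algebra_simps)
      finally show ?thesis using d by simp
    qed
    have "p0 \<noteq> 0 \<or> q0 \<noteq> 0" using 0(1) by auto
    then have "z = p1 / p0 \<or> z = q1 / q0" using a b by (auto simp: field_simps)
    then show False using z 0 1 by auto
  qed
  have "d * y = (p2 * q1 - p1 * q2) * 1 + (p0 * q2 - p2 * q0) * z"
    unfolding 0(1) 1(1) 2(1) d_def by (simp add: algebra_simps)
  then have "y = (p2 * q1 - p1 * q2) / d + (p0 * q2 - p2 * q0) / d * z"
    using \<open>d \<noteq> 0\<close> by (simp add: field_simps)
  moreover have "d \<in> \<rat>" "p2 * q1 - p1 * q2 \<in> \<rat>" "p0 * q2 - p2 * q0 \<in> \<rat>"
    using 0 1 2 by (auto simp: d_def)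
  ultimately show ?thesis using that[of "(p2 * q1 - p1 * q2) / d" "(p0 * q2 - p2 * q0) / d"] by auto
qed

lemma rat_real: "x \<in> \<rat> \<Longrightarrow> x \<in> (\<real> :: complex set)"
proof -
  assume "x \<in> \<rat>"
  then show ?thesis by (auto elim!: Rats_cases')
qed

text \<open>An irrational real x in \<open>K\<close> would span \<open>K\<close> together with 1,
  making all of \<open>K\<close> real.\<close>

lemma real_in_K: assumes "x \<in> K" "x \<in> \<real>" shows "x \<in> \<rat>"
proof (rule ccontr)
  assume n: "x \<notin> \<rat>"
  obtain \<theta> where \<theta>: "\<theta> \<in> K" "\<theta> \<notin> \<real>" using K by (auto simp: imaginary_quadratic_field_def)
  obtain u v where "u \<in> \<rat>" "v \<in> \<rat>" "\<theta> = u + v * x" using rat_span[OF assms(1) n \<theta>(1)] .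
  then have "\<theta> \<in> \<real>" using assms(2) rat_real by auto
  then show False using \<theta> by simp
qed

text \<open>A nonrational z satisfies z^2 = u + v z with rational u and v. Its conjugate is the
  other root, so the trace is v and the norm - u.\<close>

lemma trace_norm_rat:
  assumes z: "z \<in> K" shows "z + cnj z \<in> \<rat>" "z * cnj z \<in> \<rat>" "cnj z \<in> K"
proof -
  have "z + cnj z \<in> \<rat> \<and> z * cnj z \<in> \<rat>"
  proof (cases "z \<in> \<rat>")
    case True
    then have "cnj z = z" using rat_real[of z] by (simp add: Reals_cnj_iff)
    then show ?thesis using True by auto
  next
    case False
    then have nr: "z \<notin> \<real>" using real_in_K z by blast
    obtain u v where uv: "u \<in> \<rat>" "v \<in> \<rat>" "z * z = u + v * z" using rat_span[OF z False K_mult[OF z z]] .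
    have r: "cnj u = u" "cnj v = v" using uv rat_real by (auto simp: Reals_cnj_iff)
    have "cnj z * cnj z = u + v * cnj z" using arg_cong[OF uv(3), of cnj] r by simp
    then have "(z - cnj z) * (z + cnj z - v) = 0" using uv(3) by (simp add: algebra_simps)
    moreover have "z - cnj z \<noteq> 0" using nr by (auto simp: Reals_cnj_iff)
    ultimately have t: "z + cnj z = v" by simp
    have "z * cnj z = z * (v - z)" using t by (simp add: algebra_simps flip: t)
    also have "\<dots> = - u" using uv(3) by (simp add: algebra_simps)
    finally show ?thesis using t uv by simp
  qed
  then show 1: "z + cnj z \<in> \<rat>" "z * cnj z \<in> \<rat>" by auto
  have "z + cnj z \<in> K" using 1 rat_subset by blast
  from K_add[OF this K_minus[OF z]] show "cnj z \<in> K" by simp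
qed

definition OK :: "complex set" where "OK = {x \<in> K. algebraic_int x}"

lemma OK_add: "x \<in> OK \<Longrightarrow> y \<in> OK \<Longrightarrow> x + y \<in> OK" and OK_mult: "x \<in> OK \<Longrightarrow> y \<in> OK \<Longrightarrow> x * y \<in> OK"
  and OK_minus: "x \<in> OK \<Longrightarrow> - x \<in> OK"
proof -
  interpret R: ring "ring_of_integers K" by (rule ring_int)
  show "x \<in> OK \<Longrightarrow> y \<in> OK \<Longrightarrow> x + y \<in> OK" using R.add.m_closed[of x y] by (simp add: OK_def)
  show "x \<in> OK \<Longrightarrow> y \<in> OK \<Longrightarrow> x * y \<in> OK" using R.m_closed[of x y] by (simp add: OK_def)
  show "x \<in> OK \<Longrightarrow> - x \<in> OK" using K_minus by (auto simp: OK_def)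
qed

lemma OK_of_int: "of_int k \<in> OK"
proof -
  have "of_int k \<in> K" using rat_subset by auto
  then show ?thesis by (simp add: OK_def int_imp_algebraic_int)
qed

lemma OK_cnj: "x \<in> OK \<Longrightarrow> cnj x \<in> OK"
  using trace_norm_rat(3) by (simp add: OK_def)

lemma OK_rat: "x \<in> OK \<Longrightarrow> x \<in> \<rat> \<Longrightarrow> x \<in> \<int>"
  by (simp add: OK_def rational_algebraic_int_is_int)

lemma OK_trace: "z \<in> OK \<Longrightarrow> z + cnj z \<in> \<int>" and OK_norm: "z \<in> OK \<Longrightarrow> z * cnj z \<in> \<int>"
  using OK_cnj OK_add OK_mult OK_rat trace_norm_rat by (auto simp: OK_def)

text \<open>Multiplying a nonreal \<theta> by the product of the denominators of its trace and norm
  gives a root of a monic integer quadratic; a sign change makes the imaginary part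
  positive.\<close>

lemma ex_nonreal_OK: "\<exists>z\<in>OK. Im z > 0"
proof -
  obtain \<theta> where \<theta>: "\<theta> \<in> K" "\<theta> \<notin> \<real>" using K by (auto simp: imaginary_quadratic_field_def)
  define u v where "u = \<theta> * cnj \<theta>" and "v = \<theta> + cnj \<theta>"
  have "u \<in> \<rat>" "v \<in> \<rat>" using trace_norm_rat[OF \<theta>(1)] by (auto simp: u_def v_def)
  then obtain a b :: int and c d :: int where uv: "u = of_int a / of_int b" "b \<noteq> 0" "v = of_int c / of_int d" "d \<noteq> 0"
    by (metis Rats_cases' less_irrefl)
  define m where "m = b * d"
  have m: "m \<noteq> 0" using uv by (simp add: m_def)
  define z where "z = of_int m * \<theta>"
  have zK: "z \<in> K" unfolding z_def by (intro rat_mult \<theta>) auto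
  have vm: "of_int m * v = of_int (b * c)" and um: "of_int m * of_int m * u = of_int (b * d * d * a)"
    using uv by (auto simp: m_def)
  have root: "z\<^sup>2 - of_int (b * c) * z + of_int (b * d * d * a) = 0"
    unfolding vm[symmetric] um[symmetric] u_def v_def z_def by (simp add: algebra_simps power2_eq_square)
  have "algebraic_int z"
  proof -
    define p where "p = [: of_int (b * d * d * a), - of_int (b * c), 1 :: complex:]"
    have "Polynomial.coeff p (Polynomial.degree p) = 1" by (simp add: p_def)
    moreover have "\<forall>i. Polynomial.coeff p i \<in> \<int>" by (auto simp: p_def coeff_pCons split: nat.splits)
    moreover have "Polynomial.poly p z = 0" using root by (simp add: p_def algebra_simps power2_eq_square)
    ultimately show ?thesis by (intro algebraic_int.intros[of p]) auto
  qed
  then have zO: "z \<in> OK" using zK by (simp add: OK_def)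
  have "Im \<theta> \<noteq> 0" using \<theta> by (simp add: complex_is_Real_iff)
  then have "Im z \<noteq> 0" using m by (simp add: z_def)
  then have "Im z > 0 \<or> Im (- z) > 0" by auto
  then show ?thesis using zO OK_minus by blast
qed

text \<open>The value is four times the norm minus the squared trace, an integer. This discreteness
  allows a least positive imaginary part to be chosen.\<close>

lemma four_Im_sq: assumes "z \<in> OK" obtains k :: nat where "4 * (Im z)\<^sup>2 = real k"
proof -
  obtain a where a: "z + cnj z = of_int a" using OK_trace[OF assms] by (auto elim: Ints_cases)
  obtain b where b: "z * cnj z = of_int b" using OK_norm[OF assms] by (auto elim: Ints_cases)
  have "2 * Re z = of_int a" using arg_cong[OF a, of Re] by simp
  moreover have "(Re z)\<^sup>2 + (Im z)\<^sup>2 = of_int b" using arg_cong[OF b, of Re] by (simp add: power2_eq_square)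
  ultimately have eq: "4 * (Im z)\<^sup>2 = of_int (4 * b - a * a)" by (simp add: power2_eq_square algebra_simps flip: \<open>2 * Re z = of_int a\<close>)
  have "0 \<le> 4 * (Im z)\<^sup>2" by simp
  then have "4 * b - a * a \<ge> 0" unfolding eq by (simp only: of_int_0_le_iff)
  then have "4 * (Im z)\<^sup>2 = real (nat (4 * b - a * a))" unfolding eq by simp
  then show ?thesis by (rule that)
qed

text \<open>Take \<omega> with least positive imaginary part. Subtracting a floor multiple of
  \<omega> leaves an algebraic integer of smaller imaginary part, hence a real one, which is
  rational and so an integer.\<close>

lemma OK_basis:
  obtains \<omega> s n where "imaginary_quadratic_order \<omega> s n" "OK = {of_int x + of_int y * \<omega> | x y. True}"
proof -
  define P where "P = (\<lambda>k::nat. \<exists>z\<in>OK. Im z > 0 \<and> 4 * (Im z)\<^sup>2 = real k)"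
  have "\<exists>k. P k" unfolding P_def using ex_nonreal_OK four_Im_sq by metis
  then have L: "P (Least P)" by (rule LeastI_ex)
  then obtain \<omega> where \<omega>: "\<omega> \<in> OK" "Im \<omega> > 0" "4 * (Im \<omega>)\<^sup>2 = real (Least P)" by (auto simp: P_def)
  have min: "Im \<omega> \<le> Im z" if z: "z \<in> OK" "Im z > 0" for z
  proof -
    obtain k where k: "4 * (Im z)\<^sup>2 = real k" using four_Im_sq[OF z(1)] .
    then have "P k" using z by (auto simp: P_def)
    then have "Least P \<le> k" by (rule Least_le)
    then have "(Im \<omega>)\<^sup>2 \<le> (Im z)\<^sup>2" using \<omega>(3) k by linarith
    then show ?thesis using z by (intro power2_le_imp_le[of "Im \<omega>" "Im z"]) auto
  qed
  obtain s where s: "\<omega> + cnj \<omega> = of_int s" using OK_trace[OF \<omega>(1)] by (auto elim: Ints_cases)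
  obtain n where n: "\<omega> * cnj \<omega> = of_int n" using OK_norm[OF \<omega>(1)] by (auto elim: Ints_cases)
  have "\<omega>\<^sup>2 = (\<omega> + cnj \<omega>) * \<omega> - \<omega> * cnj \<omega>" by (simp add: algebra_simps power2_eq_square)
  then have sq: "\<omega>\<^sup>2 = of_int s * \<omega> - of_int n" unfolding s n .
  have "OK \<subseteq> {of_int x + of_int y * \<omega> | x y. True}"
  proof
    fix z assume z: "z \<in> OK"
    define y where "y = \<lfloor>Im z / Im \<omega>\<rfloor>"
    define r where "r = z + - (of_int y * \<omega>)"
    have rO: "r \<in> OK" unfolding r_def by (intro OK_add OK_minus OK_mult OK_of_int z \<omega>)
    have "of_int y \<le> Im z / Im \<omega>" "Im z / Im \<omega> < of_int y + 1" unfolding y_def by linarith+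
    then have "of_int y * Im \<omega> \<le> Im z" "Im z < (of_int y + 1) * Im \<omega>" using \<omega>(2) by (simp_all add: field_simps)
    then have "Im r \<ge> 0" "Im r < Im \<omega>" by (auto simp: r_def algebra_simps)
    then have "Im r = 0" using min[OF rO] by force
    then have "r \<in> \<real>" by (simp add: complex_is_Real_iff)
    then have "r \<in> \<int>" using rO real_in_K by (intro OK_rat) (auto simp: OK_def)
    then obtain x where "r = of_int x" by (auto elim: Ints_cases)
    then have "z = of_int x + of_int y * \<omega>" by (simp add: r_def algebra_simps)
    then show "z \<in> {of_int x + of_int y * \<omega> | x y. True}" by blast
  qed
  moreover have "{of_int x + of_int y * \<omega> | x y. True} \<subseteq> OK"
    using OK_add OK_mult OK_of_int \<omega>(1) by blast
  ultimately have "OK = {of_int x + of_int y * \<omega> | x y. True}" by blast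
  moreover have "imaginary_quadratic_order \<omega> s n" by unfold_locales (use \<omega> sq in auto)
  ultimately show ?thesis using that by blast
qed

end

section \<open>Translation between the algebraic notions and the lattice\<close>

lemma rcoset_ring_of_integers: "I +>\<^bsub>ring_of_integers K\<^esub> x = {h + x | h. h \<in> I}"
  unfolding a_r_coset_def' by auto

locale ring_of_integers_basis = imaginary_quadratic_order +
  fixes K :: "complex set"
  assumes ring_int': "ring (ring_of_integers K)" and carrier_eq: "{x \<in> K. algebraic_int x} = ints"
begin

lemma carrier_ints: "carrier (ring_of_integers K) = ints"
  using carrier_eq by simp

lemma integral_basis_omega: "integral_basis K 1 \<omega>"
  unfolding integral_basis_def carrier_ints
proof (intro conjI ballI)
  fix z assume "z \<in> ints"
  then obtain x y where z: "z = pt x y" by (rule intsE)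
  show "\<exists>!(m, n). z = of_int m * 1 + of_int n * \<omega>"
  proof (rule ex1I[of _ "(x, y)"])
    show "case (x, y) of (m, n) \<Rightarrow> z = of_int m * 1 + of_int n * \<omega>" by (simp add: z pt_def)
    fix p assume "case p of (m, n) \<Rightarrow> z = of_int m * 1 + of_int n * \<omega>"
    then have "pt (fst p) (snd p) = pt x y" unfolding z by (simp add: pt_def split: prod.splits)
    then show "p = (x, y)" by (simp add: prod_eq_iff)
  qed
qed auto

text \<open>In the basis 1, \<omega> the discriminant is s^2 - 4 n = - (2 Im \<omega>)^2; this
  converts the covolume factor Im \<omega> into the form used for the main term.\<close>

lemma sqrt_discriminant: "sqrt \<bar>real_of_int (discriminant K)\<bar> = 2 * Im \<omega>"
proof -
  have val: "(1 * cnj \<omega> - \<omega> * cnj 1)\<^sup>2 = of_int (s\<^sup>2 - 4 * n)"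
  proof -
    have "(1 * cnj \<omega> - \<omega> * cnj 1)\<^sup>2 = of_real (- 4 * (Im \<omega>)\<^sup>2)"
      by (simp add: complex_eq_iff power2_eq_square)
    also have "- 4 * (Im \<omega>)\<^sup>2 = of_int (s\<^sup>2 - 4 * n)" using n_eq by (simp add: Re_omega power2_eq_square)
    finally show ?thesis by simp
  qed
  have "discriminant K = s\<^sup>2 - 4 * n"
    unfolding discriminant_def
  proof (rule the_equality)
    show "\<exists>w1 w2. integral_basis K w1 w2 \<and> complex_of_int (s\<^sup>2 - 4 * n) = (w1 * cnj w2 - w2 * cnj w1)\<^sup>2"
      using integral_basis_omega val by metis
    fix d assume "\<exists>w1 w2. integral_basis K w1 w2 \<and> complex_of_int d = (w1 * cnj w2 - w2 * cnj w1)\<^sup>2"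
    then obtain w1 w2 where w: "integral_basis K w1 w2" "complex_of_int d = (w1 * cnj w2 - w2 * cnj w1)\<^sup>2" by blast
    have "complex_of_int d = of_int (s\<^sup>2 - 4 * n)"
      using integral_basis_discriminant_unique[OF w(1) integral_basis_omega] w(2) val by simp
    then show "d = s\<^sup>2 - 4 * n" by (simp only: of_int_eq_iff)
  qed
  moreover have "real_of_int (s\<^sup>2 - 4 * n) = - ((2 * Im \<omega>)\<^sup>2)"
    using n_eq by (simp add: Re_omega power2_eq_square)
  ultimately have "\<bar>real_of_int (discriminant K)\<bar> = (2 * Im \<omega>)\<^sup>2" by simp
  then show ?thesis using Im_pos by (simp only: real_sqrt_abs abs_of_pos mult_pos_pos zero_less_numeral)
qed

lemma ideal_is_ideal:
  assumes "ideal I (ring_of_integers K)" shows "is_ideal I"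
proof -
  interpret I: ideal I "ring_of_integers K" by fact
  have sub: "I \<subseteq> ints" using I.a_subset carrier_ints by simp
  show ?thesis
    unfolding is_ideal_def
  proof (intro conjI ballI)
    show "I \<subseteq> ints" by (rule sub)
    show "0 \<in> I" using additive_subgroup.zero_closed[OF I.is_additive_subgroup] by simp
    show "x + y \<in> I" if "x \<in> I" "y \<in> I" for x y using additive_subgroup.a_closed[OF I.is_additive_subgroup that] by simp
    show "r * x \<in> I" if "r \<in> ints" "x \<in> I" for r x
      using I.I_l_closed[of x r] that unfolding carrier_ints by simp
  qed
qed

text \<open>Supplies the element \<open>e\<close> that lifts residues modulo \<qq> into
  \<aa>.\<close>

lemma coprime_idempotent_exists:
  assumes "ideals_coprime K I J" obtains e where "e \<in> I" "1 - e \<in> J"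
proof -
  have "1 \<in> I <+>\<^bsub>ring_of_integers K\<^esub> J"
    using assms ints_1 unfolding ideals_coprime_def carrier_ints by blast
  then obtain i j where ij: "i \<in> I" "j \<in> J" "1 = i + j" unfolding set_add_def' by auto
  then have "1 - i = j" by (metis add_diff_cancel_left')
  then show ?thesis using that[of i] ij by simp
qed

text \<open>Given an inverse y of x modulo \<open>I\<close>, any z splits as (z y) x - z (x y - 1),
  a multiple of x plus an element of \<open>I\<close>.\<close>

lemma coprime_iff_unit_mod:
  assumes I: "is_ideal I" and x: "x \<in> ints" shows "coprime_to_ideal K x I \<longleftrightarrow> unit_mod I x"
proof
  assume "coprime_to_ideal K x I"
  then obtain e where e: "e \<in> PIdl\<^bsub>ring_of_integers K\<^esub> x" "1 - e \<in> I"
    unfolding coprime_to_ideal_def by (rule coprime_idempotent_exists)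
  obtain r where r: "e = r * x" "r \<in> ints" using e(1) unfolding cgenideal_def carrier_ints by auto
  have "x * r - 1 \<in> I" using e(2) ideal_diff_commute[OF I, of 1 e] by (simp add: r mult.commute)
  then show "unit_mod I x" using x r by (auto simp: unit_mod_def)
next
  assume "unit_mod I x"
  then obtain y where y: "y \<in> ints" "x * y - 1 \<in> I" by (auto simp: unit_mod_def)
  have "ints \<subseteq> PIdl\<^bsub>ring_of_integers K\<^esub> x <+>\<^bsub>ring_of_integers K\<^esub> I"
  proof
    fix z assume z: "z \<in> ints"
    have p: "(z * y) * x \<in> PIdl\<^bsub>ring_of_integers K\<^esub> x"
      unfolding cgenideal_def carrier_ints using z y by auto
    have i: "- (z * (x * y - 1)) \<in> I" using ideal_minus[OF I ideal_mult[OF I z y(2)]] .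
    have eq: "(z * y) * x + - (z * (x * y - 1)) = z" by (simp add: algebra_simps)
    have "(z * y) * x + - (z * (x * y - 1)) \<in> PIdl\<^bsub>ring_of_integers K\<^esub> x <+>\<^bsub>ring_of_integers K\<^esub> I"
      using p i unfolding set_add_def' ring_of_integers_simps by blast
    then show "z \<in> PIdl\<^bsub>ring_of_integers K\<^esub> x <+>\<^bsub>ring_of_integers K\<^esub> I" unfolding eq .
  qed
  moreover have "PIdl\<^bsub>ring_of_integers K\<^esub> x <+>\<^bsub>ring_of_integers K\<^esub> I \<subseteq> ints"
    unfolding set_add_def' cgenideal_def carrier_ints using x ideal_ints[OF I] by auto
  ultimately show "coprime_to_ideal K x I"
    unfolding coprime_to_ideal_def ideals_coprime_def carrier_ints by blast
qed

lemma reduced_residue_system_iff: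
  assumes I: "is_ideal I" and S: "reduced_residue_system K I S" shows "reduced_reps I S"
  unfolding reduced_reps_def
proof (intro conjI ballI allI impI)
  show "unit_mod I x" if "x \<in> S" for x
    using S that coprime_iff_unit_mod[OF I, of x] unfolding reduced_residue_system_def carrier_ints by blast
  fix x assume u: "unit_mod I x"
  then have x: "x \<in> ints" by (simp add: unit_mod_def)
  then show "\<exists>!s. s \<in> S \<and> x - s \<in> I"
    using S u coprime_iff_unit_mod[OF I x] unfolding reduced_residue_system_def carrier_ints by blast
qed

definition cls :: "complex set \<Rightarrow> complex \<Rightarrow> complex set" where
  "cls I x = I +>\<^bsub>ring_of_integers K\<^esub> x"

lemma cls_eq_iff: "is_ideal I \<Longrightarrow> cls I x = cls I y \<longleftrightarrow> x - y \<in> I"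
proof
  assume I: "is_ideal I" and eq: "cls I x = cls I y"
  have "x \<in> cls I x" using ideal_0[OF I] unfolding cls_def rcoset_ring_of_integers by force
  then have "x \<in> cls I y" by (simp add: eq)
  then show "x - y \<in> I" unfolding cls_def rcoset_ring_of_integers by auto
next
  assume I: "is_ideal I" and xy: "x - y \<in> I"
  have sub: "cls I u \<subseteq> cls I v" if "u - v \<in> I" for u v
  proof
    fix z assume "z \<in> cls I u"
    then obtain h where h: "z = h + u" "h \<in> I" unfolding cls_def rcoset_ring_of_integers by blast
    have "z = (h + (u - v)) + v" by (simp add: h)
    then show "z \<in> cls I v" using ideal_add[OF I h(2) that] unfolding cls_def rcoset_ring_of_integers by blast
  qed
  show "cls I x = cls I y" using sub[OF xy] sub[of y x] xy ideal_diff_commute[OF I] by blast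
qed

lemma carrier_Quot: "carrier (ring_of_integers K Quot I) = cls I ` ints"
  unfolding FactRing_def A_RCOSETS_def' carrier_ints[symmetric] cls_def by auto

lemma ideal_norm_eq:
  assumes "ideal I (ring_of_integers K)" "I \<noteq> {0}" shows "ideal_norm K I = nrm I"
proof -
  have I: "is_ideal I" using assms(1) by (rule ideal_is_ideal)
  obtain R where R: "reps I R" "card R = nrm I" using ex_reps[OF I assms(2)] by metis
  have "cls I ` ints = cls I ` R"
  proof
    show "cls I ` R \<subseteq> cls I ` ints" using R by (auto simp: reps_def)
    show "cls I ` ints \<subseteq> cls I ` R"
    proof
      fix Z assume "Z \<in> cls I ` ints"
      then obtain x where x: "Z = cls I x" "x \<in> ints" by blast
      obtain r where "r \<in> R" "x - r \<in> I" using reps_ex[OF R(1) x(2)] by blast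
      then show "Z \<in> cls I ` R" using cls_eq_iff[OF I] x by blast
    qed
  qed
  moreover have "inj_on (cls I) R"
    using reps_incongruent[OF I R(1)] by (auto simp: inj_on_def cls_eq_iff[OF I] incongruent_def)
  ultimately show ?thesis unfolding ideal_norm_def carrier_Quot by (simp add: card_image R)
qed

lemma ideal_phi_eq:
  assumes "ideal I (ring_of_integers K)" and S: "reduced_reps I S" shows "ideal_phi K I = card S"
proof -
  interpret I: ideal I "ring_of_integers K" by fact
  have I: "is_ideal I" using assms(1) by (rule ideal_is_ideal)
  have mult: "cls I x \<otimes>\<^bsub>ring_of_integers K Quot I\<^esub> cls I y = cls I (x * y)" if "x \<in> ints" "y \<in> ints" for x y
    using I.rcoset_mult_add[of x y] that unfolding carrier_ints by (simp add: FactRing_def cls_def)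
  have one: "\<one>\<^bsub>ring_of_integers K Quot I\<^esub> = cls I 1" by (simp add: FactRing_def cls_def)
  have "Units (ring_of_integers K Quot I) = cls I ` {x. unit_mod I x}"
  proof
    show "Units (ring_of_integers K Quot I) \<subseteq> cls I ` {x. unit_mod I x}"
    proof
      fix Z assume "Z \<in> Units (ring_of_integers K Quot I)"
      then obtain Y where XY: "Z \<in> cls I ` ints" "Y \<in> cls I ` ints"
        "Z \<otimes>\<^bsub>ring_of_integers K Quot I\<^esub> Y = \<one>\<^bsub>ring_of_integers K Quot I\<^esub>"
        unfolding Units_def carrier_Quot by blast
      then obtain x y where xy: "Z = cls I x" "Y = cls I y" "x \<in> ints" "y \<in> ints" by blast
      have "cls I (x * y) = cls I 1" using XY(3) unfolding xy one mult[OF xy(3,4)] .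
      then have "unit_mod I x" using xy unfolding cls_eq_iff[OF I] unit_mod_def by blast
      then show "Z \<in> cls I ` {x. unit_mod I x}" using xy by blast
    qed
    show "cls I ` {x. unit_mod I x} \<subseteq> Units (ring_of_integers K Quot I)"
    proof
      fix Z assume "Z \<in> cls I ` {x. unit_mod I x}"
      then obtain x y where x: "Z = cls I x" "x \<in> ints" "y \<in> ints" "x * y - 1 \<in> I"
        by (auto simp: unit_mod_def)
      have "cls I x \<otimes>\<^bsub>ring_of_integers K Quot I\<^esub> cls I y = \<one>\<^bsub>ring_of_integers K Quot I\<^esub>"
        "cls I y \<otimes>\<^bsub>ring_of_integers K Quot I\<^esub> cls I x = \<one>\<^bsub>ring_of_integers K Quot I\<^esub>"
        using x by (simp_all add: mult one cls_eq_iff[OF I] mult.commute)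
      then show "Z \<in> Units (ring_of_integers K Quot I)"
        unfolding Units_def carrier_Quot x(1) using x by blast
    qed
  qed
  also have "\<dots> = cls I ` S"
  proof
    show "cls I ` S \<subseteq> cls I ` {x. unit_mod I x}" using S by (auto simp: reduced_reps_def)
    show "cls I ` {x. unit_mod I x} \<subseteq> cls I ` S"
    proof
      fix Z assume "Z \<in> cls I ` {x. unit_mod I x}"
      then obtain x where x: "Z = cls I x" "unit_mod I x" by blast
      then obtain r where "r \<in> S" "x - r \<in> I" using S by (auto simp: reduced_reps_def)
      then show "Z \<in> cls I ` S" using cls_eq_iff[OF I] x by blast
    qed
  qed
  finally have U: "Units (ring_of_integers K Quot I) = cls I ` S" .
  have "inj_on (cls I) S"
    using reduced_reps_incongruent[OF I S] by (auto simp: inj_on_def cls_eq_iff[OF I] incongruent_def)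
  then show ?thesis unfolding ideal_phi_def U by (rule card_image)
qed

end

theorem theorem1p2:
  fixes K :: "complex set" and \<epsilon> :: real
  assumes "imaginary_quadratic_field K" and "\<epsilon> > 0"
  shows "\<exists>C::real. C > 0 \<and>
    (\<forall>\<aa> \<qq> \<alpha> S t.
       ideal \<aa> (ring_of_integers K) \<and> \<aa> \<noteq> {0} \<and>
       ideal \<qq> (ring_of_integers K) \<and> \<qq> \<noteq> {0} \<and>
       \<alpha> \<in> carrier (ring_of_integers K) \<and>
       ideals_coprime K \<aa> \<qq> \<and> coprime_to_ideal K \<alpha> \<qq> \<and>
       reduced_residue_system K \<qq> S \<and> (t::real) \<ge> 0 \<longrightarrow>
       \<bar>(\<Sum>\<rho>\<in>S. real (card {z \<in> \<aa>. z - \<alpha> * \<rho>\<^sup>2 \<in> \<qq> \<and> Re (z * cnj z) \<le> t}))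
          - 2 * pi * ideal_phi_star K \<qq>
              / (sqrt \<bar>real_of_int (discriminant K)\<bar> * real (ideal_norm K \<aa>)) * t\<bar>
       \<le> C * ((t / real (ideal_norm K \<aa>)) powr (1 / 3) * real (ideal_norm K \<qq>) powr (1 / 3 + \<epsilon>)
              + 2 ^ ideal_omega K \<qq> * real (ideal_norm K \<qq>) powr (1 / 2)))"
proof (cases "ring (ring_of_integers K)")
  \<comment> \<open>An \<open>ideal\<close> includes the ring axioms of its ambient structure, so in
    this case the implication is vacuous and any positive constant serves.\<close>
  case False
  then have "\<not> ideal I (ring_of_integers K)" for I by (auto simp: ideal_def)
  then show ?thesis by (intro exI[of _ 1]) auto
next
  case True
  interpret Q: imaginary_quadratic K by (intro imaginary_quadratic.intro assms(1) True)
  obtain \<omega> s n where \<omega>: "imaginary_quadratic_order \<omega> s n" "Q.OK = {of_int x + of_int y * \<omega> | x y. True}"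
    by (rule Q.OK_basis)
  interpret imaginary_quadratic_order \<omega> s n by (rule \<omega>(1))
  have carr: "{x \<in> K. algebraic_int x} = ints"
    using \<omega>(2) by (simp add: Q.OK_def ints_def pt_def)
  interpret ring_of_integers_basis \<omega> s n K
    by (intro ring_of_integers_basis.intro ring_of_integers_basis_axioms.intro \<omega>(1) True carr)
  obtain C where C: "C > 0" and est: "\<And>\<aa> \<qq> e \<alpha> S t. is_ideal \<aa> \<Longrightarrow> \<aa> \<noteq> {0} \<Longrightarrow> is_ideal \<qq> \<Longrightarrow> \<qq> \<noteq> {0} \<Longrightarrow> e \<in> \<aa> \<Longrightarrow> 1 - e \<in> \<qq> \<Longrightarrow>
      unit_mod \<qq> \<alpha> \<Longrightarrow> reduced_reps \<qq> S \<Longrightarrow> t \<ge> 0 \<Longrightarrow>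
      \<bar>(\<Sum>\<rho>\<in>S. real (card {z \<in> \<aa>. z - \<alpha> * \<rho>\<^sup>2 \<in> \<qq> \<and> (cmod z)\<^sup>2 \<le> t}))
         - real (card S) * pi / (real (nrm \<aa>) * real (nrm \<qq>) * Im \<omega>) * t\<bar>
      \<le> C * ((t / real (nrm \<aa>)) powr (1/3) * real (nrm \<qq>) powr (1/3 + \<epsilon>) + real (nrm \<qq>) powr (1/2))"
    by (rule square_class_count[OF assms(2)]) blast
  show ?thesis
  proof (rule exI[of _ C], rule conjI[OF C], intro allI impI, elim conjE)
    fix \<aa> \<qq> S :: "complex set" and \<alpha> :: complex and t :: real
    assume a: "ideal \<aa> (ring_of_integers K)" "\<aa> \<noteq> {0}" and q: "ideal \<qq> (ring_of_integers K)" "\<qq> \<noteq> {0}"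
      and \<alpha>: "\<alpha> \<in> carrier (ring_of_integers K)" and cop: "ideals_coprime K \<aa> \<qq>" "coprime_to_ideal K \<alpha> \<qq>"
      and S: "reduced_residue_system K \<qq> S" and t: "0 \<le> t"
    note ai = ideal_is_ideal[OF a(1)] and qi = ideal_is_ideal[OF q(1)]
    obtain e where e: "e \<in> \<aa>" "1 - e \<in> \<qq>" using coprime_idempotent_exists[OF cop(1)] .
    have u: "unit_mod \<qq> \<alpha>" using coprime_iff_unit_mod[OF qi, of \<alpha>] \<alpha> cop(2) unfolding carrier_ints by blast
    have red: "reduced_reps \<qq> S" by (rule reduced_residue_system_iff[OF qi S])
    have nq: "nrm \<qq> > 0" by (rule nrm_pos[OF qi q(2)])
    \<comment> \<open>\<open>ideal_phi\<close> is the size of any reduced residue system and the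
      root of the discriminant is 2 Im \<omega>, so the factor 2 cancels and both coefficients
      agree.\<close>
    have main: "2 * pi * ideal_phi_star K \<qq> / (sqrt \<bar>real_of_int (discriminant K)\<bar> * real (ideal_norm K \<aa>)) * t
        = real (card S) * pi / (real (nrm \<aa>) * real (nrm \<qq>) * Im \<omega>) * t"
      unfolding ideal_phi_star_def ideal_phi_eq[OF q(1) red] ideal_norm_eq[OF a] ideal_norm_eq[OF q] sqrt_discriminant
      by (simp add: mult_ac)
    have Re: "Re (z * cnj z) = (cmod z)\<^sup>2" for z unfolding cmod_power2 by (simp add: power2_eq_square)
    have "1 * real (nrm \<qq>) powr (1/2) \<le> 2 ^ ideal_omega K \<qq> * real (nrm \<qq>) powr (1/2)"
      by (intro mult_right_mono) auto
    then have "C * ((t / real (nrm \<aa>)) powr (1/3) * real (nrm \<qq>) powr (1/3 + \<epsilon>) + real (nrm \<qq>) powr (1/2)) \<le>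
        C * ((t / real (nrm \<aa>)) powr (1/3) * real (nrm \<qq>) powr (1/3 + \<epsilon>) + 2 ^ ideal_omega K \<qq> * real (nrm \<qq>) powr (1/2))"
      using C by (intro mult_left_mono add_left_mono) auto
    with est[OF ai a(2) qi q(2) e u red t]
    show "\<bar>(\<Sum>\<rho>\<in>S. real (card {z \<in> \<aa>. z - \<alpha> * \<rho>\<^sup>2 \<in> \<qq> \<and> Re (z * cnj z) \<le> t}))
          - 2 * pi * ideal_phi_star K \<qq>
              / (sqrt \<bar>real_of_int (discriminant K)\<bar> * real (ideal_norm K \<aa>)) * t\<bar>
       \<le> C * ((t / real (ideal_norm K \<aa>)) powr (1 / 3) * real (ideal_norm K \<qq>) powr (1 / 3 + \<epsilon>)
              + 2 ^ ideal_omega K \<qq> * real (ideal_norm K \<qq>) powr (1 / 2))"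
      unfolding main Re unfolding ideal_norm_eq[OF a] ideal_norm_eq[OF q] by linarith
  qed
qed

end
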